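(* Let $k\ge1$ be an odd integer, let $\chi$ be a non-principal even primitive Dirichlet character modulo $q$, and let $a,x>0$. Then \begin{align*} \sum_{n=1}^\infty\sigma_{k,\chi}(n) K_0(a\sqrt{nx})=&- \frac{ L(-k,\chi) }{4}\left( \log \left(\frac{8\pi}{a^2} \right) +\frac{ L'(-k,\chi)}{ L(-k,\chi)} -2\gamma \right)+\frac{ L(-k,\chi) }{4} \log x\\ &+(-1)^{\frac{k-1}{2}}\frac{k!\,q^k}{2 ({2\pi })^{k+1} } \tau(\chi) \sum_{n=1}^\infty \bar{\sigma}_{k, \bar{\chi}}(n) \left(\frac{1}{n^{k+1}}-\frac{1}{(n+ \frac{a^2qx}{16\pi^2} )^{k+1} } \right), \end{align*} where $\gamma$ is Euler's constant.
   Context: For a Dirichlet character $\chi$ and $z\in\mathbb{C}$: $\sigma_{z,\chi}(n)=\sum_{d\mid n}d^z\chi(d)$ and $\bar{\sigma}_{z,\chi}(n)=\sum_{d\mid n}d^z\chi(n/d)$. $\tau(\chi)=\sum_{h=1}^q\chi(h)e^{2\pi i h/q}$ is the Gauss sum, $L(s,\chi)$ the Dirichlet $L$-function, and $K_0$ the modified Bessel function of the second kind of order $0$. *)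

theory Defs
  imports "HOL-Complex_Analysis.Complex_Analysis"
begin

definition dirichlet_char :: "nat \<Rightarrow> (nat \<Rightarrow> complex) \<Rightarrow> bool" where
  "dirichlet_char q chi \<longleftrightarrow> q > 0 \<and>
     (\<forall>m n. chi (m * n) = chi m * chi n) \<and>
     (\<forall>n. chi (n + q) = chi n) \<and>
     (\<forall>n. chi n = 0 \<longleftrightarrow> \<not> coprime n q)"

definition principal_char :: "nat \<Rightarrow> (nat \<Rightarrow> complex) \<Rightarrow> bool" where
  "principal_char q chi \<longleftrightarrow> (\<forall>n. chi n = (if coprime n q then 1 else 0))"

text \<open>Primitive: chi is not induced by a character of any proper divisor d of q,
  i.e. chi is not constant on residue classes mod d among integers coprime to q.\<close>
definition primitive_char :: "nat \<Rightarrow> (nat \<Rightarrow> complex) \<Rightarrow> bool" where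
  "primitive_char q chi \<longleftrightarrow>
     (\<forall>d. d dvd q \<and> d < q \<longrightarrow>
        \<not> (\<forall>m n. coprime m q \<and> coprime n q \<and> m mod d = n mod d \<longrightarrow> chi m = chi n))"

text \<open>Even character: chi(-1) = 1, where -1 is represented by q - 1.\<close>
definition even_char :: "nat \<Rightarrow> (nat \<Rightarrow> complex) \<Rightarrow> bool" where
  "even_char q chi \<longleftrightarrow> chi (q - 1) = 1"

text \<open>Dirichlet L-function: the (unique) entire function that agrees with the
  Dirichlet series on Re s > 1 (meaningful for non-principal characters).\<close>
definition dirichlet_L :: "(nat \<Rightarrow> complex) \<Rightarrow> complex \<Rightarrow> complex" where
  "dirichlet_L chi = (THE f. f holomorphic_on UNIV \<and>
     (\<forall>s. Re s > 1 \<longrightarrow> f s = (\<Sum>n. chi (Suc n) / of_nat (Suc n) powr s)))"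

definition gauss_sum :: "nat \<Rightarrow> (nat \<Rightarrow> complex) \<Rightarrow> complex" where
  "gauss_sum q chi = (\<Sum>h=1..q. chi h * exp (2 * pi * \<i> * of_nat h / of_nat q))"

definition sigma_chi :: "nat \<Rightarrow> (nat \<Rightarrow> complex) \<Rightarrow> nat \<Rightarrow> complex" where
  "sigma_chi k chi n = (\<Sum>d | d dvd n. of_nat d ^ k * chi d)"

definition sigma_bar_chi :: "nat \<Rightarrow> (nat \<Rightarrow> complex) \<Rightarrow> nat \<Rightarrow> complex" where
  "sigma_bar_chi k chi n = (\<Sum>d | d dvd n. of_nat d ^ k * chi (n div d))"

definition bessel_K0 :: "real \<Rightarrow> real" where
  "bessel_K0 x = integral {0..} (\<lambda>t. exp (- x * cosh t))"

end

theory Submission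
  imports Defs "HOL-Real_Asymp.Real_Asymp"
begin

text \<open>
  Put \<open>P(u) = \<Sum> d^k \<chi>(d) exp(-d u)\<close> and \<open>X = a^2 x / 4\<close>. Since
  \<open>2 K\<^sub>0(2 sqrt(\<alpha> \<beta>)) = \<integral> exp(-\<alpha> u - \<beta>/u) du/u\<close> over the half-line, the Bessel series equals
  \<open>1/2 \<integral> P(u) / (exp(X/u) - 1) du/u\<close>. The Fourier expansion of a primitive character and the partial
  fractions of the cotangent write \<open>P(u)\<close> as \<open>\<tau>(\<chi>) k! / q\<close> times the sum over \<open>n\<close> of the conjugate of
  \<open>\<chi>(n)\<close> times \<open>(u + i c\<^sub>n)^(-k-1) + (u - i c\<^sub>n)^(-k-1)\<close>, where \<open>c\<^sub>n = 2 \<pi> n / q\<close>. Expanding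
  \<open>1/(exp v - 1) = 1/v - 1/2 + \<Sum> 2v/(v^2 + 4 \<pi>^2 r^2)\<close> at \<open>v = X/u\<close> produces Poisson kernels, whose
  integrals against the pole terms are the terms of the dual series; the part \<open>1/v\<close> contributes
  nothing because \<open>\<integral> P = 0\<close>. The part \<open>-1/2\<close> diverges logarithmically at \<open>0\<close>. It is regularised by
  subtracting \<open>P(0) c^2/(c^2 + u^2)\<close> with \<open>c = X/(2 \<pi> N)\<close>, for which the kernel sums are exactly
  harmonic numbers, and letting \<open>N\<close> tend to infinity. The numbers \<open>L(-k,\<chi>)\<close> and \<open>L'(-k,\<chi>)\<close> enter
  through the Mellin transform \<open>\<integral> P(u) u^(s-1) du = \<Gamma>(s) L(s-k,\<chi>)\<close> near \<open>s = 0\<close>, which also provides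
  the analytic continuation of \<open>L\<close>.
\<close>

section \<open>Gauss sums\<close>

text \<open>The obstacle is that P(0) = L(-k, chi) does not vanish. Partial sums of the kernel
  series are only bounded by 1/(2 u), so sum and integral cannot be exchanged by domination for P
  itself, while P minus a multiple of the cutoff vanishes linearly at 0. The cutoff is itself a
  scaled Poisson kernel: against the kernel at b its integral is (pi/2) c/(b + c), and for b = X/(2
  pi r), c = X/(2 pi N) this is (pi/2) r/(N + r). The defects 1/r - 1/(N + r) then add up to a
  harmonic number. Changing the cutoff costs a multiple of ln c, which contains -ln N, so Euler's
  constant arises once here and once more as -Gamma'(1) in the Mellin transform; hence the 2 gamma
  of the formula. Parity enters three times: chi even merges the two half-series of poles, k + 1
  even makes conjugate poles contribute equally at 0, and k - 1 even makes an antiderivative of P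
  vanish at 0, hence also the integral of P. The formula divides by L(-k, chi), so nonvanishing is
  proved as well: P(0) is a nonzero multiple of the value at k + 1 for the conjugate
  character.\<close>

definition unity_root :: "nat \<Rightarrow> int \<Rightarrow> complex" where
  "unity_root q m = cis (2 * pi * of_int m / of_nat q)"

lemma unity_root_add: "unity_root q (m + n) = unity_root q m * unity_root q n"
  by (simp add: unity_root_def cis_mult add_divide_distrib distrib_left)

lemma unity_root_0 [simp]: "unity_root q 0 = 1"
  by (simp add: unity_root_def)

lemma unity_root_eq_1_iff:
  assumes "q > 0"
  shows "unity_root q m = 1 \<longleftrightarrow> int q dvd m"
proof
  assume "unity_root q m = 1"
  then have "exp (\<i> * complex_of_real (2 * pi * of_int m / of_nat q)) = 1"
    by (simp add: unity_root_def cis_conv_exp)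
  then obtain n :: int where "2 * pi * of_int m / of_nat q = of_int (2 * n) * pi"
    by (subst (asm) exp_eq_1) auto
  then have "real_of_int m = real_of_int (n * int q)"
    using assms by (simp add: field_simps)
  then have "m = n * int q" by linarith
  then show "int q dvd m" by simp
next
  assume "int q dvd m"
  then obtain n where "m = int q * n" by auto
  then show "unity_root q m = 1"
    using assms cis_multiple_2pi[of "of_int n"] by (simp add: unity_root_def mult.assoc)
qed

lemma unity_root_power: "unity_root q m ^ n = unity_root q (int n * m)"
  by (induction n) (simp_all add: unity_root_add distrib_right)

lemma unity_root_cong:
  assumes "q > 0" "int q dvd m - n"
  shows "unity_root q m = unity_root q n"
  using unity_root_add[of q "m - n" n] unity_root_eq_1_iff[of q "m - n"] assms by simp

lemma sum_unity_root:
  assumes "q > 0"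
  shows "(\<Sum>j<q. unity_root q (int j * m)) = (if int q dvd m then of_nat q else 0)"
proof (cases "int q dvd m")
  case True
  then have "unity_root q (int j * m) = 1" for j
    using assms unity_root_eq_1_iff[of q "int j * m"] by simp
  then show ?thesis using True by simp
next
  case False
  then have ne: "unity_root q m \<noteq> 1" using assms unity_root_eq_1_iff by blast
  have "unity_root q m ^ q = 1"
    using assms unity_root_eq_1_iff[of q "int q * m"] by (simp add: unity_root_power)
  moreover have "(\<Sum>j<q. unity_root q m ^ j) = (1 - unity_root q m ^ q) / (1 - unity_root q m)"
    using ne by (simp add: sum_gp_strict)
  ultimately show ?thesis using False by (simp add: unity_root_power)
qed

text \<open>Multiplication by a unit is injective on the residues below \<open>q\<close>, hence
  permutes them; \<open>per\<close> makes the reduction modulo \<open>q\<close> harmless.\<close>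

lemma sum_mult_coprime_mod:
  fixes f :: "nat \<Rightarrow> 'a::comm_monoid_add"
  assumes "q > 0" "coprime m q" and per: "\<And>h. f (h mod q) = f h"
  shows "(\<Sum>h<q. f (m * h)) = (\<Sum>h<q. f h)"
proof -
  have inj: "inj_on (\<lambda>h. (m * h) mod q) {..<q}"
  proof (rule linorder_inj_onI)
    fix x y assume xy: "x < y" "x \<in> {..<q}" "y \<in> {..<q}"
    show "m * x mod q \<noteq> m * y mod q"
    proof
      assume "m * x mod q = m * y mod q"
      then have "q dvd m * y - m * x" using xy by (subst mod_eq_dvd_iff_nat [symmetric]) auto
      then have "q dvd m * (y - x)" by (simp add: diff_mult_distrib2)
      then have "q dvd y - x"
        using assms(2) by (simp add: coprime_commute coprime_dvd_mult_right_iff)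
      then show False using xy by (auto dest: dvd_imp_le)
    qed
  qed auto
  have "(\<lambda>h. (m * h) mod q) ` {..<q} = {..<q}"
    using inj assms(1) by (intro endo_inj_surj) auto
  then have "bij_betw (\<lambda>h. (m * h) mod q) {..<q} {..<q}"
    using inj by (simp add: bij_betw_def)
  then have "(\<Sum>h<q. f (m * h mod q)) = (\<Sum>h<q. f h)"
    by (rule sum.reindex_bij_betw)
  then show ?thesis using per by simp
qed

lemma dvd_mod_diff: "int q dvd int (h mod q) - int h"
  by (subst mod_eq_dvd_iff [symmetric]) (simp add: zmod_int)

section \<open>Characters modulo q: absolute values, separability of Gauss sums, Fourier
  inversion\<close>

locale dirichlet_character =
  fixes q :: nat and chi :: "nat \<Rightarrow> complex"
  assumes char: "dirichlet_char q chi"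
begin

lemma q_pos: "q > 0" using char by (simp add: dirichlet_char_def)

lemma chi_mult: "chi (m * n) = chi m * chi n"
  using char by (simp add: dirichlet_char_def)

lemma chi_eq_0_iff: "chi n = 0 \<longleftrightarrow> \<not> coprime n q"
  using char by (simp add: dirichlet_char_def)

lemma chi_add_mult: "chi (n + m * q) = chi n"
proof (induction m)
  case (Suc m)
  have "chi ((n + m * q) + q) = chi (n + m * q)"
    using char unfolding dirichlet_char_def by blast
  then show ?case using Suc by (simp add: algebra_simps)
qed simp

lemma chi_mod: "chi (n mod q) = chi n"
  using chi_add_mult[of "n mod q" "n div q"] by simp

lemma chi_1: "chi 1 = 1"
  using chi_mult[of 1 1] chi_eq_0_iff[of 1] by simp

lemma chi_power: "chi (n ^ m) = chi n ^ m"
proof (induction m)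
  case 0
  then show ?case using chi_1 by simp
qed (simp add: chi_mult)

text \<open>By the pigeonhole principle two powers of \<open>n\<close> agree modulo
  \<open>q\<close>, so \<open>chi n\<close> is a root of unity.\<close>

lemma norm_chi:
  assumes "coprime n q"
  shows "norm (chi n) = 1"
proof -
  have inj: "\<not> inj_on (\<lambda>i. n ^ i mod q) {..q}"
  proof
    assume "inj_on (\<lambda>i. n ^ i mod q) {..q}"
    then have "card {..q} \<le> card {..<q}"
      by (rule card_inj_on_le) (auto simp: q_pos)
    then show False by simp
  qed
  then obtain i j where ij: "i < j" "n ^ i mod q = n ^ j mod q"
    unfolding inj_on_def by (metis linorder_neqE_nat)
  then have "chi n ^ i = chi n ^ j"
    using chi_mod[of "n ^ i"] chi_mod[of "n ^ j"] by (simp add: chi_power)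
  also have "\<dots> = chi n ^ i * chi n ^ (j - i)"
    using ij by (simp flip: power_add)
  finally have "chi n ^ (j - i) = 1"
    using assms chi_eq_0_iff[of n] by simp
  then have "norm (chi n) ^ (j - i) = 1" by (metis norm_power norm_one)
  then show ?thesis using ij power_eq_imp_eq_base[of "norm (chi n)" "j - i" 1] by simp
qed

lemma norm_chi_le: "norm (chi n) \<le> 1"
  using norm_chi[of n] chi_eq_0_iff[of n] by (cases "coprime n q") auto

lemma chi_times_cnj: "coprime n q \<Longrightarrow> chi n * cnj (chi n) = 1"
  using norm_chi[of n] by (simp add: complex_norm_square[symmetric])

lemma gauss_sum_eq: "gauss_sum q chi = (\<Sum>h<q. chi h * unity_root q (int h))"
proof -
  let ?f = "\<lambda>h. chi h * unity_root q (int h)"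
  have "gauss_sum q chi = (\<Sum>h=1..q. ?f h)"
    unfolding gauss_sum_def unity_root_def cis_conv_exp
    by (intro sum.cong refl arg_cong2[of _ _ _ _ "(*)"] arg_cong[of _ _ exp]) simp
  also have "\<dots> = (\<Sum>h\<in>{1..<q}. ?f h) + ?f q"
    using q_pos by (simp add: sum.last_plus atLeastLessThanSuc_atLeastAtMost[symmetric])
  also have "?f q = ?f 0"
    using chi_mod[of q] unity_root_eq_1_iff[of q "int q"] q_pos by simp
  also have "(\<Sum>h\<in>{1..<q}. ?f h) + ?f 0 = (\<Sum>h<q. ?f h)"
    using q_pos by (simp add: lessThan_atLeast0 sum.atLeast_Suc_lessThan)
  finally show ?thesis .
qed

text \<open>For \<open>j\<close> coprime to \<open>q\<close> the factor comes out by the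
  substitution h -> j h. Otherwise the frequency \<open>j\<close> sees \<open>h\<close> only modulo
  a proper divisor of \<open>q\<close>, and primitivity forces the sum to vanish, as
  \<open>chi j\<close> does.\<close>

lemma separable_sum:
  assumes "primitive_char q chi"
  shows "(\<Sum>h<q. chi h * unity_root q (int h * int j)) = gauss_sum q chi * cnj (chi j)"
proof (cases "coprime j q")
  case True
  have per: "chi (h mod q) * unity_root q (int (h mod q)) = chi h * unity_root q (int h)" for h
  proof -
    have "int q dvd int (h mod q) - int h" by (rule dvd_mod_diff)
    then show ?thesis using q_pos unity_root_cong[of q "int (h mod q)" "int h"]
      by (simp add: chi_mod)
  qed
  have "gauss_sum q chi = (\<Sum>h<q. chi (j * h) * unity_root q (int (j * h)))"
    unfolding gauss_sum_eq
    using sum_mult_coprime_mod[of q j "\<lambda>h. chi h * unity_root q (int h)"] q_pos True per by simp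
  also have "\<dots> = chi j * (\<Sum>h<q. chi h * unity_root q (int h * int j))"
    by (simp add: sum_distrib_left chi_mult mult_ac)
  finally have "gauss_sum q chi * cnj (chi j)
      = (chi j * cnj (chi j)) * (\<Sum>h<q. chi h * unity_root q (int h * int j))" by simp
  then show ?thesis using chi_times_cnj[OF True] by simp
next
  case False
  \<comment> \<open>\<open>unity_root q (h * j)\<close> depends on \<open>h\<close> only modulo
    \<open>d\<close>, the quotient of \<open>q\<close> by this gcd. Primitivity then supplies two
    units congruent modulo \<open>d\<close> with different character values.\<close>
  define g where "g = gcd j q"
  define d where "d = q div g"
  have g: "g > 1"
    using False q_pos gcd_pos_nat[of j q] unfolding g_def coprime_iff_gcd_eq_1 by linarith
  have q: "q = d * g" by (simp add: d_def g_def)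
  then have "d dvd q" by (rule dvdI)
  moreover have "d < q" using g q_pos by (simp add: d_def)
  ultimately obtain m n where mn: "coprime m q" "coprime n q" "m mod d = n mod d" "chi m \<noteq> chi n"
    using assms unfolding primitive_char_def by blast
  \<comment> \<open>Twisting the frequency by a unit \<open>l\<close> divides the sum by
    \<open>chi l\<close>. The units \<open>m\<close> and \<open>n\<close> give the same twisted sum
    although \<open>chi m\<close> and \<open>chi n\<close> differ, so that sum must be 0.\<close>
  define W where "W l = (\<Sum>h<q. chi h * unity_root q (int h * int (l * j)))" for l
  have shift: "chi l * W l = W 1" if "coprime l q" for l
  proof -
    have per: "chi (h mod q) * unity_root q (int (h mod q) * int j) = chi h * unity_root q (int h * int j)" for h
    proof -
      have "int q dvd int (h mod q) - int h" by (rule dvd_mod_diff)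
      then have "int q dvd int (h mod q) * int j - int h * int j"
        by (subst left_diff_distrib [symmetric]) (rule dvd_mult2)
      then show ?thesis using q_pos unity_root_cong[of q "int (h mod q) * int j" "int h * int j"]
        by (simp add: chi_mod)
    qed
    have "W 1 = (\<Sum>h<q. chi (l * h) * unity_root q (int (l * h) * int j))"
      unfolding W_def
      using sum_mult_coprime_mod[of q l "\<lambda>h. chi h * unity_root q (int h * int j)"] q_pos that per
      by simp
    also have "\<dots> = chi l * W l"
      unfolding W_def by (simp add: sum_distrib_left chi_mult mult_ac)
    finally show ?thesis by simp
  qed
  have "int d dvd int m - int n"
    using mn(3) by (subst mod_eq_dvd_iff [symmetric]) (simp flip: zmod_int)
  moreover have "int g dvd int j" by (simp add: g_def)
  ultimately have "int q dvd (int m - int n) * int j"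
    unfolding q of_nat_mult by (rule mult_dvd_mono)
  then have "int q dvd int h * int (m * j) - int h * int (n * j)" for h
    using dvd_mult[of "int q" "(int m - int n) * int j" "int h"] by (simp add: algebra_simps)
  then have "unity_root q (int h * int (m * j)) = unity_root q (int h * int (n * j))" for h
    using q_pos by (intro unity_root_cong)
  then have "W m = W n"
    unfolding W_def by simp
  then have "(chi m - chi n) * W m = 0"
    using shift[OF mn(1)] shift[OF mn(2)] by (simp add: algebra_simps)
  then have "W 1 = 0" using shift[OF mn(1)] mn(4) by auto
  then show ?thesis
    using False chi_eq_0_iff[of j] by (simp add: W_def)
qed

text \<open>The Gauss sum turns each \<open>cnj (chi j)\<close> into a sum over \<open>h\<close>,
  and orthogonality of the additive characters selects the \<open>h\<close> congruent to
  \<open>d\<close> modulo \<open>q\<close>.\<close>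

lemma chi_fourier:
  assumes "primitive_char q chi"
  shows "chi d = gauss_sum q chi / of_nat q * (\<Sum>j<q. cnj (chi j) * unity_root q (- (int j * int d)))"
proof -
  have "gauss_sum q chi * (\<Sum>j<q. cnj (chi j) * unity_root q (- (int j * int d)))
      = (\<Sum>j<q. (\<Sum>h<q. chi h * unity_root q (int h * int j)) * unity_root q (- (int j * int d)))"
    using separable_sum[OF assms] by (simp add: sum_distrib_left mult_ac)
  also have "\<dots> = (\<Sum>j<q. \<Sum>h<q. chi h * unity_root q (int j * (int h - int d)))"
    unfolding sum_distrib_right mult.assoc unity_root_add[symmetric]
    by (simp add: right_diff_distrib mult.commute)
  also have "\<dots> = (\<Sum>h<q. chi h * (\<Sum>j<q. unity_root q (int j * (int h - int d))))"
    by (subst sum.swap) (simp add: sum_distrib_left)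
  also have "\<dots> = (\<Sum>h<q. chi h * (if int q dvd int h - int d then of_nat q else 0))"
    using q_pos by (simp add: sum_unity_root)
  also have "\<dots> = (\<Sum>h<q. if h = d mod q then of_nat q * chi d else 0)"
  proof (intro sum.cong refl)
    fix h assume "h \<in> {..<q}"
    then have "int q dvd int h - int d \<longleftrightarrow> h = d mod q"
      by (subst mod_eq_dvd_iff [symmetric]) (auto simp flip: zmod_int)
    then show "chi h * (if int q dvd int h - int d then of_nat q else 0)
        = (if h = d mod q then of_nat q * chi d else 0)"
      by (auto simp: chi_mod)
  qed
  also have "\<dots> = of_nat q * chi d" using q_pos by simp
  finally show ?thesis using q_pos by (simp add: field_simps)
qed

lemma chi_reflect:
  assumes "even_char q chi" "j \<le> q"
  shows "chi (q - j) = chi j"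
proof -
  have "chi ((q - 1) * j) = chi j"
    using assms by (simp add: chi_mult even_char_def)
  moreover have "((q - 1) * j) mod q = (q - j) mod q"
  proof (cases "j = 0")
    case False
    have "(q - 1) * j = (q - j) + (j - 1) * q"
    proof -
      obtain l where l: "q = j + l" using assms(2) le_Suc_ex by blast
      obtain i where i: "j = Suc i" using False not0_implies_Suc by blast
      show ?thesis using l i by (simp add: algebra_simps)
    qed
    then show ?thesis by simp
  qed simp
  ultimately show ?thesis by (metis chi_mod)
qed

text \<open>Only for \<open>q = 1\<close> is 0 a unit, and then the character is principal. Thanks
  to this value all later series may run from index 0, although \<open>pole 0 = 0\<close>.\<close>

lemma chi_0:
  assumes "\<not> principal_char q chi"
  shows "chi 0 = 0"
proof (rule ccontr)
  assume "chi 0 \<noteq> 0"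
  then have "q = 1" using chi_eq_0_iff[of 0] by simp
  then have "chi n = 1" for n
    using chi_mod[of n] chi_mod[of 1] chi_1 by simp
  then show False using assms \<open>q = 1\<close> by (simp add: principal_char_def)
qed

lemma sum_chi_eq_0:
  assumes "\<not> principal_char q chi"
  shows "(\<Sum>h<q. chi h) = 0"
proof -
  obtain n where n: "chi n \<noteq> (if coprime n q then 1 else 0)"
    using assms unfolding principal_char_def by blast
  then have cop: "coprime n q" "chi n \<noteq> 1" using chi_eq_0_iff[of n] by (auto split: if_splits)
  have "(\<Sum>h<q. chi (n * h)) = (\<Sum>h<q. chi h)"
    using cop q_pos by (intro sum_mult_coprime_mod) (auto simp: chi_mod)
  then have "(chi n - 1) * (\<Sum>h<q. chi h) = 0"
    by (simp add: chi_mult sum_distrib_left[symmetric] left_diff_distrib)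
  then show ?thesis using cop by simp
qed

end

section \<open>The Lipschitz formula\<close>

text \<open>Logarithmic derivative of Euler's reflection formula: Gamma z Gamma(1 - z) sin(pi z) is
  constant off the integers. The sine is kept as a factor to avoid a quotient.\<close>

lemma Digamma_reflection:
  fixes w :: complex
  assumes "w \<notin> \<int>"
  shows "(Digamma w - Digamma (1 - w)) * sin (of_real pi * w) = - (of_real pi * cos (of_real pi * w))"
proof -
  have w: "w \<notin> \<int>\<^sub>\<le>\<^sub>0" "1 - w \<notin> \<int>\<^sub>\<le>\<^sub>0"
    using assms nonpos_Ints_subset_Ints Ints_diff[of 1 "1 - w"] by auto
  let ?f = "\<lambda>z. Gamma z * Gamma (1 - z) * sin (of_real pi * z)"
  let ?D = "Gamma w * Gamma (1 - w) * ((Digamma w - Digamma (1 - w)) * sin (of_real pi * w)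
      + of_real pi * cos (of_real pi * w))"
  have "(?f has_field_derivative ?D) (at w)"
    using w by (auto intro!: derivative_eq_intros simp: algebra_simps)
  moreover have "(?f has_field_derivative 0) (at w)"
  proof (rule has_field_derivative_transform_within_open)
    show "((\<lambda>_. of_real pi) has_field_derivative 0) (at w)" by simp
    show "open (- \<int> :: complex set)" by (simp add: open_Compl closed_Ints)
    show "w \<in> - \<int>" using assms by simp
    fix z :: complex assume z: "z \<in> - \<int>"
    then have "sin (of_real pi * z) \<noteq> 0"
      by (auto simp: sin_eq_0)
    then show "of_real pi = ?f z"
      using Gamma_reflection_complex[of z] by simp
  qed
  ultimately have "?D = 0" by (rule DERIV_unique)
  moreover have "Gamma w \<noteq> 0" "Gamma (1 - w) \<noteq> 0"
    using w by (simp_all add: Gamma_eq_zero_iff)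
  ultimately show ?thesis by (simp add: add_eq_0_iff)
qed

section \<open>Geometric series weighted by powers\<close>

definition geo_moment :: "nat \<Rightarrow> complex \<Rightarrow> complex" where
  "geo_moment k z = (\<Sum>d. of_nat d ^ k * exp (- of_nat d * z))"

lemma power_div_fact_le_exp:
  fixes y :: real
  assumes "y \<ge> 0"
  shows "y ^ n / fact n \<le> exp y"
proof -
  have "(\<lambda>n. y ^ n / fact n) sums exp y"
    using exp_converges[of y] by (simp add: divide_inverse mult.commute)
  then show ?thesis
    using sum_le_suminf[of "\<lambda>n. y ^ n / fact n" "{n}"] assms by (simp add: sums_iff)
qed

lemma exp_minus_le_power:
  fixes y :: real
  assumes "y > 0"
  shows "exp (- y) \<le> fact n / y ^ n"
  using power_div_fact_le_exp[of y n] assms by (simp add: exp_minus field_simps)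

lemma summable_power_exp:
  fixes x :: real
  assumes "x > 0"
  shows "summable (\<lambda>d. real d ^ k * exp (- real d * x))"
proof (rule summable_comparison_test_ev)
  show "\<forall>\<^sub>F d in sequentially. norm (real d ^ k * exp (- real d * x))
      \<le> (fact (k + 2) / x ^ (k + 2)) * inverse (real d ^ 2)"
    using eventually_gt_at_top[of 0]
  proof eventually_elim
    case (elim d)
    have "exp (- (real d * x)) \<le> fact (k + 2) / (real d * x) ^ (k + 2)"
      using elim assms by (intro exp_minus_le_power) simp
    then have "real d ^ k * exp (- (real d * x)) \<le> real d ^ k * (fact (k + 2) / (real d * x) ^ (k + 2))"
      by (intro mult_left_mono) auto
    also have "\<dots> = (fact (k + 2) / x ^ (k + 2)) * inverse (real d ^ 2)"
      using elim assms by (simp add: power_mult_distrib power_add power2_eq_square divide_simps del: fact_Suc)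
    finally show ?case by simp
  qed
  show "summable (\<lambda>d. (fact (k + 2) / x ^ (k + 2)) * inverse (real d ^ 2))"
    by (intro summable_mult inverse_power_summable) simp
qed

lemma norm_power_exp:
  "norm (of_nat d ^ k * exp (- of_nat d * z) :: complex) = real d ^ k * exp (- real d * Re z)"
  by (simp add: norm_mult norm_power)

lemma sums_geo_moment:
  assumes "Re z > 0"
  shows "(\<lambda>d. of_nat d ^ k * exp (- of_nat d * z)) sums geo_moment k z"
  unfolding geo_moment_def
proof (rule summable_sums, rule summable_norm_cancel)
  show "summable (\<lambda>d. norm (of_nat d ^ k * exp (- of_nat d * z)))"
    unfolding norm_power_exp using summable_power_exp[OF assms] .
qed

lemma has_field_derivative_geo_moment:
  assumes "Re z > 0"
  shows "(geo_moment k has_field_derivative - geo_moment (Suc k) z) (at z)"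
proof -
  \<comment> \<open>Half the real part leaves an open half-plane around \<open>z\<close> on which a
    single real series dominates all the differentiated terms.\<close>
  define s where "s = Re z / 2"
  have s: "s > 0" using assms by (simp add: s_def)
  let ?S = "{w. Re w > s}"
  have S: "convex ?S" "open ?S" "z \<in> ?S"
    using assms convex_halfspace_Re_gt[of s] open_halfspace_Re_gt[of s] by (simp_all add: s_def)
  have "((\<lambda>x. \<Sum>d. of_nat d ^ k * exp (- of_nat d * x)) has_field_derivative
      (\<Sum>d. - (of_nat d ^ Suc k * exp (- of_nat d * z)))) (at z)"
  proof (rule has_field_derivative_series'(2)[where S = ?S and ?x0.0 = z])
    fix n x
    show "((\<lambda>x. of_nat n ^ k * exp (- of_nat n * x)) has_field_derivative
       - (of_nat n ^ Suc k * exp (- of_nat n * x))) (at x within ?S)"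
      by (auto intro!: derivative_eq_intros)
  next
    show "uniformly_convergent_on ?S (\<lambda>n x. \<Sum>d<n. - (of_nat d ^ Suc k * exp (- of_nat d * x
        :: complex)))"
    proof (rule Weierstrass_m_test')
      fix d :: nat and x assume "x \<in> ?S"
      then show "norm (- (of_nat d ^ Suc k * exp (- of_nat d * x))) \<le> real d ^ Suc k * exp (- real d * s)"
        unfolding norm_minus_cancel norm_power_exp by (intro mult_left_mono) (auto intro!: mult_left_mono)
    qed (rule summable_power_exp[OF s])
  next
    show "summable (\<lambda>d. of_nat d ^ k * exp (- of_nat d * z))"
      using sums_geo_moment[OF assms] sums_summable by blast
    show "z \<in> interior ?S" using S by (simp add: interior_open)
  qed (use S in auto)
  moreover have "(\<Sum>d. - (of_nat d ^ Suc k * exp (- of_nat d * z))) = - geo_moment (Suc k) z"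
    using sums_geo_moment[OF assms, of "Suc k"] by (intro sums_unique[symmetric] sums_minus)
  ultimately show ?thesis by (simp add: geo_moment_def[abs_def])
qed

text \<open>The summand 1 is the term \<open>d = 0\<close>, present because
  \<open>0 ^ 0 = 1\<close>. For order at least 1 that term vanishes.\<close>

lemma geo_moment_0:
  assumes "Re z > 0"
  shows "geo_moment 0 z = 1 + 1 / (exp z - 1)"
proof -
  have n: "norm (exp (- z)) < 1" using assms by simp
  have "geo_moment 0 z = (\<Sum>d. exp (- z) ^ d)"
    by (simp add: geo_moment_def exp_of_nat_mult[symmetric])
  also have "\<dots> = 1 / (1 - exp (- z))" using n by (rule suminf_geometric)
  also have "\<dots> = 1 + 1 / (exp z - 1)"
  proof -
    have "norm (exp z) > norm (1 :: complex)" using assms by simp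
    then have "exp z \<noteq> 1" by (metis less_irrefl)
    then show ?thesis by (simp add: exp_minus field_simps)
  qed
  finally show ?thesis .
qed

text \<open>In the lower half-plane the cotangent is a geometric series in exp(-2 pi i w), since
  there 2 pi i w has positive real part.\<close>

lemma Digamma_reflection_geo:
  fixes w :: complex
  assumes "Im w < 0"
  shows "Digamma w - Digamma (1 - w) = - 2 * of_real pi * \<i> * (geo_moment 0 (2 * of_real pi * \<i> * w) - 1 / 2)"
proof -
  define E where "E = exp (\<i> * (of_real pi * w))"
  have E2: "exp (2 * of_real pi * \<i> * w) = E\<^sup>2"
    by (simp add: E_def power2_eq_square exp_add[symmetric] algebra_simps)
  have Re: "Re (2 * of_real pi * \<i> * w) > 0" using assms by (simp add: mult_less_0_iff)
  then have "norm (exp (2 * of_real pi * \<i> * w)) > 1" by simp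
  then have ne: "E\<^sup>2 \<noteq> 1" unfolding E2 by auto
  have E0: "E \<noteq> 0" by (simp add: E_def)
  have "w \<notin> \<int>" using assms by (auto elim!: Ints_cases)
  from Digamma_reflection[OF this]
  have "(Digamma w - Digamma (1 - w)) * ((E - 1 / E) / (2 * \<i>)) = - (of_real pi * ((E + 1 / E) / 2))"
    by (simp add: sin_exp_eq cos_exp_eq E_def exp_minus inverse_eq_divide)
  then have "(Digamma w - Digamma (1 - w)) * (E\<^sup>2 - 1) = - (of_real pi * \<i> * (E\<^sup>2 + 1))"
  proof -
    assume "(Digamma w - Digamma (1 - w)) * ((E - 1 / E) / (2 * \<i>)) = - (of_real pi * ((E + 1 / E) / 2))"
    then have "(Digamma w - Digamma (1 - w)) * ((E - 1 / E) / (2 * \<i>)) * (2 * \<i> * E)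
        = - (of_real pi * ((E + 1 / E) / 2)) * (2 * \<i> * E)" by simp
    moreover have "(E - 1 / E) / (2 * \<i>) * (2 * \<i> * E) = E\<^sup>2 - 1" "(E + 1 / E) / 2 * (2 *
        \<i> * E) = \<i> * (E\<^sup>2 + 1)"
      using E0 by (simp_all add: field_simps power2_eq_square)
    ultimately show ?thesis by (metis (no_types, lifting) mult.assoc mult_minus_left)
  qed
  then have "Digamma w - Digamma (1 - w) = - (of_real pi * \<i> * (E\<^sup>2 + 1)) / (E\<^sup>2 - 1)"
    using ne by (simp add: field_simps)
  also have "\<dots> = - 2 * of_real pi * \<i> * (1 + 1 / (E\<^sup>2 - 1) - 1 / 2)"
    using ne by (simp add: field_simps)
  finally show ?thesis using geo_moment_0[OF Re] by (simp add: E2)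
qed

text \<open>Repeated differentiation of the digamma case; its additive constant disappears at the
  first derivative.\<close>

lemma Polygamma_reflection_geo:
  fixes w :: complex
  assumes "Im w < 0"
  shows "Polygamma k w - (- 1) ^ k * Polygamma k (1 - w) =
    (- 2 * of_real pi * \<i>) ^ Suc k * geo_moment k (2 * of_real pi * \<i> * w) + (if k = 0 then of_real
        pi * \<i> else 0)"
  using assms
proof (induction k arbitrary: w)
  case 0
  then show ?case using Digamma_reflection_geo[of w] by (simp add: algebra_simps)
next
  case (Suc k)
  let ?l = "\<lambda>w. Polygamma k w - (- 1) ^ k * Polygamma k (1 - w)"
  let ?r = "\<lambda>w. (- 2 * of_real pi * \<i>) ^ Suc k * geo_moment k (2 * of_real pi * \<i> * w)
     + (if k = 0 then of_real pi * \<i> else 0)"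
  have w: "w \<notin> \<int>\<^sub>\<le>\<^sub>0" "1 - w \<notin> \<int>\<^sub>\<le>\<^sub>0"
    using Suc.prems by (auto elim!: nonpos_Ints_cases simp: complex_eq_iff)
  have Re: "Re (2 * of_real pi * \<i> * w) > 0" using Suc.prems by (simp add: mult_less_0_iff)
  have "(?l has_field_derivative (Polygamma (Suc k) w - (- 1) ^ Suc k * Polygamma (Suc k) (1 - w))) (at w)"
    using w by (auto intro!: derivative_eq_intros)
  moreover have "(?r has_field_derivative (- 2 * of_real pi * \<i>) ^ Suc (Suc k) * geo_moment (Suc k) (2
      * of_real pi * \<i> * w)) (at w)"
    by (rule derivative_eq_intros refl
          DERIV_chain2[where f = "geo_moment k" and g = "\<lambda>w. 2 * of_real pi * \<i> * w",
            OF has_field_derivative_geo_moment[OF Re]])+ simp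
  then have "(?l has_field_derivative (- 2 * of_real pi * \<i>) ^ Suc (Suc k) * geo_moment (Suc k) (2 *
      of_real pi * \<i> * w)) (at w)"
    by (rule has_field_derivative_transform_within_open[of _ _ _ "{w. Im w < 0}"])
       (use Suc open_halfspace_Im_lt in auto)
  ultimately show ?case by (simp add: DERIV_unique)
qed

text \<open>Lipschitz's formula: the polygamma values at \<open>w\<close> and \<open>1 - w\<close>
  are the halves m >= 0 and m < 0 of the sum of (w + m)^(-k-1) over all integers. The second half is
  indexed by \<open>Suc m\<close>, so that the integer 0 is counted once.\<close>

lemma lipschitz_sums:
  fixes w :: complex
  assumes "Im w < 0" "k \<ge> 1"
  shows "(\<lambda>m. 1 / (w + of_nat m) ^ Suc k + 1 / (w - of_nat (Suc m)) ^ Suc k) sums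
    ((2 * of_real pi * \<i>) ^ Suc k / fact k * geo_moment k (2 * of_real pi * \<i> * w))"
proof -
  have nz: "w \<noteq> 0" "1 - w \<noteq> 0" using assms by auto
  have s: "(\<lambda>m. inverse ((z + of_nat m) ^ Suc k)) sums ((- 1) ^ Suc k * Polygamma k z / fact k)"
    if "z \<noteq> 0" for z :: complex
    using Polygamma_LIMSEQ[OF that, of k] assms(2) Polygamma_converges'[OF that, of "Suc k"]
    by (simp add: Polygamma_def sums_iff)
  have "(\<lambda>m. inverse ((w + of_nat m) ^ Suc k) + (- 1) ^ Suc k * inverse ((1 - w + of_nat m) ^ Suc k))
     sums ((- 1) ^ Suc k * Polygamma k w / fact k + (- 1) ^ Suc k * ((- 1) ^ Suc k * Polygamma k (1 - w) / fact k))"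
    by (intro sums_add sums_mult s nz)
  also have "(- 1) ^ Suc k * Polygamma k w / fact k + (- 1) ^ Suc k * ((- 1) ^ Suc k * Polygamma k (1 - w) / fact k)
      = (- 1) ^ Suc k / fact k * (Polygamma k w - (- 1) ^ k * Polygamma k (1 - w))"
    by (simp add: algebra_simps add_divide_distrib diff_divide_distrib)
  also have "\<dots> = (- 1) ^ Suc k / fact k * ((- 2 * of_real pi * \<i>) ^ Suc k * geo_moment k (2 *
      of_real pi * \<i> * w))"
    using assms by (subst Polygamma_reflection_geo) auto
  also have "\<dots> = ((-1) * (- 2 * of_real pi * \<i>)) ^ Suc k / fact k * geo_moment k (2 * of_real pi * \<i> * w)"
    by (subst power_mult_distrib) simp
  finally have "(\<lambda>m. inverse ((w + of_nat m) ^ Suc k) + (- 1) ^ Suc k * inverse ((1 - w + of_nat m) ^ Suc k))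
     sums ((2 * of_real pi * \<i>) ^ Suc k / fact k * geo_moment k (2 * of_real pi * \<i> * w))" by simp
  moreover have "(- 1) ^ Suc k * inverse ((1 - w + of_nat m) ^ Suc k) = 1 / (w - of_nat (Suc m)) ^ Suc k" for m
  proof -
    have "(w - of_nat (Suc m)) ^ Suc k = ((-1) * (1 - w + of_nat m)) ^ Suc k"
      by (rule arg_cong[of _ _ "\<lambda>x. x ^ Suc k"]) simp
    also have "\<dots> = (- 1) ^ Suc k * (1 - w + of_nat m) ^ Suc k" by (rule power_mult_distrib)
    finally have "inverse ((w - of_nat (Suc m)) ^ Suc k) = inverse ((- 1) ^ Suc k) * inverse ((1 - w +
        of_nat m) ^ Suc k)"
      by (simp only: inverse_mult_distrib)
    then show ?thesis by (simp add: inverse_eq_divide power_one_over[symmetric] flip: power_inverse)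
  qed
  ultimately show ?thesis by (simp only: inverse_eq_divide)
qed

text \<open>Digamma reflection on the negative imaginary axis: subtracting the digamma series at
  \<open>1 + w\<close> and \<open>1 - w\<close> yields the fractions, and the 1/w from the shift of
  \<open>w\<close> to \<open>1 + w\<close> yields the term 1/v.\<close>

lemma coth_partial_fractions:
  fixes v :: real
  assumes "v > 0"
  shows "(\<lambda>r. 2 * v / (v\<^sup>2 + 4 * pi\<^sup>2 * (real (Suc r))\<^sup>2)) sums (1 / (exp v -
      1) + 1 / 2 - 1 / v)"
proof -
  define w where "w = - \<i> * of_real v / (2 * of_real pi)"
  have Im: "Im w < 0" using assms by (simp add: w_def)
  have z: "2 * of_real pi * \<i> * w = of_real v" by (simp add: w_def field_simps)
  have nz: "w \<noteq> 0" "1 + w \<noteq> 0" "1 - w \<noteq> 0" using Im by (auto simp: complex_eq_iff)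
  have "Digamma (1 + w) = Digamma w + 1 / w" using Digamma_plus1[OF nz(1)] by (simp add: add.commute)
  then have "Digamma (1 + w) - Digamma (1 - w) = - 2 * of_real pi * \<i> * (geo_moment 0 (of_real v) - 1 / 2) + 1 / w"
    using Digamma_reflection_geo[OF Im] z by (simp add: algebra_simps)
  also have "geo_moment 0 (of_real v) = of_real (1 + 1 / (exp v - 1))"
    using geo_moment_0[of "of_real v"] assms by (simp add: exp_of_real)
  also have "1 / w = 2 * of_real pi * \<i> * of_real (1 / v)" using assms by (simp add: w_def field_simps)
  finally have eq: "Digamma (1 + w) - Digamma (1 - w) =
      - 2 * of_real pi * \<i> * of_real (1 / (exp v - 1) + 1 / 2 - 1 / v)"
    by (simp add: algebra_simps)
  have "(\<lambda>n. (inverse (of_nat (Suc n)) - inverse (1 + w + of_nat n)) - (inverse (of_nat (Suc n))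
      - inverse (1 - w + of_nat n)))
      sums ((Digamma (1 + w) + euler_mascheroni) - (Digamma (1 - w) + euler_mascheroni))"
    using summable_Digamma[OF nz(2)] summable_Digamma[OF nz(3)]
    by (intro sums_diff) (simp_all add: Digamma_def summable_sums)
  then have "(\<lambda>n. (inverse (1 - w + of_nat n) - inverse (1 + w + of_nat n)) / (- 2 * of_real pi * \<i>))
      sums ((Digamma (1 + w) - Digamma (1 - w)) / (- 2 * of_real pi * \<i>))"
    by (intro sums_divide) simp
  also have "(Digamma (1 + w) - Digamma (1 - w)) / (- 2 * of_real pi * \<i>) = of_real (1 / (exp v - 1) +
      1 / 2 - 1 / v)"
    unfolding eq by simp
  also have "(\<lambda>n. (inverse (1 - w + of_nat n) - inverse (1 + w + of_nat n)) / (- 2 * of_real pi * \<i>))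
     = (\<lambda>r. complex_of_real (2 * v / (v\<^sup>2 + 4 * pi\<^sup>2 * (real (Suc r))\<^sup>2)))"
  proof
    fix n
    have ne: "1 - w + of_nat n \<noteq> 0" "1 + w + of_nat n \<noteq> 0" using Im by (auto simp: complex_eq_iff)
    have pos: "v\<^sup>2 + 4 * pi\<^sup>2 * (real (Suc n))\<^sup>2 > 0" using assms by (intro add_pos_nonneg) auto
    have "(1 - w + of_nat n) * (1 + w + of_nat n) = of_nat (Suc n) ^ 2 - w ^ 2"
      by (simp add: algebra_simps power2_eq_square)
    also have "w ^ 2 = - (of_real (v\<^sup>2 / (4 * pi\<^sup>2)))"
      by (simp add: w_def power_divide power_mult_distrib)
    also have "of_nat (Suc n) ^ 2 - (- (of_real (v\<^sup>2 / (4 * pi\<^sup>2)))) =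
       complex_of_real ((v\<^sup>2 + 4 * pi\<^sup>2 * (real (Suc n))\<^sup>2) / (4 * pi\<^sup>2))"
      by (simp add: field_simps)
    finally have prod: "(1 - w + of_nat n) * (1 + w + of_nat n) = \<dots>" .
    have "inverse (1 - w + of_nat n) - inverse (1 + w + of_nat n) = 2 * w / ((1 - w + of_nat n) * (1 + w + of_nat n))"
      using ne by (simp add: field_simps)
    also have "\<dots> = 2 * w * of_real ((4 * pi\<^sup>2) / (v\<^sup>2 + 4 * pi\<^sup>2 * (real (Suc n))\<^sup>2))"
      unfolding prod by simp
    also have "\<dots> / (- 2 * of_real pi * \<i>) = complex_of_real (v / (2 * pi\<^sup>2) * ((4 *
        pi\<^sup>2) / (v\<^sup>2 + 4 * pi\<^sup>2 * (real (Suc n))\<^sup>2)))"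
    proof -
      have "2 * w / (- 2 * of_real pi * \<i>) = complex_of_real (v / (2 * pi\<^sup>2))"
        by (simp add: w_def power2_eq_square)
      then show ?thesis by (metis of_real_mult times_divide_eq_left)
    qed
    also have "v / (2 * pi\<^sup>2) * ((4 * pi\<^sup>2) / (v\<^sup>2 + 4 * pi\<^sup>2 * (real (Suc
        n))\<^sup>2)) = 2 * v / (v\<^sup>2 + 4 * pi\<^sup>2 * (real (Suc n))\<^sup>2)"
      by simp
    finally show "(inverse (1 - w + of_nat n) - inverse (1 + w + of_nat n)) / (- 2 * of_real pi * \<i>)
      = complex_of_real (2 * v / (v\<^sup>2 + 4 * pi\<^sup>2 * (real (Suc n))\<^sup>2))" .
  qed
  finally show ?thesis by (subst (asm) sums_of_real_iff)
qed

section \<open>Exponential moments of a character\<close>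

text \<open>A mean value estimate obtained algebraically, splitting off one factor per induction
  step. The extra power of \<open>c\<close> is what makes the later series of differences
  converge.\<close>

lemma norm_inverse_power_diff_le:
  fixes a b :: complex
  assumes "c > 0" "norm a \<ge> c" "norm b \<ge> c"
  shows "norm (1 / a ^ m - 1 / b ^ m) \<le> real m * norm (a - b) / c ^ Suc m"
proof (induction m)
  case (Suc m)
  have nz: "a \<noteq> 0" "b \<noteq> 0" using assms by auto
  have 1: "norm ((1 / a ^ m - 1 / b ^ m) / a) \<le> real m * norm (a - b) / c ^ Suc m / c"
    unfolding norm_divide using Suc assms by (intro frac_le) auto
  have 2: "norm ((b - a) / (a * b ^ Suc m)) \<le> norm (a - b) / (c * c ^ Suc m)"
    unfolding norm_divide norm_mult norm_power using assms
    by (intro frac_le mult_mono power_mono) (auto simp: norm_minus_commute)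
  have "1 / a ^ Suc m - 1 / b ^ Suc m = (1 / a ^ m - 1 / b ^ m) / a + (b - a) / (a * b ^ Suc m)"
    using nz by (simp add: field_simps)
  then have "norm (1 / a ^ Suc m - 1 / b ^ Suc m)
      \<le> real m * norm (a - b) / c ^ Suc m / c + norm (a - b) / (c * c ^ Suc m)"
    using norm_triangle_mono[OF 1 2] by simp
  also have "\<dots> = real (Suc m) * norm (a - b) / c ^ Suc (Suc m)"
    using assms by (simp add: field_simps)
  finally show ?case .
qed simp

section \<open>Pole expansion of the moments and their size near 0 and at infinity\<close>

locale even_primitive_character = dirichlet_character +
  assumes nonprincipal: "\<not> principal_char q chi"
    and even: "even_char q chi" and primitive: "primitive_char q chi"
begin

definition char_moment :: "nat \<Rightarrow> complex \<Rightarrow> complex" where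
  "char_moment k z = (\<Sum>d. of_nat d ^ k * chi d * exp (- of_nat d * z))"

definition pole :: "nat \<Rightarrow> real" where
  "pole n = 2 * pi * real n / real q"

definition pole_term :: "nat \<Rightarrow> complex \<Rightarrow> nat \<Rightarrow> complex" where
  "pole_term k z n = 1 / (z + \<i> * of_real (pole n)) ^ Suc k + 1 / (z - \<i> * of_real (pole n)) ^ Suc k"

text \<open>This form makes sense at \<open>z = 0\<close>, where the series for
  \<open>char_moment\<close> diverges; its value there is the constant P(0).\<close>

definition pole_sum :: "nat \<Rightarrow> complex \<Rightarrow> complex" where
  "pole_sum k z = gauss_sum q chi / of_nat q * fact k * (\<Sum>n. cnj (chi n) * pole_term k z n)"

lemma summable_norm_char_moment:
  assumes "Re z > 0"
  shows "summable (\<lambda>d. norm (of_nat d ^ k * chi d * exp (- of_nat d * z)))"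
proof (rule summable_comparison_test)
  have "norm (of_nat d ^ k * chi d * exp (- of_nat d * z)) \<le> real d ^ k * exp (- real d * Re z)" for d
    using mult_right_mono[OF norm_chi_le[of d], of "real d ^ k * exp (- real d * Re z)"]
    by (simp add: norm_mult norm_power mult_ac)
  then show "\<exists>N. \<forall>d\<ge>N. norm (norm (of_nat d ^ k * chi d * exp (- of_nat d * z)))
      \<le> real d ^ k * exp (- real d * Re z)"
    by simp
qed (rule summable_power_exp[OF assms])

lemma sums_char_moment:
  assumes "Re z > 0"
  shows "(\<lambda>d. of_nat d ^ k * chi d * exp (- of_nat d * z)) sums char_moment k z"
  unfolding char_moment_def
  using summable_norm_cancel[OF summable_norm_char_moment[OF assms]] by (rule summable_sums)

text \<open>The additive characters in the Fourier expansion of \<open>chi\<close> become imaginary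
  shifts of the argument.\<close>

lemma char_moment_fourier:
  assumes "Re z > 0"
  shows "char_moment k z = gauss_sum q chi / of_nat q *
    (\<Sum>j<q. cnj (chi j) * geo_moment k (z + \<i> * of_real (pole j)))"
proof -
  have "(\<lambda>d. gauss_sum q chi / of_nat q * (\<Sum>j<q. cnj (chi j) *
      (of_nat d ^ k * exp (- of_nat d * (z + \<i> * of_real (pole j))))))
     sums (gauss_sum q chi / of_nat q * (\<Sum>j<q. cnj (chi j) * geo_moment k (z + \<i> * of_real (pole j))))"
    using assms by (intro sums_mult sums_sum sums_geo_moment) simp
  also have "(\<lambda>d. gauss_sum q chi / of_nat q * (\<Sum>j<q. cnj (chi j) *
      (of_nat d ^ k * exp (- of_nat d * (z + \<i> * of_real (pole j))))))
     = (\<lambda>d. of_nat d ^ k * chi d * exp (- of_nat d * z))"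
  proof
    fix d
    have "exp (- of_nat d * (z + \<i> * of_real (pole j))) = exp (- of_nat d * z) * unity_root q (- (int
        j * int d))" for j
      by (simp add: unity_root_def cis_conv_exp exp_add[symmetric] pole_def algebra_simps)
    then have "gauss_sum q chi / of_nat q * (\<Sum>j<q. cnj (chi j) *
      (of_nat d ^ k * exp (- of_nat d * (z + \<i> * of_real (pole j)))))
      = of_nat d ^ k * exp (- of_nat d * z) *
        (gauss_sum q chi / of_nat q * (\<Sum>j<q. cnj (chi j) * unity_root q (- (int j * int d))))"
      by (simp add: sum_distrib_left mult_ac)
    then show "gauss_sum q chi / of_nat q * (\<Sum>j<q. cnj (chi j) *
      (of_nat d ^ k * exp (- of_nat d * (z + \<i> * of_real (pole j)))))
      = of_nat d ^ k * chi d * exp (- of_nat d * z)"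
      using chi_fourier[OF primitive, of d] by (simp only: mult_ac)
  qed
  finally show ?thesis using sums_char_moment[OF assms] sums_unique2 by blast
qed

lemma has_field_derivative_char_moment:
  assumes "Re z > 0"
  shows "(char_moment k has_field_derivative - char_moment (Suc k) z) (at z)"
proof -
  let ?f = "\<lambda>k z. gauss_sum q chi / of_nat q * (\<Sum>j<q. cnj (chi j) * geo_moment k (z + \<i> *
      of_real (pole j)))"
  have g: "((\<lambda>z. geo_moment k (z + \<i> * of_real (pole j))) has_field_derivative
      - geo_moment (Suc k) (z + \<i> * of_real (pole j))) (at z)" for j
    using DERIV_shift[of "geo_moment k" _ z] has_field_derivative_geo_moment[of "z + \<i> * of_real (pole j)" k] assms
    by simp
  have "(?f k has_field_derivative gauss_sum q chi / of_nat q *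
     (\<Sum>j<q. cnj (chi j) * - geo_moment (Suc k) (z + \<i> * of_real (pole j)))) (at z)"
    by (intro DERIV_cmult DERIV_sum g)
  then have "(?f k has_field_derivative - char_moment (Suc k) z) (at z)"
    using char_moment_fourier[OF assms, of "Suc k"] by (simp add: sum_negf)
  then show ?thesis
    by (rule has_field_derivative_transform_within_open[of _ _ _ "{z. Re z > 0}"])
       (use assms open_halfspace_Re_gt[of 0] char_moment_fourier in auto)
qed

lemma pole_pos: "n > 0 \<Longrightarrow> pole n > 0"
  using q_pos by (simp add: pole_def)

lemma norm_add_pole:
  assumes "Re z \<ge> 0" "Im z = 0"
  shows "norm (z + \<i> * of_real (pole n)) \<ge> pole n" "norm (z - \<i> * of_real (pole n)) \<ge> pole n"
proof -
  have "pole n \<ge> 0" by (simp add: pole_def)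
  then show "norm (z + \<i> * of_real (pole n)) \<ge> pole n" "norm (z - \<i> * of_real (pole n)) \<ge> pole n"
    using abs_Im_le_cmod[of "z + \<i> * of_real (pole n)"] abs_Im_le_cmod[of "z - \<i> * of_real (pole n)"] assms
    by simp_all
qed

lemma norm_pole_term_le:
  assumes "u \<ge> 0"
  shows "norm (cnj (chi n) * pole_term k (of_real u) n) \<le> 2 / pole n ^ Suc k"
proof (cases "n = 0")
  case True
  then show ?thesis using chi_0[OF nonprincipal] by (simp add: pole_def)
next
  case False
  have p: "norm (1 / (of_real u + \<i> * of_real (pole n)) ^ Suc k) \<le> 1 / pole n ^ Suc k"
          "norm (1 / (of_real u - \<i> * of_real (pole n)) ^ Suc k) \<le> 1 / pole n ^ Suc k"
    using pole_pos[of n] False norm_add_pole[of "of_real u" n] assms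
    unfolding norm_divide norm_power by (auto intro!: frac_le power_mono simp del: power_Suc)
  have "norm (cnj (chi n) * pole_term k (of_real u) n) \<le> 1 * norm (pole_term k (of_real u) n)"
    unfolding norm_mult using norm_chi_le[of n] by (intro mult_right_mono) auto
  also have "\<dots> \<le> 1 / pole n ^ Suc k + 1 / pole n ^ Suc k"
    unfolding pole_term_def mult_1 by (rule norm_triangle_mono[OF p])
  finally show ?thesis by (simp del: power_Suc)
qed

lemma summable_pole_power:
  assumes "k \<ge> 1"
  shows "summable (\<lambda>n. C / pole n ^ Suc k)"
proof -
  have "summable (\<lambda>n. C * (real q / (2 * pi)) ^ Suc k * inverse (real n ^ Suc k))"
    using assms by (intro summable_mult inverse_power_summable) simp
  then show ?thesis
    by (simp add: pole_def power_mult_distrib power_divide field_simps del: power_Suc)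
qed

lemma summable_pole_term:
  assumes "k \<ge> 1" "u \<ge> 0"
  shows "summable (\<lambda>n. norm (cnj (chi n) * pole_term k (of_real u) n))"
  by (rule summable_comparison_test[OF _ summable_pole_power[OF assms(1), of 2]])
     (use norm_pole_term_le[OF assms(2)] in auto)

text \<open>Each residue class \<open>j\<close> in the Fourier form is a Lipschitz sum; the classes
  are then interleaved into one series over all \<open>n\<close>.\<close>

lemma char_moment_eq_pole_sum:
  assumes "k \<ge> 1" "u > 0"
  shows "char_moment k (of_real u) = pole_sum k (of_real u)"
proof -
  let ?z = "complex_of_real u"
  let ?p = "\<lambda>n. cnj (chi n) / (?z + \<i> * of_real (pole n)) ^ Suc k"
  let ?m = "\<lambda>n. cnj (chi n) / (?z - \<i> * of_real (pole n)) ^ Suc k"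
  let ?G = "\<lambda>j. geo_moment k (?z + \<i> * of_real (pole j)) / fact k"
  have one: "(\<lambda>m. 1 / (?z + \<i> * of_real (pole (m * q + j))) ^ Suc k + 1 / (?z - \<i> * of_real
      (pole (m * q + (q - j)))) ^ Suc k)
     sums ?G j" if j: "j < q" for j
  proof -
    \<comment> \<open>The real part j/q selects the residue class, and the imaginary part -u/(2 pi)
      places \<open>w\<close> in the lower half-plane.\<close>
    define w where "w = of_real (real j / real q) - \<i> * of_real (u / (2 * pi))"
    have Im: "Im w < 0" using assms by (simp add: w_def)
    let ?c = "2 * of_real pi * \<i> :: complex"
    have cw: "?c * w = ?z + \<i> * of_real (pole j)"
      by (simp add: w_def pole_def algebra_simps)
    have c1: "?c * (w + of_nat m) = ?z + \<i> * of_real (pole (m * q + j))" for m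
      using cw q_pos by (simp add: distrib_left pole_def field_simps)
    have c2: "?c * (w - of_nat (Suc m)) = ?z - \<i> * of_real (pole (m * q + (q - j)))" for m
      using cw q_pos j by (simp add: right_diff_distrib pole_def field_simps of_nat_diff)
    have "(\<lambda>m. (1 / (w + of_nat m) ^ Suc k + 1 / (w - of_nat (Suc m)) ^ Suc k) / ?c ^ Suc k)
       sums ((?c ^ Suc k / fact k * geo_moment k (?c * w)) / ?c ^ Suc k)"
      by (intro sums_divide lipschitz_sums Im assms)
    also have "(\<lambda>m. (1 / (w + of_nat m) ^ Suc k + 1 / (w - of_nat (Suc m)) ^ Suc k) / ?c ^ Suc k)
       = (\<lambda>m. 1 / (?c * (w + of_nat m)) ^ Suc k + 1 / (?c * (w - of_nat (Suc m))) ^ Suc k)"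
      unfolding power_mult_distrib by (simp add: add_divide_distrib mult.commute del: power_Suc)
    also have "(?c ^ Suc k / fact k * geo_moment k (?c * w)) / ?c ^ Suc k = geo_moment k (?c * w) / fact k"
      by simp
    finally show ?thesis unfolding c1 c2 cw .
  qed
  have "(\<lambda>m. \<Sum>j<q. cnj (chi j) * (1 / (?z + \<i> * of_real (pole (m * q + j))) ^ Suc k
        + 1 / (?z - \<i> * of_real (pole (m * q + (q - j)))) ^ Suc k)) sums (\<Sum>j<q. cnj (chi j) * ?G j)"
    by (intro sums_sum sums_mult one) simp
  also have "(\<lambda>m. \<Sum>j<q. cnj (chi j) * (1 / (?z + \<i> * of_real (pole (m * q + j))) ^ Suc k
        + 1 / (?z - \<i> * of_real (pole (m * q + (q - j)))) ^ Suc k))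
      = (\<lambda>m. \<Sum>n\<in>{m * q..<m * q + q}. cnj (chi n) * pole_term k ?z n)"
  proof
    fix m
    let ?b = "\<lambda>n. 1 / (?z - \<i> * of_real (pole (m * q + n))) ^ Suc k"
    \<comment> \<open>The negative half of the Lipschitz sum meets the poles of a block in reversed
      order. Evenness of \<open>chi\<close> undoes the reversal, once the term \<open>j = 0\<close>
      is dropped because \<open>chi 0 = 0\<close>.\<close>
    have "(\<Sum>j<q. cnj (chi j) * ?b (q - j)) = (\<Sum>j\<in>{1..<q}. cnj (chi j) * ?b (q - j))"
      using chi_0[OF nonprincipal] q_pos by (simp add: lessThan_atLeast0 sum.atLeast_Suc_lessThan)
    also have "\<dots> = (\<Sum>j\<in>{1..<q}. cnj (chi (q - j)) * ?b j)"
      by (rule sum.reindex_bij_witness[of _ "\<lambda>j. q - j" "\<lambda>j. q - j"]) auto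
    also have "\<dots> = (\<Sum>j\<in>{1..<q}. cnj (chi j) * ?b j)"
      using chi_reflect[OF even] by (intro sum.cong) auto
    also have "\<dots> = (\<Sum>j<q. cnj (chi j) * ?b j)"
      using chi_0[OF nonprincipal] q_pos by (simp add: lessThan_atLeast0 sum.atLeast_Suc_lessThan)
    finally have minus: "(\<Sum>j<q. cnj (chi j) * ?b (q - j)) = (\<Sum>j<q. cnj (chi j) * ?b j)" .
    have "(\<Sum>j<q. cnj (chi j) * (1 / (?z + \<i> * of_real (pole (m * q + j))) ^ Suc k + ?b (q - j)))
       = (\<Sum>j<q. cnj (chi j) * (1 / (?z + \<i> * of_real (pole (m * q + j))) ^ Suc k + ?b j))"
      unfolding distrib_left sum.distrib minus ..
    also have "\<dots> = (\<Sum>j<q. cnj (chi (j + m * q)) * pole_term k ?z (j + m * q))"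
      by (simp add: chi_add_mult pole_term_def add.commute del: power_Suc)
    also have "\<dots> = (\<Sum>n\<in>{m * q..<m * q + q}. cnj (chi n) * pole_term k ?z n)"
      using sum.shift_bounds_nat_ivl[of "\<lambda>n. cnj (chi n) * pole_term k ?z n" 0 "m * q" q]
      by (simp add: lessThan_atLeast0 add.commute)
    finally show "(\<Sum>j<q. cnj (chi j) * (1 / (?z + \<i> * of_real (pole (m * q + j))) ^ Suc k + ?b (q - j)))
       = (\<Sum>n\<in>{m * q..<m * q + q}. cnj (chi n) * pole_term k ?z n)" .
  qed
  finally have 1: "(\<lambda>m. \<Sum>n\<in>{m * q..<m * q + q}. cnj (chi n) * pole_term k ?z n) sums
      (\<Sum>j<q. cnj (chi j) * ?G j)" .
  \<comment> \<open>The ungrouped series is known to converge, so its sum agrees with that of the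
    blocks of \<open>q\<close> terms.\<close>
  have "(\<lambda>n. cnj (chi n) * pole_term k ?z n) sums (\<Sum>n. cnj (chi n) * pole_term k ?z n)"
    using summable_norm_cancel[OF summable_pole_term[OF assms(1), of u]] assms(2) by (simp add: summable_sums)
  from sums_group[OF this q_pos] 1
  have "(\<Sum>n. cnj (chi n) * pole_term k ?z n) = (\<Sum>j<q. cnj (chi j) * ?G j)"
    by (rule sums_unique2)
  then have "fact k * (\<Sum>n. cnj (chi n) * pole_term k ?z n) = (\<Sum>j<q. cnj (chi j) * geo_moment k
      (?z + \<i> * of_real (pole j)))"
    by (simp add: sum_distrib_left)
  then show ?thesis
    using char_moment_fourier[of ?z k] assms by (simp add: pole_sum_def mult.assoc)
qed

text \<open>From (d - 1)(u - 1) >= 0 a factor exp(1 - u) splits off every term with \<open>d\<close>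
  at least 1, and \<open>chi 0 = 0\<close> removes the other one. Order 0 is included, because it is
  the antiderivative for order 1.\<close>

lemma char_moment_exp_bound_ge_1:
  "\<exists>A\<ge>0. \<forall>u\<ge>1. norm (char_moment k (of_real u)) \<le> A * exp (- u)"
proof -
  define A where "A = (\<Sum>d. real d ^ k * exp (- real d * 1)) * exp 1"
  have A0: "A \<ge> 0" unfolding A_def
    by (intro mult_nonneg_nonneg suminf_nonneg summable_power_exp) auto
  have "norm (char_moment k (of_real u)) \<le> A * exp (- u)" if u: "u \<ge> 1" for u
  proof -
    have le: "norm (of_nat d ^ k * chi d * exp (- of_nat d * of_real u)) \<le> real d ^ k * exp (- real d
        * 1) * (exp 1 * exp (- u))" for d
    proof (cases "d = 0")
      case True
      then show ?thesis using chi_0[OF nonprincipal] by simp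
    next
      case d: False
      have "(real d - 1) * (u - 1) \<ge> 0" using d u by (intro mult_nonneg_nonneg) auto
      then have "- (real d * u) \<le> - real d + (1 - u)" by (simp add: algebra_simps)
      then have "exp (- (real d * u)) \<le> exp (- real d) * (exp 1 * exp (- u))"
        by (simp flip: exp_add)
      then have "norm (chi d) * exp (- (real d * u)) \<le> 1 * (exp (- real d) * (exp 1 * exp (- u)))"
        using norm_chi_le[of d] by (intro mult_mono) auto
      then have "real d ^ k * (norm (chi d) * exp (- (real d * u))) \<le> real d ^ k * (exp (- real d) *
          (exp 1 * exp (- u)))"
        by (intro mult_left_mono) auto
      then show ?thesis by (simp add: norm_mult norm_power mult_ac)
    qed
    have "norm (char_moment k (of_real u)) \<le> (\<Sum>d. real d ^ k * exp (- real d * 1) * (exp 1 * exp (- u)))"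
      unfolding char_moment_def
      by (rule norm_suminf_le[OF le]) (intro summable_mult2 summable_power_exp, simp)
    also have "\<dots> = A * exp (- u)" unfolding A_def
      by (subst suminf_mult2[symmetric]) (intro summable_power_exp, simp_all)
    finally show ?thesis .
  qed
  then show ?thesis using A0 by blast
qed

text \<open>The defining series gives the decay for \<open>u\<close> at least 1; for smaller
  \<open>u\<close> the pole expansion is bounded term by term, uniformly down to 0.\<close>

lemma char_moment_exp_bound:
  assumes "k \<ge> 1"
  shows "\<exists>C\<ge>0. \<forall>u>0. norm (char_moment k (of_real u)) \<le> C * exp (- u)"
proof -
  define B where "B = norm (gauss_sum q chi / of_nat q * fact k) * (\<Sum>n. 2 / pole n ^ Suc k)"
  have B0: "B \<ge> 0" unfolding B_def
    by (intro mult_nonneg_nonneg suminf_nonneg summable_pole_power assms) (auto simp: pole_def)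
  obtain A where A: "A \<ge> 0" "\<And>u. u \<ge> 1 \<Longrightarrow> norm (char_moment k (of_real u))
      \<le> A * exp (- u)"
    using char_moment_exp_bound_ge_1 by blast
  have "norm (char_moment k (of_real u)) \<le> (B * exp 1 + A) * exp (- u)" if u: "u > 0" for u
  proof (cases "u \<le> 1")
    case True
    have "norm (\<Sum>n. cnj (chi n) * pole_term k (of_real u) n) \<le> (\<Sum>n. 2 / pole n ^ Suc k)"
      using u assms by (intro norm_suminf_le norm_pole_term_le summable_pole_power) auto
    then have "norm (char_moment k (of_real u)) \<le> B"
      unfolding char_moment_eq_pole_sum[OF assms u] pole_sum_def B_def norm_mult[of _ "suminf _"]
      by (intro mult_left_mono) auto
    also have "\<dots> \<le> B * exp 1 * exp (- u)"
      using True B0 by (simp add: mult.assoc exp_add[symmetric] mult_le_cancel_left1)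
    also have "\<dots> \<le> (B * exp 1 + A) * exp (- u)" using A by (simp add: distrib_right)
    finally show ?thesis .
  next
    case False
    then have "norm (char_moment k (of_real u)) \<le> A * exp (- u)" using A(2)[of u] by simp
    also have "\<dots> \<le> (B * exp 1 + A) * exp (- u)" using B0 by (simp add: distrib_right)
    finally show ?thesis .
  qed
  then show ?thesis using A B0 by (intro exI[of _ "B * exp 1 + A"]) auto
qed

text \<open>The pole expansion is Lipschitz term by term: each difference gains a factor u / pole n,
  up to a constant.\<close>

lemma char_moment_lipschitz_0:
  assumes "k \<ge> 1"
  shows "\<exists>C\<ge>0. \<forall>u>0. norm (char_moment k (of_real u) - pole_sum k 0) \<le> C * u"
proof -
  define c where "c = norm (gauss_sum q chi / of_nat q * fact k)"
  define C where "C = c * (\<Sum>n. (2 * real (Suc k)) / pole n ^ Suc (Suc k))"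
  have "C \<ge> 0" unfolding C_def c_def
    by (intro mult_nonneg_nonneg suminf_nonneg summable_pole_power) (auto simp: pole_def)
  moreover have "norm (char_moment k (of_real u) - pole_sum k 0) \<le> C * u" if u: "u > 0" for u
  proof -
    have le: "norm (cnj (chi n) * pole_term k (of_real u) n - cnj (chi n) * pole_term k (of_real 0) n)
        \<le> (2 * real (Suc k)) / pole n ^ Suc (Suc k) * u" for n
    proof (cases "n = 0")
      case True
      then show ?thesis using chi_0[OF nonprincipal] u by (simp add: pole_def)
    next
      case False
      have 1: "norm (1 / (of_real u + \<i> * of_real (pole n)) ^ Suc k - 1 / (of_real 0 + \<i> * of_real
          (pole n)) ^ Suc k)
          \<le> real (Suc k) * u / pole n ^ Suc (Suc k)"
        using norm_inverse_power_diff_le[of "pole n" "of_real u + \<i> * of_real (pole n)" "of_real 0 +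
            \<i> * of_real (pole n)" "Suc k"]
          pole_pos[of n] False norm_add_pole[of "of_real u" n] norm_add_pole[of "of_real 0" n] u by simp
      have 2: "norm (1 / (of_real u - \<i> * of_real (pole n)) ^ Suc k - 1 / (of_real 0 - \<i> * of_real
          (pole n)) ^ Suc k)
          \<le> real (Suc k) * u / pole n ^ Suc (Suc k)"
        using norm_inverse_power_diff_le[of "pole n" "of_real u - \<i> * of_real (pole n)" "of_real 0 -
            \<i> * of_real (pole n)" "Suc k"]
          pole_pos[of n] False norm_add_pole[of "of_real u" n] norm_add_pole[of "of_real 0" n] u by simp
      have "norm (pole_term k (of_real u) n - pole_term k (of_real 0) n) \<le>
          real (Suc k) * u / pole n ^ Suc (Suc k) + real (Suc k) * u / pole n ^ Suc (Suc k)"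
        using norm_triangle_mono[OF 1 2] by (simp add: pole_term_def algebra_simps del: power_Suc)
      then have "norm (cnj (chi n)) * norm (pole_term k (of_real u) n - pole_term k (of_real 0) n)
          \<le> 1 * (real (Suc k) * u / pole n ^ Suc (Suc k) + real (Suc k) * u / pole n ^ Suc (Suc k))"
        using norm_chi_le[of n] by (intro mult_mono) auto
      then show ?thesis by (simp add: right_diff_distrib[symmetric] norm_mult mult_ac del: power_Suc)
    qed
    have s: "summable (\<lambda>n. cnj (chi n) * pole_term k (of_real u) n)" "summable (\<lambda>n. cnj
        (chi n) * pole_term k (of_real 0) n)"
      using summable_norm_cancel[OF summable_pole_term[OF assms]] u by (auto simp del: of_real_0)
    have "char_moment k (of_real u) - pole_sum k 0
        = gauss_sum q chi / of_nat q * fact k *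
          (\<Sum>n. cnj (chi n) * pole_term k (of_real u) n - cnj (chi n) * pole_term k (of_real 0) n)"
      unfolding char_moment_eq_pole_sum[OF assms u] pole_sum_def suminf_diff[OF s, symmetric]
      by (simp add: right_diff_distrib)
    also have "norm \<dots> \<le> c * (\<Sum>n. (2 * real (Suc k)) / pole n ^ Suc (Suc k) * u)"
      unfolding norm_mult[of _ "suminf _"] c_def
      by (intro mult_left_mono norm_suminf_le[OF le] summable_mult2 summable_pole_power) auto
    also have "\<dots> = C * u" unfolding C_def
      by (subst suminf_mult2[symmetric]) (intro summable_pole_power, auto)
    finally show ?thesis .
  qed
  ultimately show ?thesis by blast
qed

text \<open>For order 0 the majorant \<open>2 / pole n\<close> of the pole terms is not summable.
  Summing over the periods of \<open>chi\<close> gives a rational function of exp(-z)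
  instead.\<close>

lemma char_moment_0_closed:
  assumes "Re z > 0"
  shows "char_moment 0 z * (1 - exp (- of_nat q * z)) = (\<Sum>h<q. chi h * exp (- of_nat h * z))"
proof -
  let ?T = "\<Sum>h<q. chi h * exp (- of_nat h * z)"
  have n: "norm (exp (- of_nat q * z)) < 1" using assms q_pos by simp
  then have ne: "1 - exp (- of_nat q * z) \<noteq> 0" by (metis eq_iff_diff_eq_0 less_irrefl norm_one)
  have blk: "(\<Sum>d\<in>{m * q..<m * q + q}. of_nat d ^ 0 * chi d * exp (- of_nat d * z)) = exp (-
      of_nat q * z) ^ m * ?T" for m
  proof -
    have "(\<Sum>d\<in>{m * q..<m * q + q}. of_nat d ^ 0 * chi d * exp (- of_nat d * z))
       = (\<Sum>h<q. chi (h + m * q) * exp (- of_nat (h + m * q) * z))"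
      using sum.shift_bounds_nat_ivl[of "\<lambda>d. chi d * exp (- of_nat d * z)" 0 "m * q" q]
      by (simp add: lessThan_atLeast0 add.commute)
    also have "\<dots> = (\<Sum>h<q. exp (- of_nat q * z) ^ m * (chi h * exp (- of_nat h * z)))"
      by (intro sum.cong refl) (simp add: chi_add_mult exp_of_nat_mult[symmetric] exp_add[symmetric] algebra_simps)
    finally show ?thesis by (simp add: sum_distrib_left)
  qed
  have "(\<lambda>m. exp (- of_nat q * z) ^ m * ?T) sums char_moment 0 z"
    using sums_group[OF sums_char_moment[OF assms, of 0] q_pos] unfolding blk .
  moreover have "(\<lambda>m. exp (- of_nat q * z) ^ m * ?T) sums (1 / (1 - exp (- of_nat q * z)) * ?T)"
    using n by (intro sums_mult2 geometric_sums)
  ultimately have "char_moment 0 z = 1 / (1 - exp (- of_nat q * z)) * ?T" by (rule sums_unique2)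
  then show ?thesis using ne by simp
qed

text \<open>The reflection h -> q - h turns the sum into \<open>q\<close> times the sum of
  \<open>chi\<close>, which is 0, minus the sum itself.\<close>

lemma sum_times_chi_eq_0: "(\<Sum>h<q. of_nat h * chi h) = 0"
proof -
  have "(\<Sum>h<q. of_nat h * chi h) = (\<Sum>h\<in>{1..<q}. of_nat h * chi h)"
    using q_pos by (simp add: lessThan_atLeast0 sum.atLeast_Suc_lessThan)
  also have "\<dots> = (\<Sum>h\<in>{1..<q}. of_nat (q - h) * chi (q - h))"
    by (rule sum.reindex_bij_witness[of _ "\<lambda>j. q - j" "\<lambda>j. q - j"]) auto
  also have "\<dots> = (\<Sum>h\<in>{1..<q}. of_nat q * chi h - of_nat h * chi h)"
    using chi_reflect[OF even] by (intro sum.cong) (auto simp: of_nat_diff left_diff_distrib)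
  also have "\<dots> = (\<Sum>h<q. of_nat q * chi h - of_nat h * chi h)"
    using q_pos chi_0[OF nonprincipal] by (simp add: lessThan_atLeast0 sum.atLeast_Suc_lessThan)
  also have "\<dots> = - (\<Sum>h<q. of_nat h * chi h)"
    using sum_chi_eq_0[OF nonprincipal] by (simp add: sum_subtractf sum_distrib_left[symmetric])
  finally show ?thesis by simp
qed

text \<open>By the two vanishing sums the numerator of the closed form has a zero of order at least
  2 at 0, while the denominator has a simple one.\<close>

lemma char_moment_0_tendsto: "((\<lambda>u. char_moment 0 (of_real u)) \<longlongrightarrow> 0) (at_right 0)"
proof -
  let ?T = "\<lambda>z. \<Sum>h<q. chi h * exp (- of_nat h * z)"
  have "(?T has_field_derivative (\<Sum>h<q. chi h * (- of_nat h * exp (- of_nat h * 0)))) (at 0)"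
    by (auto intro!: derivative_eq_intros simp: mult.commute)
  then have "(?T has_field_derivative 0) (at 0)"
    using sum_times_chi_eq_0 by (simp add: sum_negf mult.commute)
  then have T: "((\<lambda>z. ?T z / z) \<longlongrightarrow> 0) (at 0)"
    using sum_chi_eq_0[OF nonprincipal] by (simp add: has_field_derivative_iff)
  have "((\<lambda>z. 1 - exp (- of_nat q * z)) has_field_derivative of_nat q) (at (0::complex))"
    by (auto intro!: derivative_eq_intros)
  then have E: "((\<lambda>z. (1 - exp (- of_nat q * z)) / z) \<longlongrightarrow> of_nat q) (at (0::complex))"
    by (simp add: has_field_derivative_iff)
  have lim: "((\<lambda>z. (?T z / z) / ((1 - exp (- of_nat q * z)) / z)) \<longlongrightarrow> 0 / of_nat q) (at 0)"
    using q_pos by (intro tendsto_divide T E) simp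
  have fl: "filterlim complex_of_real (at 0) (at_right 0)"
    by (rule filterlim_atI) (auto intro!: tendsto_eq_intros simp: eventually_at_filter)
  have "((\<lambda>u. (?T (of_real u) / of_real u) / ((1 - exp (- of_nat q * of_real u)) / of_real u))
      \<longlongrightarrow> 0) (at_right (0::real))"
    using filterlim_compose[OF lim fl] by simp
  moreover have "\<forall>\<^sub>F u in at_right (0::real). (?T (of_real u) / of_real u) / ((1 - exp (-
      of_nat q * of_real u)) / of_real u)
     = char_moment 0 (of_real u)"
    using eventually_at_right_less[of 0]
  proof eventually_elim
    case (elim u)
    have "norm (exp (- of_nat q * complex_of_real u)) < 1" using elim q_pos by simp
    then have ne: "1 - exp (- of_nat q * complex_of_real u) \<noteq> 0" by (metis eq_iff_diff_eq_0
        less_irrefl norm_one)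
    show ?case
      using char_moment_0_closed[of "of_real u", symmetric] elim ne by simp
  qed
  ultimately show ?thesis by (rule Lim_transform_eventually)
qed

text \<open>For positive even order the exponent k + 1 is odd, and conjugate poles cancel at 0. This
  is the boundary value at 0 of the antiderivative of a moment of odd order.\<close>

lemma char_moment_even_tendsto:
  assumes "even k"
  shows "((\<lambda>u. char_moment k (of_real u)) \<longlongrightarrow> 0) (at_right 0)"
proof (cases "k = 0")
  case True
  then show ?thesis using char_moment_0_tendsto by simp
next
  case False
  then have k: "k \<ge> 1" by simp
  have "cnj (chi n) * pole_term k 0 n = 0" for n
    using assms by (simp add: pole_term_def)
  then have P0: "pole_sum k 0 = 0" unfolding pole_sum_def by (simp only: suminf_zero mult_zero_right)
  obtain C where C: "\<forall>u>0. norm (char_moment k (of_real u)) \<le> C * u"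
    using char_moment_lipschitz_0[OF k] P0 by auto
  show ?thesis
  proof (rule Lim_null_comparison)
    show "\<forall>\<^sub>F u in at_right 0. norm (char_moment k (of_real u)) \<le> C * u"
      using eventually_at_right_less[of 0] by eventually_elim (use C in auto)
    show "((\<lambda>u. C * u) \<longlongrightarrow> 0) (at_right 0)" by (auto intro!: tendsto_eq_intros)
  qed
qed

end

section \<open>Poisson kernels on the half-line\<close>

text \<open>A measure space of its own, so that the Bochner integral applies without indicator
  functions; the open end keeps 1/u and \<open>ln u\<close> continuous.\<close>

abbreviation half_line :: "real measure" where
  "half_line \<equiv> restrict_space lborel {0<..}"

abbreviation half_integral :: "(real \<Rightarrow> 'a::{banach, second_countable_topology}) \<Rightarrow> 'a" where
  "half_integral f \<equiv> integral\<^sup>L half_line f"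

lemma integrable_half_line_iff:
  fixes f :: "real \<Rightarrow> 'a::{banach, second_countable_topology}"
  shows "integrable half_line f \<longleftrightarrow> set_integrable lborel {0<..} f"
  by (simp add: integrable_restrict_space set_integrable_def)

lemma integral_half_line:
  fixes f :: "real \<Rightarrow> 'a::{banach, second_countable_topology}"
  shows "half_integral f = (LBINT u:{0<..}. f u)"
  by (simp add: integral_restrict_space set_lebesgue_integral_def)

lemma borel_measurable_half_line:
  fixes f :: "real \<Rightarrow> 'a::topological_space"
  assumes "continuous_on {0<..} f"
  shows "f \<in> borel_measurable half_line"
  using borel_measurable_continuous_on_restrict[OF assms]
  by (simp cong: measurable_cong_sets add: sets_restrict_space)

lemma measurable_ident_half_line [measurable]:
  "(\<lambda>x. x) \<in> borel_measurable (restrict_space borel {0::real<..})"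
  by (rule measurable_restrict_space1) simp

lemma integrable_half_line_bound:
  fixes f :: "real \<Rightarrow> 'a::{banach, second_countable_topology}"
  assumes "integrable half_line g" "f \<in> borel_measurable half_line"
    and "\<And>u. u > 0 \<Longrightarrow> norm (f u) \<le> g u"
  shows "integrable half_line f"
  by (rule Bochner_Integration.integrable_bound[OF assms(1,2)], rule AE_I2)
     (use assms(3) in \<open>force simp: space_restrict_space\<close>)

lemma integral_half_line_cong:
  assumes "\<And>u. u > 0 \<Longrightarrow> f u = g u"
  shows "half_integral f = half_integral g"
  using assms by (intro Bochner_Integration.integral_cong) (auto simp: space_restrict_space)

lemma integrable_half_line_cong:
  assumes "\<And>u. u > 0 \<Longrightarrow> f u = g u"
  shows "integrable half_line f \<longleftrightarrow> integrable half_line g"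
  using assms by (intro Bochner_Integration.integrable_cong) (auto simp: space_restrict_space)

lemma integral_half_line_FTC:
  fixes f F :: "real \<Rightarrow> 'a::euclidean_space"
  assumes "\<And>u. u > 0 \<Longrightarrow> (F has_vector_derivative f u) (at u)" "continuous_on {0<..} f"
    and "integrable half_line f" "(F \<longlongrightarrow> A) (at_right 0)" "(F \<longlongrightarrow> B) at_top"
  shows "half_integral f = B - A"
proof -
  have "(LBINT u=ereal 0..\<infinity>. f u) = B - A"
  proof (rule interval_integral_FTC_integrable)
    show "((F \<circ> real_of_ereal) \<longlongrightarrow> A) (at_right (ereal 0))"
      using assms(4) by (simp add: ereal_tendsto_simps del: zero_ereal_def[symmetric])
    show "((F \<circ> real_of_ereal) \<longlongrightarrow> B) (at_left \<infinity>)"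
      using assms(5) by (simp add: ereal_tendsto_simps)
    show "set_integrable lborel (einterval (ereal 0) \<infinity>) f"
      using assms(3) by (simp add: integrable_half_line_iff)
    fix u assume "ereal 0 < ereal u"
    then have u: "u > 0" by simp
    show "(F has_vector_derivative f u) (at u)" using u by (rule assms)
    show "isCont f u" using u assms(2) by (simp add: continuous_on_eq_continuous_at)
  qed simp
  then show ?thesis by (simp add: integral_half_line interval_integral_to_infinity_eq)
qed

text \<open>For a nonnegative integrand, integrability is a consequence of the two limits rather
  than a premise.\<close>

lemma half_line_FTC_nonneg:
  fixes f F :: "real \<Rightarrow> real"
  assumes "\<And>u. u > 0 \<Longrightarrow> (F has_real_derivative f u) (at u)" "continuous_on {0<..} f"
    and "\<And>u. u > 0 \<Longrightarrow> f u \<ge> 0" "(F \<longlongrightarrow> A) (at_right 0)" "(F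
        \<longlongrightarrow> B) at_top"
  shows "integrable half_line f" "half_integral f = B - A"
proof -
  have A: "((F \<circ> real_of_ereal) \<longlongrightarrow> A) (at_right (ereal 0))"
    using assms(4) by (simp add: ereal_tendsto_simps del: zero_ereal_def[symmetric])
  have B: "((F \<circ> real_of_ereal) \<longlongrightarrow> B) (at_left \<infinity>)"
    using assms(5) by (simp add: ereal_tendsto_simps)
  have nonneg: "AE x in lborel. ereal 0 < ereal x \<longrightarrow> ereal x < \<infinity>
      \<longrightarrow> 0 \<le> f x"
    using assms(3) by simp
  have cont: "isCont f u" if "ereal 0 < ereal u" for u
    using that assms(2) by (simp add: continuous_on_eq_continuous_at)
  have deriv: "(F has_real_derivative f u) (at u)" if "ereal 0 < ereal u" for u
    using that assms(1) by simp
  show "integrable half_line f" "half_integral f = B - A"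
    using interval_integral_FTC_nonneg[OF _ deriv cont nonneg A B]
    by (simp_all add: integral_half_line integrable_half_line_iff interval_integral_to_infinity_eq)
qed

lemma half_line_cauchy_kernel:
  fixes b :: real
  assumes "b > 0"
  shows "integrable half_line (\<lambda>u. 1 / (b\<^sup>2 + u\<^sup>2))"
    and "half_integral (\<lambda>u. 1 / (b\<^sup>2 + u\<^sup>2)) = pi / (2 * b)"
proof -
  have pos: "b\<^sup>2 + u\<^sup>2 > 0" for u using assms by (intro add_pos_nonneg) auto
  have *: "((\<lambda>u. arctan (u / b) / b) has_real_derivative 1 / (b\<^sup>2 + u\<^sup>2)) (at u)" if "u > 0" for u
  proof -
    have "1 + (u / b)\<^sup>2 = (b\<^sup>2 + u\<^sup>2) / b\<^sup>2" using assms by (simp add: field_simps)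
    then show ?thesis using assms
      by (auto intro!: derivative_eq_intros simp: power2_eq_square)
  qed
  have c: "continuous_on {0<..} (\<lambda>u. 1 / (b\<^sup>2 + u\<^sup>2))"
    using pos by (intro continuous_intros) (metis less_irrefl)
  have n: "1 / (b\<^sup>2 + u\<^sup>2) \<ge> 0" for u using pos[of u] by simp
  have A: "((\<lambda>u. arctan (u / b) / b) \<longlongrightarrow> 0) (at_right 0)"
    using assms by (auto intro!: tendsto_eq_intros)
  have "filterlim (\<lambda>u. u / b) at_top at_top"
    using assms by real_asymp
  then have B: "((\<lambda>u. arctan (u / b) / b) \<longlongrightarrow> (pi / 2) / b) at_top"
    by (intro tendsto_divide filterlim_compose[OF tendsto_arctan_at_top] tendsto_const) (use assms in auto)
  show "integrable half_line (\<lambda>u. 1 / (b\<^sup>2 + u\<^sup>2))"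
    by (rule half_line_FTC_nonneg(1)[OF * c n A B])
  show "half_integral (\<lambda>u. 1 / (b\<^sup>2 + u\<^sup>2)) = pi / (2 * b)"
    using half_line_FTC_nonneg(2)[OF * c n A B] by simp
qed

text \<open>Integrating this over the half-line is integrating \<open>f\<close> over the whole line,
  so residue evaluations can be stated without leaving \<open>half_line\<close>.\<close>

definition symmetrize :: "(real \<Rightarrow> complex) \<Rightarrow> real \<Rightarrow> complex" where
  "symmetrize f u = f u + f (- u)"

lemma continuous_on_symmetrize:
  assumes "continuous_on UNIV f"
  shows "continuous_on S (symmetrize f)"
proof -
  have "continuous_on UNIV (\<lambda>u. f u + f (- u))"
    by (intro continuous_on_add assms continuous_on_compose2[OF assms] continuous_intros) auto
  then show ?thesis unfolding symmetrize_def[abs_def] by (rule continuous_on_subset) simp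
qed

lemma integrable_symmetrize:
  fixes m K :: real
  assumes "continuous_on UNIV f" "m > 0" "\<And>u. norm (f u) \<le> K / (m\<^sup>2 + u\<^sup>2)"
  shows "integrable half_line (symmetrize f)"
proof (rule integrable_half_line_bound)
  show "integrable half_line (\<lambda>u. (2 * K) * (1 / (m\<^sup>2 + u\<^sup>2)))"
    using half_line_cauchy_kernel(1)[OF assms(2)] by (intro integrable_mult_right)
  show "symmetrize f \<in> borel_measurable half_line"
    by (intro borel_measurable_half_line continuous_on_symmetrize assms)
  fix u :: real
  have "norm (f u + f (- u)) \<le> K / (m\<^sup>2 + u\<^sup>2) + K / (m\<^sup>2 + (-u)\<^sup>2)"
    by (intro norm_triangle_mono assms)
  then show "norm (symmetrize f u) \<le> (2 * K) * (1 / (m\<^sup>2 + u\<^sup>2))" by (simp add: symmetrize_def)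
qed

text \<open>The folded integrand has the antiderivative F(u) - F(-u), which tends to 0 at both
  ends.\<close>

lemma integral_symmetrize_FTC:
  assumes "\<And>u. (F has_vector_derivative f u) (at u)" "continuous_on UNIV f"
    and "integrable half_line (symmetrize f)" "(F \<longlongrightarrow> A) at_top" "(F
        \<longlongrightarrow> A) at_bot"
  shows "half_integral (symmetrize f) = 0"
proof -
  have "half_integral (symmetrize f) = (A - A) - (F 0 - F 0)"
  proof (rule integral_half_line_FTC[where F = "\<lambda>u. F u - F (- u)"])
    fix u :: real
    have "((\<lambda>u. F (- u)) has_vector_derivative (-1) *\<^sub>R f (- u)) (at u)"
      using vector_diff_chain_at[OF has_vector_derivative_minus[OF has_vector_derivative_id] assms(1)[of "- u"]]
      by (simp add: o_def)
    then show "((\<lambda>u. F u - F (- u)) has_vector_derivative symmetrize f u) (at u)"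
      unfolding symmetrize_def using has_vector_derivative_diff[OF assms(1)[of u]] by fastforce
  next
    have "isCont F 0" using assms(1) has_vector_derivative_continuous by blast
    then have F0: "(F \<longlongrightarrow> F 0) (nhds 0)" by (simp add: isCont_def tendsto_at_iff_tendsto_nhds)
    have "filterlim uminus (nhds (0::real)) (at_right 0)" "filterlim (\<lambda>u. u) (nhds (0::real)) (at_right 0)"
      by (auto intro!: tendsto_eq_intros)
    then show "((\<lambda>u. F u - F (- u)) \<longlongrightarrow> F 0 - F 0) (at_right 0)"
      by (intro tendsto_diff filterlim_compose[OF F0])
    show "((\<lambda>u. F u - F (- u)) \<longlongrightarrow> A - A) at_top"
      by (intro tendsto_diff assms(4) filterlim_compose[OF assms(5)] filterlim_uminus_at_bot_at_top)
  qed (use assms continuous_on_symmetrize in auto)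
  then show ?thesis by simp
qed

section \<open>Integrals of products of poles and the Poisson integral of a negative power\<close>

lemma add_imag_nz: "c > 0 \<Longrightarrow> of_real u + \<i> * of_real c \<noteq> 0"
  by (auto simp: complex_eq_iff)

lemma norm_add_imag: "norm (complex_of_real u + \<i> * of_real c) = sqrt (c\<^sup>2 + u\<^sup>2)"
  by (simp add: cmod_def add.commute)

lemma tendsto_inverse_add_imag:
  "((\<lambda>u. 1 / (complex_of_real u + \<i> * of_real c)) \<longlongrightarrow> 0) at_top"
  "((\<lambda>u. 1 / (complex_of_real u + \<i> * of_real c)) \<longlongrightarrow> 0) at_bot"
proof -
  have top: "((\<lambda>u. 1 / (complex_of_real u + \<i> * of_real c)) \<longlongrightarrow> 0) at_infinity"
  proof (rule Lim_null_comparison)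
    have "norm (1 / (complex_of_real u + \<i> * of_real c)) \<le> norm (inverse u)" if "u \<noteq> 0" for u
      unfolding norm_divide norm_add_imag using that
      by (simp add: inverse_eq_divide) (intro divide_left_mono, auto intro!: real_le_rsqrt mult_pos_pos
          simp: add_nonneg_pos)
    then show "\<forall>\<^sub>F u in at_infinity. norm (1 / (complex_of_real u + \<i> * of_real c))
        \<le> norm (inverse u)"
      using eventually_not_equal_at_infinity[of "0::real"] by (auto elim!: eventually_mono)
    show "((\<lambda>u::real. norm (inverse u)) \<longlongrightarrow> 0) at_infinity"
      using tendsto_norm[OF tendsto_inverse_0[where 'a = real]] by simp
  qed
  show "((\<lambda>u. 1 / (complex_of_real u + \<i> * of_real c)) \<longlongrightarrow> 0) at_top"
    using top at_top_le_at_infinity by (rule tendsto_mono[rotated])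
  show "((\<lambda>u. 1 / (complex_of_real u + \<i> * of_real c)) \<longlongrightarrow> 0) at_bot"
    using top at_bot_le_at_infinity by (rule tendsto_mono[rotated])
qed

lemma norm_pole_prod_le:
  assumes "b > 0" "c > 0"
  shows "norm (1 / ((complex_of_real u + \<i> * of_real c) ^ Suc n * (of_real u + \<i> * of_real b)))
    \<le> (1 / c ^ n) / ((min b c)\<^sup>2 + u\<^sup>2)"
proof -
  let ?m = "min b c"
  have m: "sqrt (?m\<^sup>2 + u\<^sup>2) \<le> sqrt (c\<^sup>2 + u\<^sup>2)" "sqrt (?m\<^sup>2 +
      u\<^sup>2) \<le> sqrt (b\<^sup>2 + u\<^sup>2)"
    using assms by (auto intro!: power_mono)
  have pos: "?m\<^sup>2 + u\<^sup>2 > 0" using assms by (intro add_pos_nonneg) auto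
  have cs: "c \<le> sqrt (c\<^sup>2 + u\<^sup>2)" by (rule real_le_rsqrt) simp
  have "c ^ n * (sqrt (?m\<^sup>2 + u\<^sup>2) * sqrt (?m\<^sup>2 + u\<^sup>2))
      \<le> sqrt (c\<^sup>2 + u\<^sup>2) ^ n * (sqrt (c\<^sup>2 + u\<^sup>2) * sqrt (b\<^sup>2 + u\<^sup>2))"
    using m cs assms by (intro mult_mono power_mono) auto
  then have "c ^ n * (?m\<^sup>2 + u\<^sup>2) \<le> sqrt (c\<^sup>2 + u\<^sup>2) ^ Suc n * sqrt
      (b\<^sup>2 + u\<^sup>2)"
    using pos by (simp add: mult_ac)
  then show ?thesis
    unfolding norm_divide norm_mult norm_power norm_add_imag using pos assms
    by (simp del: power_Suc) (rule divide_left_mono, auto intro!: mult_pos_pos zero_less_power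
        add_pos_nonneg simp del: power_Suc)
qed

text \<open>All poles lie below the real axis and the integrand is of order u^(-2), so closing the
  contour upwards would give 0. Explicit antiderivatives replace the contour here.\<close>

lemma integral_pole_prod_eq_0:
  assumes "b > 0" "c > 0"
  shows "half_integral
    (symmetrize (\<lambda>u. 1 / ((of_real u + \<i> * of_real c) ^ Suc n * (of_real u + \<i> * of_real b)))) = 0"
proof -
  define f where "f n u = 1 / ((complex_of_real u + \<i> * of_real c) ^ Suc n * (of_real u + \<i> *
      of_real b))" for n u
  have cont: "continuous_on UNIV (f n)" for n
    unfolding f_def using assms by (intro continuous_intros) (auto simp: add_imag_nz)
  have int: "integrable half_line (symmetrize (f n))" for n
    using norm_pole_prod_le[OF assms, of _ n] assms
    by (intro integrable_symmetrize[OF cont, where m = "min b c" and K = "1 / c ^ n"]) (auto simp: f_def)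
  have pow: "half_integral (symmetrize (\<lambda>u. 1 / (complex_of_real u + \<i> * of_real c) ^ Suc (Suc n))) = 0"
    "integrable half_line (symmetrize (\<lambda>u. 1 / (complex_of_real u + \<i> * of_real c) ^ Suc (Suc n)))" for n
  proof -
    let ?f = "\<lambda>u. 1 / (complex_of_real u + \<i> * of_real c) ^ Suc (Suc n)"
    let ?F = "\<lambda>u. - 1 / of_nat (Suc n) * (1 / (complex_of_real u + \<i> * of_real c)) ^ Suc n"
    have c: "continuous_on UNIV ?f"
      using assms by (intro continuous_intros) (auto simp: add_imag_nz)
    show i: "integrable half_line (symmetrize ?f)"
      using norm_pole_prod_le[OF assms(2,2), of _ n] assms(2)
      by (intro integrable_symmetrize[OF c, where m = "min c c" and K = "1 / c ^ n"]) (auto simp: mult_ac)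
    show "half_integral (symmetrize ?f) = 0"
    proof (rule integral_symmetrize_FTC[OF _ c i])
      fix u :: real
      have "((\<lambda>z. - 1 / of_nat (Suc n) * (1 / (z + \<i> * of_real c)) ^ Suc n)
          has_field_derivative ?f u) (at (of_real u))"
        using add_imag_nz[OF assms(2), of u]
        by (auto intro!: derivative_eq_intros simp: power_divide divide_simps simp del: of_nat_Suc)
           (cases n; simp add: algebra_simps)
      then show "(?F has_vector_derivative ?f u) (at u)" by (rule has_vector_derivative_real_field)
    next
      have "(?F \<longlongrightarrow> - 1 / of_nat (Suc n) * 0 ^ Suc n) at_top"
        by (intro tendsto_mult tendsto_const tendsto_power tendsto_inverse_add_imag)
      then show "(?F \<longlongrightarrow> 0) at_top" by simp
      have "(?F \<longlongrightarrow> - 1 / of_nat (Suc n) * 0 ^ Suc n) at_bot"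
        by (intro tendsto_mult tendsto_const tendsto_power tendsto_inverse_add_imag)
      then show "(?F \<longlongrightarrow> 0) at_bot" by simp
    qed
  qed
  show ?thesis
  proof (cases "b = c")
    case True
    then show ?thesis using pow(1)[of n] by (simp add: mult_ac)
  next
    case False
    \<comment> \<open>The difference of the two linear factors. Dividing by it gives both the
      partial fraction step from n to n + 1 and the logarithmic antiderivative for n = 0.\<close>
    define d where "d = \<i> * (of_real c - of_real b)"
    have d: "d \<noteq> 0" using False by (simp add: d_def)
    have "half_integral (symmetrize (f n)) = 0"
    proof (induction n)
      case 0
      let ?g = "\<lambda>z. (z + \<i> * of_real b) / (z + \<i> * of_real c) :: complex"
      show ?case
      proof (rule integral_symmetrize_FTC[OF _ cont int])
        fix u :: real
        have nz: "of_real u + \<i> * of_real c \<noteq> 0" "of_real u + \<i> * of_real b \<noteq> 0"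
          using assms add_imag_nz by auto
        \<comment> \<open>Both poles lie on the same side of the real axis, so the quotient keeps a
          positive real part and the principal logarithm is an antiderivative on the whole
          line.\<close>
        have "?g (of_real u) \<notin> \<real>\<^sub>\<le>\<^sub>0"
        proof
          assume "?g (of_real u) \<in> \<real>\<^sub>\<le>\<^sub>0"
          then have "Re (?g (of_real u)) \<le> 0" by (simp add: complex_nonpos_Reals_iff)
          moreover have "Re (?g (of_real u)) = (u\<^sup>2 + b * c) / (u\<^sup>2 + c\<^sup>2)"
            by (simp add: Re_divide power2_eq_square)
          moreover have "(u\<^sup>2 + b * c) / (u\<^sup>2 + c\<^sup>2) > 0"
            using assms by (intro divide_pos_pos add_nonneg_pos) auto
          ultimately show False by simp
        qed
        then have "((\<lambda>z. Ln (?g z) / d) has_field_derivative f 0 u) (at (of_real u))"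
          using nz d unfolding f_def
          by (auto intro!: derivative_eq_intros simp: divide_simps) (simp_all add: d_def algebra_simps)
        then show "((\<lambda>u. Ln (?g (of_real u)) / d) has_vector_derivative f 0 u) (at u)"
          by (rule has_vector_derivative_real_field)
      next
        have eq: "?g (of_real u) = 1 - d * (1 / (of_real u + \<i> * of_real c))" for u
          using add_imag_nz[OF assms(2), of u] by (simp add: d_def field_simps)
        have "((\<lambda>u. Ln (1 - d * (1 / (of_real u + \<i> * of_real c))) / d) \<longlongrightarrow>
            Ln (1 - d * 0) / d) at_top"
          using d by (intro tendsto_intros tendsto_inverse_add_imag) auto
        then show "((\<lambda>u. Ln (?g (of_real u)) / d) \<longlongrightarrow> 0) at_top" unfolding eq by simp
        have "((\<lambda>u. Ln (1 - d * (1 / (of_real u + \<i> * of_real c))) / d) \<longlongrightarrow>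
            Ln (1 - d * 0) / d) at_bot"
          using d by (intro tendsto_intros tendsto_inverse_add_imag) auto
        then show "((\<lambda>u. Ln (?g (of_real u)) / d) \<longlongrightarrow> 0) at_bot" unfolding eq by simp
      qed
    next
      case (Suc n)
      have "symmetrize (f (Suc n)) u = (symmetrize (f n) u
          - symmetrize (\<lambda>u. 1 / (complex_of_real u + \<i> * of_real c) ^ Suc (Suc n)) u) / d" for u
      proof -
        have "f (Suc n) u = (f n u - 1 / (complex_of_real u + \<i> * of_real c) ^ Suc (Suc n)) / d" for u
        proof -
          have nz: "of_real u + \<i> * of_real c \<noteq> 0" "of_real u + \<i> * of_real b \<noteq> 0"
            using assms add_imag_nz by auto
          have "f n u - 1 / (complex_of_real u + \<i> * of_real c) ^ Suc (Suc n)
              = ((of_real u + \<i> * of_real c) - (of_real u + \<i> * of_real b)) * f (Suc n) u"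
            unfolding f_def using nz by (simp add: divide_simps)
          also have "\<dots> = d * f (Suc n) u" by (simp add: d_def algebra_simps)
          finally show ?thesis using d by simp
        qed
        then show ?thesis by (simp add: symmetrize_def add_divide_distrib diff_divide_distrib)
      qed
      then have "symmetrize (f (Suc n)) = (\<lambda>u. (symmetrize (f n) u
          - symmetrize (\<lambda>u. 1 / (complex_of_real u + \<i> * of_real c) ^ Suc (Suc n)) u) / d)" by blast
      then show ?case using Suc int pow[of n] by (simp add: Bochner_Integration.integral_diff)
    qed
    then show ?thesis by (simp add: f_def[abs_def])
  qed
qed

lemma norm_poisson_le:
  assumes "b > 0" "c > 0"
  shows "norm (of_real (2 * b) / ((complex_of_real u + \<i> * of_real c) ^ n * of_real (b\<^sup>2 + u\<^sup>2)))
    \<le> (2 * b / c ^ n) / (b\<^sup>2 + u\<^sup>2)"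
proof -
  have pos: "b\<^sup>2 + u\<^sup>2 > 0" using assms by (intro add_pos_nonneg) auto
  have cs: "c \<le> sqrt (c\<^sup>2 + u\<^sup>2)" by (rule real_le_rsqrt) simp
  have "2 * b / (sqrt (c\<^sup>2 + u\<^sup>2) ^ n * (b\<^sup>2 + u\<^sup>2)) \<le> 2 * b / (c ^ n *
      (b\<^sup>2 + u\<^sup>2))"
    using pos cs assms
    by (intro divide_left_mono mult_right_mono power_mono mult_pos_pos) (auto intro!: zero_less_power add_pos_nonneg)
  moreover have "norm (complex_of_real (b\<^sup>2 + u\<^sup>2)) = b\<^sup>2 + u\<^sup>2"
    using pos by (metis abs_of_pos norm_of_real)
  ultimately show ?thesis
    using assms unfolding norm_divide norm_mult norm_power norm_add_imag by simp
qed

text \<open>(z + i c)^(-n) is bounded and holomorphic in the upper half-plane, so its Poisson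
  integral reproduces its value at i b, here with the factor 2 pi.\<close>

lemma half_line_poisson:
  assumes "b > 0" "c > 0"
  defines "f \<equiv> \<lambda>n u. of_real (2 * b) / ((complex_of_real u + \<i> * of_real c) ^ n *
      of_real (b\<^sup>2 + u\<^sup>2))"
  shows "integrable half_line (symmetrize (f n))"
    and "half_integral (symmetrize (f n)) = 2 * of_real pi / (\<i> * of_real (b + c)) ^ n"
proof -
  have pos: "b\<^sup>2 + u\<^sup>2 > 0" for u using assms by (intro add_pos_nonneg) auto
  have nzr: "complex_of_real (b\<^sup>2 + u\<^sup>2) \<noteq> 0" for u
    using pos[of u] by (metis less_irrefl of_real_eq_0_iff)
  have cont: "continuous_on UNIV (f n)" for n
    unfolding f_def using assms nzr by (intro continuous_intros) (auto simp: add_imag_nz)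
  show int: "integrable half_line (symmetrize (f n))" for n
    using norm_poisson_le[OF assms(1,2)] assms
    by (intro integrable_symmetrize[OF cont, where m = b and K = "2 * b / c ^ n"]) (auto simp: f_def)
  show "half_integral (symmetrize (f n)) = 2 * of_real pi / (\<i> * of_real (b + c)) ^ n"
  proof (induction n)
    case 0
    have "symmetrize (f 0) = (\<lambda>u. complex_of_real (4 * b * (1 / (b\<^sup>2 + u\<^sup>2))))"
      by (simp add: symmetrize_def f_def fun_eq_iff)
    then have "half_integral (symmetrize (f 0)) = of_real (half_integral (\<lambda>u. 4 * b * (1 /
        (b\<^sup>2 + u\<^sup>2))))"
      by (simp only: integral_complex_of_real)
    also have "half_integral (\<lambda>u. 4 * b * (1 / (b\<^sup>2 + u\<^sup>2))) = 4 * b * (pi / (2 * b))"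
      unfolding half_line_cauchy_kernel(2)[OF assms(1), symmetric] by (rule integral_mult_right_zero)
    finally have "half_integral (symmetrize (f 0)) = of_real (4 * b * (pi / (2 * b)))" .
    then show ?case using assms by simp
  next
    case (Suc n)
    define e where "e = \<i> * complex_of_real (b + c)"
    have e: "e \<noteq> 0" using assms by (simp add: e_def complex_eq_iff)
    let ?g = "\<lambda>u. 1 / ((of_real u + \<i> * of_real c) ^ Suc n * (of_real u + \<i> * of_real b))"
    have gi: "integrable half_line (symmetrize ?g)"
      using norm_pole_prod_le[OF assms(1,2), of _ n] assms
      by (intro integrable_symmetrize[where m = "min b c" and K = "1 / c ^ n"])
         (auto intro!: continuous_intros simp: add_imag_nz)
    \<comment> \<open>With b^2 + u^2 = (u + i b)(u - i b), the identity (u + i c) - (u - i b) = i (b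
      + c) relates the two exponents; the extra term is a product of poles with integral 0.\<close>
    have "f (Suc n) u = (f n u - of_real (2 * b) * ?g u) / e" for u
    proof -
      have nz: "of_real u + \<i> * of_real c \<noteq> 0" "of_real u + \<i> * of_real b \<noteq> 0"
          "of_real u - \<i> * of_real b \<noteq> 0"
        using assms add_imag_nz by (auto simp: complex_eq_iff)
      have fac: "complex_of_real (b\<^sup>2 + u\<^sup>2) = (of_real u + \<i> * of_real b) * (of_real u -
          \<i> * of_real b)"
        by (simp add: algebra_simps power2_eq_square)
      have "f n u - of_real (2 * b) * ?g u
          = ((of_real u + \<i> * of_real c) - (of_real u - \<i> * of_real b)) * f (Suc n) u"
        unfolding f_def fac using nz by (simp add: divide_simps) (simp add: algebra_simps)
      also have "\<dots> = e * f (Suc n) u" by (simp add: e_def algebra_simps)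
      finally show ?thesis using e by simp
    qed
    then have "symmetrize (f (Suc n)) = (\<lambda>u. (symmetrize (f n) u - of_real (2 * b) * symmetrize ?g u) / e)"
      unfolding symmetrize_def fun_eq_iff
      by (simp only: add_divide_distrib diff_divide_distrib distrib_left) simp
    then have "half_integral (symmetrize (f (Suc n))) =
        (half_integral (symmetrize (f n)) - of_real (2 * b) * half_integral (symmetrize ?g)) / e"
      using int gi by (simp add: Bochner_Integration.integral_diff)
    also have "\<dots> = 2 * of_real pi / e ^ n / e"
      unfolding integral_pole_prod_eq_0[OF assms(1,2)] Suc by (simp add: e_def)
    finally show ?case by (simp add: e_def mult.commute)
  qed
qed

section \<open>Regularised kernel summation\<close>

text \<open>The point 1 is a null set, so nothing is required of \<open>f\<close> there except
  measurability.\<close>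

lemma half_line_split:
  fixes f :: "real \<Rightarrow> 'a::{banach, second_countable_topology}"
  assumes "set_integrable lborel {0<..<1} f1" "set_integrable lborel {1<..} f2"
    and "\<And>u. 0 < u \<Longrightarrow> u < 1 \<Longrightarrow> f u = f1 u" "\<And>u. u > 1
        \<Longrightarrow> f u = f2 u"
    and "f \<in> borel_measurable half_line"
  shows "integrable half_line f"
    and "half_integral f = (LBINT u:{0<..<1}. f1 u) + (LBINT u:{1<..}. f2 u)"
proof -
  let ?g = "\<lambda>u. indicator {0<..} u *\<^sub>R f u"
  let ?h = "\<lambda>u. indicator {0<..<1} u *\<^sub>R f1 u + indicator {1<..} u *\<^sub>R f2 u"
  have g: "?g \<in> borel_measurable lborel"
    using assms(5) by (subst (asm) borel_measurable_restrict_space_iff) auto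
  have h: "integrable lborel ?h"
    using assms(1,2) by (simp add: set_integrable_def)
  have ae: "AE u in lborel. ?h u = ?g u"
    using AE_lborel_singleton[of "1::real"]
    by eventually_elim (use assms(3,4) in \<open>auto simp: indicator_def\<close>)
  show "integrable half_line f"
    unfolding integrable_half_line_iff set_integrable_def
    using integrable_cong_AE_imp[OF h g] ae by (auto simp: eq_commute)
  show "half_integral f = (LBINT u:{0<..<1}. f1 u) + (LBINT u:{1<..}. f2 u)"
    unfolding integral_half_line set_lebesgue_integral_def
    using integral_cong_AE[OF _ _ ae] g h assms(1,2)
    by (simp add: set_integrable_def borel_measurable_integrable)
qed

text \<open>Exchanges the sharp cutoff at 1, suited to the Mellin transform, for the smooth cutoff
  at scale \<open>c\<close>, suited to Poisson kernels; the logarithm is the price.\<close>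

lemma half_line_cutoff_comparison:
  fixes c :: real
  assumes "c > 0"
  defines "f \<equiv> \<lambda>u. ((if u < 1 then 1 else 0) - c\<^sup>2 / (c\<^sup>2 + u\<^sup>2)) / u"
  shows "integrable half_line f" "half_integral f = - ln c"
proof -
  have pos: "c\<^sup>2 + u\<^sup>2 > 0" for u using assms(1) by (intro add_pos_nonneg) auto
  then have nz: "c\<^sup>2 + u\<^sup>2 \<noteq> 0" for u by (metis less_irrefl)
  let ?f1 = "\<lambda>u. u / (c\<^sup>2 + u\<^sup>2)" and ?f2 = "\<lambda>u. c\<^sup>2 / (u * (c\<^sup>2
      + u\<^sup>2))"
  let ?F1 = "\<lambda>u. ln (c\<^sup>2 + u\<^sup>2) / 2" and ?F2 = "\<lambda>u. ln u - ln (c\<^sup>2 + u\<^sup>2) / 2"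
  have d1: "(?F1 has_real_derivative ?f1 u) (at u)" for u
  proof -
    have "((\<lambda>u. ln (c\<^sup>2 + u\<^sup>2)) has_real_derivative (2 * u) / (c\<^sup>2 + u\<^sup>2)) (at u)"
      using pos[of u] by (auto intro!: derivative_eq_intros)
    moreover have "2 * u / D / 2 = u / D" for D :: real by simp
    ultimately show ?thesis using DERIV_cdivide[of "\<lambda>u. ln (c\<^sup>2 + u\<^sup>2)" _ u UNIV 2] by metis
  qed
  have d2: "(?F2 has_real_derivative ?f2 u) (at u)" if "u > 0" for u
  proof -
    have "1 / u - u / D = (D - u\<^sup>2) / (u * D)" if "D \<noteq> 0" for D
      using that \<open>u > 0\<close> by (simp add: divide_simps power2_eq_square)
    from this[OF nz[of u]] have "1 / u - ?f1 u = ?f2 u" by simp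
    then show ?thesis using DERIV_diff[OF DERIV_ln_divide[OF that] d1] by simp
  qed
  have c1: "isCont ?f1 u" for u using nz by (intro continuous_intros) auto
  have c2: "isCont ?f2 u" if "u > 0" for u using nz that by (intro continuous_intros) auto
  have L1: "((?F1 \<circ> real_of_ereal) \<longlongrightarrow> ln (c\<^sup>2 + 0\<^sup>2) / 2) (at_right (ereal 0))"
    unfolding ereal_tendsto_simps by (intro tendsto_intros nz) simp_all
  have L2: "((?F1 \<circ> real_of_ereal) \<longlongrightarrow> ln (c\<^sup>2 + 1\<^sup>2) / 2) (at_left (ereal 1))"
    unfolding ereal_tendsto_simps by (intro tendsto_intros nz) simp_all
  have L3: "((?F2 \<circ> real_of_ereal) \<longlongrightarrow> ln 1 - ln (c\<^sup>2 + 1\<^sup>2) / 2)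
      (at_right (ereal 1))"
    unfolding ereal_tendsto_simps by (intro tendsto_intros nz) simp_all
  have L4: "((?F2 \<circ> real_of_ereal) \<longlongrightarrow> 0) (at_left \<infinity>)"
    unfolding ereal_tendsto_simps using assms(1) by real_asymp
  have I1: "set_integrable lborel (einterval (ereal 0) (ereal 1)) ?f1"
    "(LBINT u=ereal 0..ereal 1. ?f1 u) = ln (c\<^sup>2 + 1\<^sup>2) / 2 - ln (c\<^sup>2 + 0\<^sup>2) / 2"
    using interval_integral_FTC_nonneg[OF _ d1 c1 _ L1 L2] pos[THEN less_imp_le] by auto
  have I2: "set_integrable lborel (einterval (ereal 1) \<infinity>) ?f2"
    "(LBINT u=ereal 1..\<infinity>. ?f2 u) = 0 - (ln 1 - ln (c\<^sup>2 + 1\<^sup>2) / 2)"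
    using interval_integral_FTC_nonneg[of "ereal 1" "\<infinity>" ?F2 ?f2, OF _ d2 c2 _ L3 L4] pos[THEN less_imp_le]
    by auto
  have s1: "set_integrable lborel {0<..<1} ?f1" using I1(1) by simp
  have s2: "set_integrable lborel {1<..} (\<lambda>u. - ?f2 u)" using I2(1) by (simp add: set_integrable_def)
  have e1: "f u = ?f1 u" if "0 < u" "u < 1" for u
  proof -
    have "1 - c\<^sup>2 / (c\<^sup>2 + u\<^sup>2) = u\<^sup>2 / (c\<^sup>2 + u\<^sup>2)"
      using diff_divide_distrib[of "c\<^sup>2 + u\<^sup>2" "c\<^sup>2" "c\<^sup>2 + u\<^sup>2"]
          divide_self[OF nz[of u]] by simp
    then show ?thesis using that by (simp add: f_def power2_eq_square)
  qed
  have e2: "f u = - ?f2 u" if "u > 1" for u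
    using that by (simp add: f_def mult.commute)
  have m: "f \<in> borel_measurable half_line" unfolding f_def by measurable
  show "integrable half_line f" by (rule half_line_split(1)[OF s1 s2 e1 e2 m])
  have "half_integral f = (LBINT u:{0<..<1}. ?f1 u) + (LBINT u:{1<..}. - ?f2 u)"
    by (rule half_line_split(2)[OF s1 s2 e1 e2 m])
  also have "(LBINT u:{1<..}. - ?f2 u) = - (LBINT u:{1<..}. ?f2 u)"
    by (simp add: set_lebesgue_integral_def)
  also have "(LBINT u:{1<..}. ?f2 u) = ln (c\<^sup>2 + 1\<^sup>2) / 2"
    using I2(2) by (simp add: interval_integral_to_infinity_eq)
  also have "(LBINT u:{0<..<1}. ?f1 u) = ln (c\<^sup>2 + 1\<^sup>2) / 2 - ln (c\<^sup>2) / 2"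
    using I1(2) by (simp add: interval_lebesgue_integral_def)
  finally show "half_integral f = - ln c" using assms(1) by (simp add: ln_realpow)
qed

text \<open>The double telescoping is symmetric in \<open>N\<close> and \<open>R\<close>, so an
  infinite sum over \<open>R\<close> terms becomes a finite sum of \<open>N\<close> terms whose
  second parts tend to 0.\<close>

lemma sum_harmonic_shift:
  "(\<Sum>r<R. 1 / real (Suc r) - 1 / real (N + Suc r)) = (\<Sum>j<N. 1 / real (Suc j) - 1 / real (R + Suc j))"
proof (induction R)
  case (Suc R)
  have "(\<Sum>j<N. 1 / real (R + Suc j) - 1 / real (R + Suc (Suc j))) = 1 / real (Suc R) - 1 / real (R + Suc N)"
    using sum_lessThan_telescope'[of "\<lambda>j. 1 / real (R + Suc j)" N] by simp
  moreover have "(\<Sum>j<N. 1 / real (Suc j) - 1 / real (Suc R + Suc j))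
     = (\<Sum>j<N. 1 / real (Suc j) - 1 / real (R + Suc j)) + (\<Sum>j<N. 1 / real (R + Suc j) - 1 / real
         (R + Suc (Suc j)))"
    by (simp add: sum.distrib[symmetric])
  ultimately show ?case using Suc by (simp add: add.commute)
qed simp

lemma harmonic_shift_tendsto:
  "(\<lambda>R. \<Sum>r<R. 1 / real (Suc r) - 1 / real (N + Suc r)) \<longlonglongrightarrow> harm N"
proof -
  have "(\<lambda>R. \<Sum>j<N. 1 / real (Suc j) - 1 / real (R + Suc j)) \<longlonglongrightarrow>
      (\<Sum>j<N. 1 / real (Suc j) - 0)"
    by (intro tendsto_sum tendsto_diff tendsto_const) real_asymp
  also have "(\<Sum>j<N. 1 / real (Suc j) - 0) = harm N"
    by (simp add: harm_def lessThan_atLeast0 sum.atLeast1_atMost_eq inverse_eq_divide)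
  finally show ?thesis by (simp only: sum_harmonic_shift)
qed

lemma inverse_exp_minus_1_bounds:
  fixes v :: real
  assumes "v > 0"
  shows "0 < 1 / (exp v - 1)" "1 / (exp v - 1) \<le> 1 / v"
proof -
  have "exp v - 1 \<ge> v" using exp_ge_add_one_self[of v] by linarith
  then show "0 < 1 / (exp v - 1)" "1 / (exp v - 1) \<le> 1 / v"
    using assms by (auto intro: divide_left_mono)
qed

lemma integrable_exp_minus: "integrable half_line (\<lambda>u::real. exp (- u))"
proof (rule half_line_FTC_nonneg(1)[where F = "\<lambda>u. - exp (- u)" and A = "-1" and B = 0])
  show "((\<lambda>u::real. - exp (- u)) \<longlongrightarrow> -1) (at_right 0)" by (auto intro!: tendsto_eq_intros)
  show "((\<lambda>u::real. - exp (- u)) \<longlongrightarrow> 0) at_top" by real_asymp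
qed (auto intro!: derivative_eq_intros continuous_intros)

text \<open>The summation sees the moment only through these properties. \<open>P0\<close> is the
  limit at 0, \<open>P_lip\<close> makes P(u) - P0 absorb a factor 1/u, and \<open>P_zero\<close>
  disposes of the linear term u/X in the expansion of \<open>bose\<close>.\<close>

locale poisson_data =
  fixes P :: "real \<Rightarrow> complex" and P0 :: complex and C C' X :: real
  assumes X: "X > 0" and C: "C \<ge> 0" "C' \<ge> 0"
    and P_cont: "continuous_on {0<..} P"
    and P_exp: "u > 0 \<Longrightarrow> norm (P u) \<le> C * exp (- u)"
    and P_lip: "u > 0 \<Longrightarrow> norm (P u - P0) \<le> C' * u"
    and P_zero: "half_integral P = 0"
begin

definition bose :: "real \<Rightarrow> real" where
  "bose u = 1 / (exp (X / u) - 1)"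

text \<open>Away from 0 the poles of \<open>bose\<close> are the points i node r and their
  conjugates, since exp v - 1 vanishes at the multiples of 2 pi i. The index is shifted:
  \<open>node r\<close> belongs to the multiple r + 1.\<close>

definition node :: "nat \<Rightarrow> real" where
  "node r = X / (2 * pi * real (Suc r))"

definition kernel :: "nat \<Rightarrow> real \<Rightarrow> real" where
  "kernel r u = node r / ((node r)\<^sup>2 + u\<^sup>2)"

text \<open>A multiple of \<open>kernel N\<close>, so its integrals against the kernels are Poisson
  integrals again. Because of the shifted index, the harmonic number that appears is the one at
  \<open>Suc N\<close>.\<close>

definition cutoff :: "nat \<Rightarrow> real \<Rightarrow> real" where
  "cutoff N u = (node N)\<^sup>2 / ((node N)\<^sup>2 + u\<^sup>2)"

lemma node_pos: "node r > 0"
  using X by (simp add: node_def)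

lemma node_sq_pos: "(node r)\<^sup>2 + u\<^sup>2 > 0"
  using node_pos[of r] by (intro add_pos_nonneg) auto

lemma kernel_nonneg: "kernel r u \<ge> 0"
  using node_pos[of r] node_sq_pos[of r u] by (simp add: kernel_def less_imp_le)

lemma kernel_le: "kernel r u \<le> 1 / node r"
proof -
  have "kernel r u \<le> node r / (node r)\<^sup>2" unfolding kernel_def
    using node_pos[of r] by (intro divide_left_mono mult_pos_pos node_sq_pos) auto
  then show ?thesis using node_pos[of r] by (simp add: power2_eq_square)
qed

lemma continuous_on_kernel: "continuous_on S (kernel r)"
proof -
  have "(node r)\<^sup>2 + u\<^sup>2 \<noteq> 0" for u using node_sq_pos[of r u] by linarith
  then show ?thesis unfolding kernel_def[abs_def] by (intro continuous_intros) auto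
qed

lemma continuous_on_cutoff: "continuous_on S (cutoff N)"
proof -
  have "(node r)\<^sup>2 + u\<^sup>2 \<noteq> 0" for u r using node_sq_pos[of r u] by linarith
  then show ?thesis unfolding cutoff_def[abs_def] by (intro continuous_intros) auto
qed

lemma continuous_on_bose: "continuous_on {0<..} bose"
proof -
  have "exp (X / u) - 1 \<noteq> 0" if "u > 0" for u using X that by simp
  then show ?thesis unfolding bose_def[abs_def] by (intro continuous_intros) auto
qed

lemma bose_bounds:
  assumes "u > 0"
  shows "0 \<le> bose u" "bose u \<le> u / X"
  using inverse_exp_minus_1_bounds[of "X / u"] X assms by (auto simp: bose_def)

text \<open>Partial fractions at v = X/u; the additional division by \<open>u\<close> is the measure
  du/u.\<close>

lemma kernel_sums:
  assumes "u > 0"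
  shows "(\<lambda>r. kernel r u / (pi * real (Suc r))) sums ((bose u + 1 / 2 - u / X) / u)"
proof -
  have "(\<lambda>r. (2 * (X / u) / ((X / u)\<^sup>2 + 4 * pi\<^sup>2 * (real (Suc r))\<^sup>2)) / u)
     sums ((1 / (exp (X / u) - 1) + 1 / 2 - 1 / (X / u)) / u)"
    using X assms by (intro sums_divide coth_partial_fractions) simp
  also have "(\<lambda>r. (2 * (X / u) / ((X / u)\<^sup>2 + 4 * pi\<^sup>2 * (real (Suc r))\<^sup>2)) /
      u) = (\<lambda>r. kernel r u / (pi * real (Suc r)))"
  proof
    fix r
    let ?s = "real (Suc r)"
    have p: "X\<^sup>2 + (2 * pi * ?s * u)\<^sup>2 > 0" using X by (intro add_pos_nonneg) auto
    have "(X / u)\<^sup>2 + 4 * pi\<^sup>2 * ?s\<^sup>2 = (X\<^sup>2 + (2 * pi * ?s * u)\<^sup>2) / u\<^sup>2"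
      using assms unfolding power_mult_distrib power_divide by (simp add: divide_simps)
    then have "(2 * (X / u) / ((X / u)\<^sup>2 + 4 * pi\<^sup>2 * ?s\<^sup>2)) / u = 2 * X / (X\<^sup>2 +
        (2 * pi * ?s * u)\<^sup>2)"
      using assms by (simp add: power2_eq_square)
    moreover have "(node r)\<^sup>2 + u\<^sup>2 = (X\<^sup>2 + (2 * pi * ?s * u)\<^sup>2) / (2 * pi * ?s)\<^sup>2"
      unfolding node_def power_mult_distrib power_divide by (simp add: divide_simps del: of_nat_Suc)
    then have "kernel r u / (pi * ?s) = (X / (2 * pi * ?s)) / ((X\<^sup>2 + (2 * pi * ?s * u)\<^sup>2) /
        (2 * pi * ?s)\<^sup>2) / (pi * ?s)"
      by (simp add: kernel_def node_def del: of_nat_Suc)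
    moreover have "(X / (2 * pi * ?s)) / ((X\<^sup>2 + (2 * pi * ?s * u)\<^sup>2) / (2 * pi * ?s)\<^sup>2) / (pi * ?s)
        = 2 * X / (X\<^sup>2 + (2 * pi * ?s * u)\<^sup>2)"
      using p by (simp add: power2_eq_square divide_simps del: of_nat_Suc)
    ultimately show "(2 * (X / u) / ((X / u)\<^sup>2 + 4 * pi\<^sup>2 * ?s\<^sup>2)) / u = kernel r u /
        (pi * ?s)" by simp
  qed
  finally show ?thesis by (simp add: bose_def)
qed

text \<open>Nonnegative terms keep the partial sums below the limit, and \<open>bose_bounds\<close>
  leaves only the 1/2. This majorant is what forces the integrand to vanish at 0.\<close>

lemma kernel_partial_sum_le:
  assumes "u > 0"
  shows "(\<Sum>r<R. kernel r u / (pi * real (Suc r))) \<le> 1 / (2 * u)"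
proof -
  have "(\<Sum>r<R. kernel r u / (pi * real (Suc r))) \<le> (bose u + 1 / 2 - u / X) / u"
    using kernel_sums[OF assms] kernel_nonneg
    by (intro sum_le_suminf[THEN order.trans]) (auto simp: sums_iff)
  also have "\<dots> \<le> (1 / 2) / u"
  proof (rule divide_right_mono)
    show "bose u + 1 / 2 - u / X \<le> 1 / 2" using bose_bounds[OF assms] by linarith
  qed (use assms in simp)
  finally show ?thesis by simp
qed

lemma P_measurable [measurable]: "P \<in> borel_measurable half_line"
  by (rule borel_measurable_half_line[OF P_cont])

lemma kernel_measurable [measurable]: "kernel r \<in> borel_measurable half_line"
  by (rule borel_measurable_half_line[OF continuous_on_kernel])

lemma cutoff_measurable [measurable]: "cutoff r \<in> borel_measurable half_line"
  by (rule borel_measurable_half_line[OF continuous_on_cutoff])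

lemma bose_measurable [measurable]: "bose \<in> borel_measurable half_line"
  by (rule borel_measurable_half_line[OF continuous_on_bose])

lemma integrable_P: "integrable half_line P"
  by (rule integrable_half_line_bound[of "\<lambda>u. C * exp (- u)"])
     (use integrable_exp_minus P_exp in auto)

lemma integrable_P_kernel: "integrable half_line (\<lambda>u. P u * of_real (kernel r u))"
proof (rule integrable_half_line_bound[of "\<lambda>u. C * exp (- u) * (1 / node r)"])
  show "norm (P u * of_real (kernel r u)) \<le> C * exp (- u) * (1 / node r)" if "u > 0" for u
    unfolding norm_mult using P_exp[OF that] kernel_le[of r u] kernel_nonneg[of r u] C
    by (intro mult_mono) auto
qed (use integrable_exp_minus in auto)

lemma integrable_P_bose: "integrable half_line (\<lambda>u. P u * of_real (bose u / u))"
proof (rule integrable_half_line_bound[of "\<lambda>u. C * exp (- u) * (1 / X)"])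
  show "norm (P u * of_real (bose u / u)) \<le> C * exp (- u) * (1 / X)" if "u > 0" for u
  proof -
    have "bose u / u \<le> 1 / X" using bose_bounds[OF that] that X by (simp add: field_simps)
    then have "norm (complex_of_real (bose u / u)) \<le> 1 / X"
      using bose_bounds[OF that] that by (simp only: norm_of_real) simp
    then show ?thesis
      unfolding norm_mult using P_exp[OF that] C by (intro mult_mono) auto
  qed
qed (use integrable_exp_minus in auto)

lemma half_line_cutoff:
  "integrable half_line (cutoff N)" "half_integral (cutoff N) = pi * node N / 2"
proof -
  have eq: "cutoff N = (\<lambda>u. (node N)\<^sup>2 * (1 / ((node N)\<^sup>2 + u\<^sup>2)))" by (simp
      add: cutoff_def fun_eq_iff)
  show "integrable half_line (cutoff N)" unfolding eq
    using half_line_cauchy_kernel(1)[OF node_pos] by (intro integrable_mult_right)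
  have "half_integral (cutoff N) = (node N)\<^sup>2 * (pi / (2 * node N))"
    unfolding eq half_line_cauchy_kernel(2)[OF node_pos, symmetric] by (rule integral_mult_right_zero)
  then show "half_integral (cutoff N) = pi * node N / 2"
    using node_pos[of N] by (simp add: power2_eq_square)
qed

text \<open>Folding 1/(u + i c) gives -2 i c/(c^2 + u^2), which is the cutoff up to a constant, so
  the Poisson integral with n = 1 applies. It yields (pi/2) c/(b + c), and the common factor X/(2
  pi) of the nodes cancels.\<close>

lemma half_line_cutoff_kernel:
  "integrable half_line (\<lambda>u. cutoff N u * kernel r u)"
  "half_integral (\<lambda>u. cutoff N u * kernel r u) = pi / 2 * (real (Suc r) / real (Suc N + Suc r))"
proof -
  let ?b = "node r" and ?c = "node N"
  let ?f = "\<lambda>u. of_real (2 * ?b) / ((complex_of_real u + \<i> * of_real ?c) ^ 1 * of_real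
      (?b\<^sup>2 + u\<^sup>2))"
  have eq: "complex_of_real (cutoff N u * kernel r u) = \<i> * of_real (?c / 4) * symmetrize ?f u" for u
  proof -
    have nz: "complex_of_real u + \<i> * of_real ?c \<noteq> 0" "- complex_of_real u + \<i> * of_real ?c \<noteq> 0"
      using node_pos[of N] by (auto simp: complex_eq_iff)
    have nzr: "complex_of_real (?b\<^sup>2 + u\<^sup>2) \<noteq> 0" "complex_of_real (?c\<^sup>2 +
        u\<^sup>2) \<noteq> 0"
      using node_sq_pos[of r u] node_sq_pos[of N u] by (metis less_irrefl of_real_eq_0_iff)+
    have "1 / (complex_of_real u + \<i> * of_real ?c) + 1 / (- complex_of_real u + \<i> * of_real ?c)
        = - (2 * \<i> * of_real ?c) / of_real (?c\<^sup>2 + u\<^sup>2)"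
    proof -
      have "(complex_of_real u + \<i> * of_real ?c) * (- complex_of_real u + \<i> * of_real ?c) = -
          of_real (?c\<^sup>2 + u\<^sup>2)"
        by (simp add: algebra_simps power2_eq_square)
      then have "1 / (complex_of_real u + \<i> * of_real ?c) + 1 / (- complex_of_real u + \<i> * of_real ?c)
          = (2 * \<i> * of_real ?c) / - of_real (?c\<^sup>2 + u\<^sup>2)"
        using add_frac_eq[OF nz, of 1 1] by simp
      then show ?thesis by (metis minus_divide_left minus_divide_right)
    qed
    moreover have "symmetrize ?f u = of_real (2 * ?b) / of_real (?b\<^sup>2 + u\<^sup>2) *
        (1 / (complex_of_real u + \<i> * of_real ?c) + 1 / (- complex_of_real u + \<i> * of_real ?c))"
    proof -
      have "a / (p ^ 1 * A) + a / (n ^ 1 * A) = a / A * (1 / p + 1 / n)" for a p n A :: complex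
        by (simp add: distrib_left mult.commute)
      then show ?thesis unfolding symmetrize_def of_real_minus power2_minus .
    qed
    ultimately have sym: "symmetrize ?f u = of_real (2 * ?b) / of_real (?b\<^sup>2 + u\<^sup>2) * (- (2 *
        \<i> * of_real ?c) / of_real (?c\<^sup>2 + u\<^sup>2))"
      by simp
    have "\<i> * of_real (?c / 4) * symmetrize ?f u
        = of_real (?b / (?b\<^sup>2 + u\<^sup>2)) * of_real (?c\<^sup>2 / (?c\<^sup>2 + u\<^sup>2))"
    proof -
      have "\<i> * of_real (c / 4) * (of_real (2 * b) / of_real B * (- (2 * \<i> * of_real c) / of_real C'')) =
          of_real (b / B) * complex_of_real (c\<^sup>2 / C'')" for b c B C''
        by (simp add: power2_eq_square mult_ac)
      then show ?thesis unfolding sym .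
    qed
    then show ?thesis by (simp add: cutoff_def kernel_def mult.commute)
  qed
  have int: "integrable half_line (\<lambda>u. complex_of_real (cutoff N u * kernel r u))"
    unfolding eq using half_line_poisson(1)[OF node_pos node_pos] by (intro integrable_mult_right)
  then show "integrable half_line (\<lambda>u. cutoff N u * kernel r u)"
    by (subst (asm) complex_of_real_integrable_eq)
  have "complex_of_real (half_integral (\<lambda>u. cutoff N u * kernel r u))
     = \<i> * of_real (?c / 4) * (2 * of_real pi / (\<i> * of_real (?b + ?c)) ^ 1)"
    unfolding integral_complex_of_real[symmetric] eq half_line_poisson(2)[OF node_pos node_pos, symmetric]
    by (rule integral_mult_right_zero)
  also have "\<dots> = of_real (pi / 2 * (?c / (?b + ?c)))" by simp
  finally have "half_integral (\<lambda>u. cutoff N u * kernel r u) = pi / 2 * (?c / (?b + ?c))"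
    by (simp only: of_real_eq_iff)
  also have "?c / (?b + ?c) = real (Suc r) / real (Suc N + Suc r)"
  proof -
    have "?c = X / (2 * pi) * (1 / real (Suc N))" "?b + ?c = X / (2 * pi) * (1 / real (Suc r) + 1 / real (Suc N))"
      by (simp_all add: node_def field_simps del: of_nat_Suc)
    then have "?c / (?b + ?c) = (1 / real (Suc N)) / (1 / real (Suc r) + 1 / real (Suc N))"
      using X by (simp del: of_nat_Suc)
    also have "\<dots> = real (Suc r) / real (Suc N + Suc r)"
      by (simp add: field_simps del: of_nat_Suc)
    finally show ?thesis .
  qed
  finally show "half_integral (\<lambda>u. cutoff N u * kernel r u) = pi / 2 * (real (Suc r) / real (Suc
      N + Suc r))" .
qed

section \<open>The moment after subtraction of the cutoff\<close>

definition remainder :: "nat \<Rightarrow> real \<Rightarrow> complex" where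
  "remainder N u = P u - P0 * of_real (cutoff N u)"

lemma remainder_measurable [measurable]: "remainder N \<in> borel_measurable half_line"
  unfolding remainder_def[abs_def] by measurable

text \<open>One majorant records both the linear zero at 0 and the decay like 1/u at infinity;
  divided by \<open>u\<close> it becomes an integrable Cauchy kernel.\<close>

lemma remainder_bound: "\<exists>A\<ge>0. \<forall>u>0. norm (remainder N u) \<le> A * u * (1 /
    (1\<^sup>2 + u\<^sup>2))"
proof -
  let ?c = "node N" and ?p = "norm P0"
  define A where "A = 2 * (C' + ?p / ?c\<^sup>2 + C + ?p * ?c\<^sup>2)"
  have A0: "A \<ge> 0" using C by (simp add: A_def)
  have "norm (remainder N u) \<le> A * u * (1 / (1\<^sup>2 + u\<^sup>2))" if u: "u > 0" for u
  proof (cases "u < 1")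
    case True
    have "1 - cutoff N u = u\<^sup>2 / (?c\<^sup>2 + u\<^sup>2)"
    proof -
      have "1 = ((node N)\<^sup>2 + u\<^sup>2) / ((node N)\<^sup>2 + u\<^sup>2)"
        using node_sq_pos[of N u] by (metis divide_self less_irrefl)
      then show ?thesis unfolding cutoff_def add_divide_distrib by linarith
    qed
    also have "\<dots> \<le> u\<^sup>2 / ?c\<^sup>2" using node_pos[of N] by (intro divide_left_mono
        mult_pos_pos node_sq_pos) auto
    also have "\<dots> \<le> u / ?c\<^sup>2"
      using True u node_pos[of N] by (intro divide_right_mono) (auto simp: power2_eq_square mult_left_le)
    finally have 1: "1 - cutoff N u \<le> u / ?c\<^sup>2" .
    have 0: "1 - cutoff N u \<ge> 0"
      using node_sq_pos[of N u] by (simp add: cutoff_def)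
    have "remainder N u = (P u - P0) + P0 * of_real (1 - cutoff N u)"
      by (simp add: remainder_def algebra_simps)
    then have "norm (remainder N u) \<le> norm (P u - P0) + ?p * (1 - cutoff N u)"
      using 0 norm_triangle_ineq[of "P u - P0" "P0 * of_real (1 - cutoff N u)"]
      by (simp add: norm_mult del: of_real_diff)
    also have "\<dots> \<le> C' * u + ?p * (u / ?c\<^sup>2)"
      by (intro add_mono P_lip[OF u] mult_left_mono 1) simp
    also have "\<dots> = (C' + ?p / ?c\<^sup>2) * u * 1" by (simp add: algebra_simps)
    also have "\<dots> \<le> (C' + ?p / ?c\<^sup>2) * u * (2 * (1 / (1\<^sup>2 + u\<^sup>2)))"
    proof (intro mult_left_mono)
      have "u\<^sup>2 \<le> 1" using True u by (simp add: power_le_one)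
      then show "1 \<le> 2 * (1 / (1\<^sup>2 + u\<^sup>2))" by (simp add: field_simps add_pos_nonneg)
    qed (use C u in auto)
    also have "\<dots> = 2 * (C' + ?p / ?c\<^sup>2) * u * (1 / (1\<^sup>2 + u\<^sup>2))" by simp
    also have "\<dots> \<le> A * u * (1 / (1\<^sup>2 + u\<^sup>2))"
      unfolding A_def using C u by (intro mult_right_mono) auto
    finally show ?thesis .
  next
    case False
    then have u1: "u \<ge> 1" by simp
    have le: "1 / u \<le> 2 * u * (1 / (1\<^sup>2 + u\<^sup>2))"
    proof -
      have "1\<^sup>2 \<le> u\<^sup>2" using u1 by (intro power_mono) auto
      then have "1\<^sup>2 + u\<^sup>2 \<le> 2 * u * u" by (simp add: power2_eq_square)
      then show ?thesis using u by (simp add: field_simps add_pos_nonneg)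
    qed
    have e: "exp (- u) \<le> 1 / u" using exp_minus_le_power[of u 1] u by simp
    have "cutoff N u \<le> ?c\<^sup>2 / u\<^sup>2"
      unfolding cutoff_def using u by (intro divide_left_mono mult_pos_pos node_sq_pos) auto
    also have "\<dots> \<le> ?c\<^sup>2 / u" using u1 by (intro divide_left_mono) (auto simp: power2_eq_square)
    finally have c: "cutoff N u \<le> ?c\<^sup>2 / u" .
    have c0: "cutoff N u \<ge> 0" using node_sq_pos[of N u] by (simp add: cutoff_def)
    have "norm (remainder N u) \<le> norm (P u) + ?p * cutoff N u"
      unfolding remainder_def using norm_triangle_ineq4[of "P u" "P0 * of_real (cutoff N u)"] c0
      by (simp add: norm_mult)
    also have "\<dots> \<le> C * (1 / u) + ?p * (?c\<^sup>2 / u)"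
      using P_exp[OF u] mult_left_mono[OF e C(1)] by (intro add_mono mult_left_mono c) auto
    also have "\<dots> = (C + ?p * ?c\<^sup>2) * (1 / u)" by (simp add: add_divide_distrib)
    also have "\<dots> \<le> (C + ?p * ?c\<^sup>2) * (2 * u * (1 / (1\<^sup>2 + u\<^sup>2)))"
      using C by (intro mult_left_mono le) auto
    also have "\<dots> = 2 * (C + ?p * ?c\<^sup>2) * u * (1 / (1\<^sup>2 + u\<^sup>2))" by simp
    also have "\<dots> \<le> A * u * (1 / (1\<^sup>2 + u\<^sup>2))"
      unfolding A_def using C u by (intro mult_right_mono) auto
    finally show ?thesis .
  qed
  then show ?thesis using A0 by blast
qed

text \<open>The finite part at 0 of the logarithmically divergent integral of P(u) du/u.\<close>

definition regularized :: complex where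
  "regularized = half_integral (\<lambda>u. (P u - (if u < 1 then P0 else 0)) / of_real u)"

lemma integrable_remainder: "integrable half_line (remainder N)"
  unfolding remainder_def[abs_def]
  by (intro Bochner_Integration.integrable_diff integrable_P integrable_mult_right integrable_of_real
      half_line_cutoff)

lemma integrable_remainder_div: "integrable half_line (\<lambda>u. remainder N u / of_real u)"
proof -
  obtain A where A: "\<forall>u>0. norm (remainder N u) \<le> A * u * (1 / (1\<^sup>2 + u\<^sup>2))"
    using remainder_bound by blast
  show ?thesis
  proof (rule integrable_half_line_bound[of "\<lambda>u. A * (1 / (1\<^sup>2 + u\<^sup>2))"])
    show "integrable half_line (\<lambda>u. A * (1 / (1\<^sup>2 + u\<^sup>2)))"
      by (intro integrable_mult_right half_line_cauchy_kernel) simp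
    show "norm (remainder N u / of_real u) \<le> A * (1 / (1\<^sup>2 + u\<^sup>2))" if "u > 0" for u
    proof -
      have "norm (remainder N u) / u \<le> A * u * (1 / (1\<^sup>2 + u\<^sup>2)) / u"
        using A that by (intro divide_right_mono) auto
      then show ?thesis using that by (simp add: norm_divide)
    qed
  qed measurable
qed

lemma integral_remainder_div:
  "half_integral (\<lambda>u. remainder N u / of_real u) = regularized - P0 * of_real (ln (node N))"
proof -
  let ?h = "\<lambda>u. ((if u < 1 then 1 else 0) - (node N)\<^sup>2 / ((node N)\<^sup>2 + u\<^sup>2)) / u"
  have int: "integrable half_line (\<lambda>u. P0 * complex_of_real (?h u))"
    by (intro integrable_mult_right integrable_of_real half_line_cutoff_comparison node_pos)
  have "regularized = half_integral (\<lambda>u. remainder N u / of_real u - P0 * complex_of_real (?h u))"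
    unfolding regularized_def
    by (intro integral_half_line_cong) (auto simp: remainder_def cutoff_def diff_divide_distrib right_diff_distrib)
  also have "\<dots> = half_integral (\<lambda>u. remainder N u / of_real u) - P0 * of_real (- ln (node N))"
    unfolding Bochner_Integration.integral_diff[OF integrable_remainder_div int]
      half_line_cutoff_comparison(2)[OF node_pos, symmetric] integral_complex_of_real[symmetric]
      integral_mult_right_zero ..
  finally show ?thesis by simp
qed

lemma integral_remainder: "half_integral (remainder N) = - P0 * of_real (pi * node N / 2)"
proof -
  have "half_integral (remainder N) = half_integral P
      - half_integral (\<lambda>u. P0 * complex_of_real (cutoff N u))"
    unfolding remainder_def[abs_def]
    by (intro Bochner_Integration.integral_diff integrable_P integrable_mult_right integrable_of_real
        half_line_cutoff)
  also have "\<dots> = - P0 * complex_of_real (half_integral (cutoff N))"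
    unfolding P_zero integral_complex_of_real[symmetric] by simp
  finally show ?thesis unfolding half_line_cutoff .
qed

text \<open>The share of the cutoff in the Bose integral; it is of the order of
  \<open>node N\<close> and disappears in the limit.\<close>

definition residual :: "nat \<Rightarrow> real" where
  "residual N = half_integral (\<lambda>u. cutoff N u * (bose u / u))"

lemma cutoff_bose_bounds:
  assumes "u > 0"
  shows "0 \<le> cutoff N u * (bose u / u)" "cutoff N u * (bose u / u) \<le> cutoff N u * (1 / X)"
proof -
  have c0: "cutoff N u \<ge> 0" using node_sq_pos[of N u] by (simp add: cutoff_def)
  have b: "0 \<le> bose u / u" "bose u / u \<le> 1 / X"
    using bose_bounds[OF assms] assms X by (simp_all add: field_simps)
  show "0 \<le> cutoff N u * (bose u / u)" using c0 b(1) by (rule mult_nonneg_nonneg)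
  show "cutoff N u * (bose u / u) \<le> cutoff N u * (1 / X)" using c0 b by (intro mult_left_mono)
qed

lemma integrable_cutoff_bose: "integrable half_line (\<lambda>u. cutoff N u * (bose u / u))"
proof (rule integrable_half_line_bound[of "\<lambda>u. cutoff N u * (1 / X)"])
  show "integrable half_line (\<lambda>u. cutoff N u * (1 / X))"
    using half_line_cutoff by (intro integrable_mult_left)
  show "norm (cutoff N u * (bose u / u)) \<le> cutoff N u * (1 / X)" if "u > 0" for u
    using cutoff_bose_bounds[OF that, of N] by (simp only: real_norm_def abs_of_nonneg)
qed measurable

lemma residual_bounds: "0 \<le> residual N" "residual N \<le> pi * node N / 2 * (1 / X)"
proof -
  show "0 \<le> residual N" unfolding residual_def
    by (rule Bochner_Integration.integral_nonneg) (auto simp: space_restrict_space cutoff_bose_bounds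
        simp del: times_divide_eq_right)
  have "residual N \<le> half_integral (\<lambda>u. cutoff N u * (1 / X))" unfolding residual_def
    by (rule integral_mono[OF integrable_cutoff_bose integrable_mult_left])
       (auto simp: half_line_cutoff space_restrict_space cutoff_bose_bounds simp del: times_divide_eq_right)
  also have "\<dots> = pi * node N / 2 * (1 / X)"
    by (simp only: integral_mult_left_zero half_line_cutoff)
  finally show "residual N \<le> pi * node N / 2 * (1 / X)" .
qed

definition bose_integral :: complex where
  "bose_integral = half_integral (\<lambda>u. P u * of_real (bose u / u))"

text \<open>Of the three parts of the kernel sum, the last one sees only the cutoff, because
  \<open>P\<close> integrates to 0.\<close>

lemma integral_remainder_kernel_total:
  "half_integral (\<lambda>u. remainder N u * of_real ((bose u + 1 / 2 - u / X) / u)) =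
    bose_integral - P0 * of_real (residual N) + (regularized - P0 * of_real (ln (node N))) / 2
      + P0 * of_real (pi * node N / 2) / of_real X"
proof -
  let ?a = "\<lambda>u. P u * of_real (bose u / u) - P0 * of_real (cutoff N u * (bose u / u))"
  have ia: "integrable half_line (\<lambda>u. P0 * complex_of_real (cutoff N u * (bose u / u)))"
    by (intro integrable_mult_right integrable_of_real integrable_cutoff_bose)
  have "half_integral (\<lambda>u. remainder N u * of_real ((bose u + 1 / 2 - u / X) / u))
     = half_integral (\<lambda>u. ?a u + remainder N u / of_real u / 2 - remainder N u / of_real X)"
    by (intro integral_half_line_cong) (use X in \<open>auto simp: remainder_def field_simps\<close>)
  also have "\<dots> = half_integral ?a + half_integral (\<lambda>u. remainder N u / of_real u / 2)
      - half_integral (\<lambda>u. remainder N u / of_real X)"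
  proof -
    note i = Bochner_Integration.integrable_diff[OF integrable_P_bose ia]
      integrable_divide[OF integrable_remainder_div[of N], of 2]
      integrable_divide[OF integrable_remainder[of N], of "of_real X"]
    show ?thesis
      unfolding Bochner_Integration.integral_diff[OF Bochner_Integration.integrable_add[OF i(1,2)] i(3)]
        Bochner_Integration.integral_add[OF i(1,2)] ..
  qed
  also have "half_integral ?a = bose_integral - P0 * of_real (residual N)"
    unfolding bose_integral_def residual_def integral_complex_of_real[symmetric]
    by (subst Bochner_Integration.integral_diff[OF integrable_P_bose ia]) (simp only: integral_mult_right_zero)
  also have "half_integral (\<lambda>u. remainder N u / of_real u / 2) = (regularized - P0 * of_real (ln
      (node N))) / 2"
    unfolding integral_remainder_div[symmetric] by (rule integral_divide_zero)
  also have "half_integral (\<lambda>u. remainder N u / of_real X) = - P0 * of_real (pi * node N / 2) / of_real X"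
    unfolding integral_remainder[symmetric] by (rule integral_divide_zero)
  finally show ?thesis by simp
qed

text \<open>The linear zero of \<open>remainder N\<close> cancels the 1/(2 u) of
  \<open>kernel_partial_sum_le\<close>, which leaves an integrable majorant independent of
  \<open>R\<close>.\<close>

lemma remainder_kernel_tendsto:
  "(\<lambda>R. \<Sum>r<R. half_integral (\<lambda>u. remainder N u * of_real (kernel r u)) / of_real (pi
      * real (Suc r)))
     \<longlonglongrightarrow> half_integral (\<lambda>u. remainder N u * of_real ((bose u + 1 / 2 - u / X) / u))"
proof -
  let ?k = "\<lambda>R u. \<Sum>r<R. kernel r u / (pi * real (Suc r))"
  obtain A where A: "A \<ge> 0" "\<forall>u>0. norm (remainder N u) \<le> A * u * (1 / (1\<^sup>2 + u\<^sup>2))"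
    using remainder_bound by blast
  have int: "integrable half_line (\<lambda>u. remainder N u * of_real (kernel r u))" for r
  proof (rule integrable_half_line_bound[of "\<lambda>u. norm (remainder N u) * (1 / node r)"])
    show "integrable half_line (\<lambda>u. norm (remainder N u) * (1 / node r))"
      by (intro integrable_mult_left integrable_norm integrable_remainder)
    show "norm (remainder N u * of_real (kernel r u)) \<le> norm (remainder N u) * (1 / node r)" for u
      unfolding norm_mult using kernel_le[of r u] kernel_nonneg[of r u] by (intro mult_left_mono) auto
  qed measurable
  have "(\<lambda>R. half_integral (\<lambda>u. remainder N u * of_real (?k R u)))
     \<longlonglongrightarrow> half_integral (\<lambda>u. remainder N u * of_real ((bose u + 1 / 2 - u / X) / u))"
  proof (rule integral_dominated_convergence)
    show "integrable half_line (\<lambda>u. A / 2 * (1 / (1\<^sup>2 + u\<^sup>2)))"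
      by (intro integrable_mult_right half_line_cauchy_kernel) simp
    show "AE u in half_line. (\<lambda>R. remainder N u * of_real (?k R u)) \<longlonglongrightarrow>
        remainder N u * of_real ((bose u + 1 / 2 - u / X) / u)"
    proof (rule AE_I2)
      fix u assume "u \<in> space half_line"
      then have "(\<lambda>R. ?k R u) \<longlonglongrightarrow> (bose u + 1 / 2 - u / X) / u"
        using kernel_sums[of u] by (auto simp: space_restrict_space sums_def)
      then show "(\<lambda>R. remainder N u * of_real (?k R u)) \<longlonglongrightarrow> remainder N u *
          of_real ((bose u + 1 / 2 - u / X) / u)"
        by (intro tendsto_mult tendsto_const tendsto_of_real)
    qed
    show "AE u in half_line. norm (remainder N u * of_real (?k R u)) \<le> A / 2 * (1 / (1\<^sup>2 +
        u\<^sup>2))" for R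
    proof (rule AE_I2)
      fix u assume "u \<in> space half_line"
      then have u: "u > 0" by (simp add: space_restrict_space)
      have "?k R u \<ge> 0" using kernel_nonneg by (intro sum_nonneg) simp
      then have "norm (remainder N u * of_real (?k R u)) = norm (remainder N u) * ?k R u"
        by (simp only: norm_mult norm_of_real abs_of_nonneg)
      also have "\<dots> \<le> (A * u * (1 / (1\<^sup>2 + u\<^sup>2))) * (1 / (2 * u))"
        using A u kernel_partial_sum_le[OF u, of R] \<open>?k R u \<ge> 0\<close> by (intro mult_mono) auto
      also have "\<dots> = A / 2 * (1 / (1\<^sup>2 + u\<^sup>2))" using u by simp
      finally show "norm (remainder N u * of_real (?k R u)) \<le> A / 2 * (1 / (1\<^sup>2 + u\<^sup>2))" .
    qed
  qed measurable
  also have "(\<lambda>R. half_integral (\<lambda>u. remainder N u * of_real (?k R u))) =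
     (\<lambda>R. \<Sum>r<R. half_integral (\<lambda>u. remainder N u * of_real (kernel r u)) / of_real
         (pi * real (Suc r)))"
  proof
    fix R
    have "half_integral (\<lambda>u. remainder N u * of_real (?k R u))
       = half_integral (\<lambda>u. \<Sum>r<R. remainder N u * of_real (kernel r u) / of_real (pi * real (Suc r)))"
      by (simp add: sum_distrib_left)
    also have "\<dots> = (\<Sum>r<R. half_integral (\<lambda>u. remainder N u * of_real (kernel r u) /
        of_real (pi * real (Suc r))))"
      by (intro Bochner_Integration.integral_sum integrable_divide int)
    finally show "half_integral (\<lambda>u. remainder N u * of_real (?k R u))
       = (\<Sum>r<R. half_integral (\<lambda>u. remainder N u * of_real (kernel r u)) / of_real (pi * real (Suc r)))"
      by (simp only: integral_divide_zero)
  qed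
  finally show ?thesis .
qed

text \<open>The combination \<open>W\<close> equals \<open>P0 * T N\<close> for every
  \<open>N\<close>, and \<open>W\<close> does not depend on \<open>N\<close>; so only the limit of
  \<open>T\<close> is needed. There harm(N + 1) - ln(N + 1) gives Euler's constant, and the terms
  with \<open>node N\<close> and \<open>residual N\<close> vanish.\<close>

lemma poisson_summation:
  assumes "(\<lambda>r. (P0 * of_real (pi / 2) - half_integral (\<lambda>u. P u * of_real (kernel r u)))
      / of_nat (Suc r)) sums V"
  shows "V = P0 * of_real (pi / 2 * (euler_mascheroni + ln (X / (2 * pi)))) - of_real pi * bose_integral
    - of_real (pi / 2) * regularized"
proof -
  define W where "W = V + of_real pi * bose_integral + of_real (pi / 2) * regularized"
  define T where "T N = pi / 2 * (harm (Suc N) + ln (node N)) + pi * residual N - pi * (pi * node N / 2) / X" for N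
  have eq: "W = P0 * of_real (T N)" for N
  proof -
    let ?I = "\<lambda>r. half_integral (\<lambda>u. remainder N u * of_real (kernel r u))"
    have "(P0 * of_real (pi / 2) - half_integral (\<lambda>u. P u * of_real (kernel r u))) / of_nat (Suc r)
        = P0 * of_real (pi / 2 * (1 / real (Suc r) - 1 / real (Suc N + Suc r))) - of_real pi * (?I r /
            of_real (pi * real (Suc r)))" for r
    proof -
      have "half_integral (\<lambda>u. P u * of_real (kernel r u)) - P0 * of_real (half_integral
          (\<lambda>u. cutoff N u * kernel r u)) = ?I r"
      proof -
        have "?I r = half_integral (\<lambda>u. P u * of_real (kernel r u) - P0 * of_real (cutoff N u * kernel r u))"
          by (simp add: remainder_def algebra_simps)
        also have "\<dots> = half_integral (\<lambda>u. P u * of_real (kernel r u)) - half_integral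
            (\<lambda>u. P0 * of_real (cutoff N u * kernel r u))"
          by (intro Bochner_Integration.integral_diff integrable_P_kernel integrable_mult_right
              integrable_of_real half_line_cutoff_kernel)
        finally show ?thesis unfolding integral_complex_of_real[symmetric] integral_mult_right_zero ..
      qed
      then have "half_integral (\<lambda>u. P u * of_real (kernel r u)) = ?I r + P0 * of_real (pi / 2 *
          (real (Suc r) / real (Suc N + Suc r)))"
        unfolding half_line_cutoff_kernel by (simp add: algebra_simps)
      \<comment> \<open>Removing the share of the cutoff multiplies pi/2 by 1 - (r + 1)/(N + r + 2);
        division by r + 1 then gives exactly the telescoping difference.\<close>
      moreover have "complex_of_real (pi / 2 * (1 / real (Suc r) - 1 / real (Suc N + Suc r)))
         = (of_real (pi / 2) - of_real (pi / 2 * (real (Suc r) / real (Suc N + Suc r)))) / of_nat (Suc r)"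
      proof -
        have "pi / 2 * (1 / real (Suc r) - 1 / real (Suc N + Suc r)) = (pi / 2 - pi / 2 * (real (Suc r) /
            real (Suc N + Suc r))) / real (Suc r)"
          by (simp add: field_simps del: of_nat_Suc of_nat_add)
        then show ?thesis by (simp only: of_real_diff of_real_divide of_real_of_nat_eq)
      qed
      ultimately show ?thesis
        by (simp add: diff_divide_distrib add_divide_distrib right_diff_distrib del: of_nat_Suc)
    qed
    then have "(\<lambda>R. \<Sum>r<R. P0 * of_real (pi / 2 * (1 / real (Suc r) - 1 / real (Suc N + Suc r)))
        - of_real pi * (?I r / of_real (pi * real (Suc r)))) \<longlonglongrightarrow> V"
      using assms by (simp only: sums_def)
    moreover have "(\<lambda>R. P0 * of_real (pi / 2 * (\<Sum>r<R. 1 / real (Suc r) - 1 / real (Suc N + Suc r)))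
        - of_real pi * (\<Sum>r<R. ?I r / of_real (pi * real (Suc r))))
      \<longlonglongrightarrow> P0 * of_real (pi / 2 * harm (Suc N)) - of_real pi *
         half_integral (\<lambda>u. remainder N u * of_real ((bose u + 1 / 2 - u / X) / u))"
      by (intro tendsto_diff tendsto_mult tendsto_const tendsto_of_real harmonic_shift_tendsto
          remainder_kernel_tendsto)
    moreover have "(\<lambda>R. \<Sum>r<R. P0 * of_real (pi / 2 * (1 / real (Suc r) - 1 / real (Suc N + Suc r)))
        - of_real pi * (?I r / of_real (pi * real (Suc r))))
      = (\<lambda>R. P0 * of_real (pi / 2 * (\<Sum>r<R. 1 / real (Suc r) - 1 / real (Suc N + Suc r)))
        - of_real pi * (\<Sum>r<R. ?I r / of_real (pi * real (Suc r))))"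
      by (simp only: sum_subtractf[symmetric] sum_distrib_left of_real_sum)
    ultimately have "V = P0 * of_real (pi / 2 * harm (Suc N)) - of_real pi *
         half_integral (\<lambda>u. remainder N u * of_real ((bose u + 1 / 2 - u / X) / u))"
      by (simp only: LIMSEQ_unique)
    then show ?thesis unfolding integral_remainder_kernel_total W_def T_def
      by (simp add: algebra_simps diff_divide_distrib)
  qed
  have ln_node: "ln (node N) = ln (X / (2 * pi)) - ln (real (Suc N))" for N
    using X by (simp add: node_def ln_div ln_mult del: of_nat_Suc)
  have node0: "node \<longlonglongrightarrow> 0"
    unfolding node_def[abs_def] by real_asymp
  have res0: "residual \<longlonglongrightarrow> 0"
  proof (rule tendsto_sandwich)
    show "(\<lambda>_. 0 :: real) \<longlonglongrightarrow> 0" by (rule tendsto_const)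
    show "(\<lambda>N. pi * node N / 2 * (1 / X)) \<longlonglongrightarrow> 0"
      using tendsto_mult_left_zero[OF node0, of "pi / 2 * (1 / X)"] by (simp add: mult_ac)
  qed (use residual_bounds in \<open>auto simp del: times_divide_eq_right\<close>)
  have "(\<lambda>N. pi / 2 * ((harm (Suc N) - ln (real (Suc N))) + ln (X / (2 * pi))) + pi * residual N
      - pi * (pi * node N / 2) / X)
     \<longlonglongrightarrow> pi / 2 * (euler_mascheroni + ln (X / (2 * pi))) + pi * 0 - pi * (pi * 0 / 2) / X"
    using X by (intro tendsto_intros res0 node0 LIMSEQ_Suc[OF euler_mascheroni_LIMSEQ]) auto
  then have "T \<longlonglongrightarrow> pi / 2 * (euler_mascheroni + ln (X / (2 * pi)))"
    unfolding T_def[abs_def] ln_node by (simp add: algebra_simps)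
  then have "(\<lambda>N. P0 * of_real (T N)) \<longlonglongrightarrow> P0 * of_real (pi / 2 *
      (euler_mascheroni + ln (X / (2 * pi))))"
    by (intro tendsto_intros)
  then have "(\<lambda>N::nat. W) \<longlonglongrightarrow> P0 * of_real (pi / 2 * (euler_mascheroni + ln
      (X / (2 * pi))))"
    using eq by simp
  then have "W = P0 * of_real (pi / 2 * (euler_mascheroni + ln (X / (2 * pi))))"
    by (simp add: LIMSEQ_const_iff)
  then show ?thesis by (simp add: W_def algebra_simps)
qed

end

section \<open>Mellin transforms and the L-function\<close>

lemma half_line_scale:
  fixes f :: "real \<Rightarrow> 'a::{banach, second_countable_topology}"
  assumes "d > 0"
  shows "integrable half_line (\<lambda>u. f (d * u)) \<longleftrightarrow> integrable half_line f"
    and "half_integral (\<lambda>u. f (d * u)) = (1 / d) *\<^sub>R half_integral f"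
proof -
  have ind: "indicator {0<..} (d * u) = (indicator {0<..} u :: real)" for u
    using assms by (auto simp: indicator_def zero_less_mult_iff)
  show "integrable half_line (\<lambda>u. f (d * u)) \<longleftrightarrow> integrable half_line f"
    using lborel_integrable_real_affine_iff[of d "\<lambda>u. indicator {0<..} u *\<^sub>R f u" 0] assms
    by (simp add: integrable_half_line_iff set_integrable_def ind)
  show "half_integral (\<lambda>u. f (d * u)) = (1 / d) *\<^sub>R half_integral f"
    using lborel_integral_real_affine[of d "\<lambda>u. indicator {0<..} u *\<^sub>R f u" 0] assms
    by (simp add: integral_half_line set_lebesgue_integral_def ind)
qed

text \<open>Passes from absolute gauge integrability, in which Euler's integral is available, to the
  Bochner integral over \<open>half_line\<close>.\<close>

lemma half_line_absolutely_integrable: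
  fixes f :: "real \<Rightarrow> 'a::euclidean_space"
  assumes "f absolutely_integrable_on {0<..}" "f \<in> borel_measurable half_line"
  shows "integrable half_line f" "half_integral f = integral {0<..} f"
proof -
  have "(\<lambda>u. indicator {0<..} u *\<^sub>R f u) \<in> borel_measurable lborel"
    using assms(2) by (subst (asm) borel_measurable_restrict_space_iff) auto
  then have s: "set_integrable lborel {0<..} f"
    using assms(1) integrable_completion[of "\<lambda>u. indicator {0<..} u *\<^sub>R f u" lborel]
    by (simp add: set_integrable_def)
  then show "integrable half_line f" by (simp add: integrable_half_line_iff)
  show "half_integral f = integral {0<..} f"
    using set_borel_integral_eq_integral(2)[OF s] by (simp add: integral_half_line)
qed

lemma measurable_powr_half_line: "(\<lambda>u. complex_of_real u powr s) \<in> borel_measurable half_line"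
  by (intro borel_measurable_half_line continuous_intros) (auto simp: complex_nonpos_Reals_iff)

lemma half_line_Gamma:
  assumes "Re s > 0" "d > 0"
  shows "integrable half_line (\<lambda>u. complex_of_real u powr (s - 1) * of_real (exp (- (d * u))))"
    and "half_integral (\<lambda>u. complex_of_real u powr (s - 1) * of_real (exp (- (d * u)))) = Gamma s
        / of_real d powr s"
proof -
  let ?f = "\<lambda>u. complex_of_real u powr (s - 1) * of_real (exp (- u))"
  have f: "?f = (\<lambda>u. complex_of_real u powr (s - 1) / of_real (exp u))"
    by (simp add: fun_eq_iff exp_minus divide_inverse flip: exp_of_real)
  have m: "?f \<in> borel_measurable half_line"
    by (intro borel_measurable_times measurable_powr_half_line borel_measurable_half_line continuous_intros)
  have i: "integrable half_line ?f" "half_integral ?f = Gamma s"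
    using half_line_absolutely_integrable[of ?f] m absolutely_integrable_Gamma_integral'[OF assms(1)]
      Gamma_integral_complex'[OF assms(1)] unfolding f by (auto simp: integral_unique)
  have eq: "complex_of_real u powr (s - 1) * of_real (exp (- (d * u))) = of_real d powr (1 - s) * ?f (d *
      u)" if "u > 0" for u
  proof -
    have "complex_of_real (d * u) powr (s - 1) = of_real d powr (s - 1) * of_real u powr (s - 1)"
      using that assms by (simp add: powr_times_real)
    moreover have "complex_of_real d powr (1 - s) * of_real d powr (s - 1) = 1"
      using assms by (simp flip: powr_add)
    ultimately show ?thesis by (simp add: mult.assoc[symmetric])
  qed
  have "integrable half_line (\<lambda>u. of_real d powr (1 - s) * ?f (d * u))"
    using half_line_scale(1)[OF assms(2), of ?f] i by (intro integrable_mult_right) simp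
  then show "integrable half_line (\<lambda>u. complex_of_real u powr (s - 1) * of_real (exp (- (d * u))))"
    using integrable_half_line_cong[OF eq] by simp
  have "half_integral (\<lambda>u. complex_of_real u powr (s - 1) * of_real (exp (- (d * u))))
      = of_real d powr (1 - s) * half_integral (\<lambda>u. ?f (d * u))"
    using integral_half_line_cong[OF eq] by (simp only: integral_mult_right_zero)
  also have "\<dots> = of_real d powr (1 - s) * ((1 / d) *\<^sub>R Gamma s)"
    using half_line_scale(2)[OF assms(2), of ?f] i by simp
  also have "\<dots> = Gamma s / of_real d powr s"
    using assms by (simp add: powr_diff scaleR_conv_of_real)
  finally show "half_integral (\<lambda>u. complex_of_real u powr (s - 1) * of_real (exp (- (d * u)))) =
      Gamma s / of_real d powr s" .
qed

lemma half_line_Gamma_real: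
  fixes a d :: real
  assumes "a > 0" "d > 0"
  shows "integrable half_line (\<lambda>u. u powr (a - 1) * exp (- (d * u)))"
    and "half_integral (\<lambda>u. u powr (a - 1) * exp (- (d * u))) = Gamma a / d powr a"
proof -
  have eq: "complex_of_real u powr (of_real a - 1) * of_real (exp (- (d * u)))
      = complex_of_real (u powr (a - 1) * exp (- (d * u)))" if "u > 0" for u
    using that powr_of_real[of u "a - 1"] by simp
  have "integrable half_line (\<lambda>u. complex_of_real (u powr (a - 1) * exp (- (d * u))))"
    using half_line_Gamma(1)[of "of_real a" d] assms integrable_half_line_cong[OF eq] by simp
  then show "integrable half_line (\<lambda>u. u powr (a - 1) * exp (- (d * u)))"
    by (simp only: complex_of_real_integrable_eq)
  have "complex_of_real (half_integral (\<lambda>u. u powr (a - 1) * exp (- (d * u)))) = Gamma (of_real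
      a) / of_real d powr of_real a"
    unfolding integral_complex_of_real[symmetric]
    using half_line_Gamma(2)[of "of_real a" d] assms integral_half_line_cong[OF eq] by simp
  also have "\<dots> = of_real (Gamma a / d powr a)"
    using assms by (simp add: Gamma_complex_of_real powr_of_real)
  finally show "half_integral (\<lambda>u. u powr (a - 1) * exp (- (d * u))) = Gamma a / d powr a"
    by (simp only: of_real_eq_iff)
qed

section \<open>Holomorphy of Mellin transforms\<close>

definition mellin :: "(real \<Rightarrow> complex) \<Rightarrow> complex \<Rightarrow> complex" where
  "mellin p s = half_integral (\<lambda>u. p u * of_real u powr (s - 1))"

lemma norm_powr_half_line: "u > 0 \<Longrightarrow> norm (complex_of_real u powr s) = u powr Re s"
  by (simp add: norm_powr_real_powr)

text \<open>Powers of the logarithm cost only factors u^(2e) and u^(-2e), which keeps all majorants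
  for differentiation in the exponent of Gamma type.\<close>

lemma abs_ln_power_le:
  fixes u e :: real
  assumes "u > 0" "e > 0"
  shows "\<bar>ln u\<bar> ^ n * exp (e * \<bar>ln u\<bar>) \<le> fact n / e ^ n * (u powr (2 * e) + u
      powr (- (2 * e)))"
proof -
  have "(e * \<bar>ln u\<bar>) ^ n / fact n \<le> exp (e * \<bar>ln u\<bar>)"
    using assms by (intro power_div_fact_le_exp) simp
  then have "\<bar>ln u\<bar> ^ n \<le> fact n / e ^ n * exp (e * \<bar>ln u\<bar>)"
    using assms by (simp add: power_mult_distrib field_simps)
  then have "\<bar>ln u\<bar> ^ n * exp (e * \<bar>ln u\<bar>) \<le> fact n / e ^ n * exp (e * \<bar>ln
      u\<bar>) * exp (e * \<bar>ln u\<bar>)"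
    by (intro mult_right_mono) auto
  also have "\<dots> = fact n / e ^ n * exp (2 * e * \<bar>ln u\<bar>)"
    by (simp add: mult.assoc flip: exp_add)
  also have "\<dots> \<le> fact n / e ^ n * (u powr (2 * e) + u powr (- (2 * e)))"
  proof (intro mult_left_mono)
    show "exp (2 * e * \<bar>ln u\<bar>) \<le> u powr (2 * e) + u powr (- (2 * e))"
      using assms by (cases "ln u \<ge> 0") (auto simp: powr_def abs_if)
  qed (use assms in simp)
  finally show ?thesis .
qed

text \<open>The derivative is the integral with an extra factor \<open>ln u\<close>; the error of
  the difference quotient is bounded by the second order Taylor remainder of exp(h ln u), uniformly
  enough to be integrated.\<close>

lemma mellin_holomorphic:
  assumes "continuous_on {0<..} p" and C: "C \<ge> 0" "\<And>u. u > 0 \<Longrightarrow> norm (p u) \<le>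
      C * exp (- u)"
  shows "mellin p holomorphic_on {s. Re s > 0}"
proof -
  have m: "p \<in> borel_measurable half_line" by (rule borel_measurable_half_line[OF assms(1)])
  have mln: "(\<lambda>u. complex_of_real (ln u)) \<in> borel_measurable half_line"
    by (intro borel_measurable_half_line continuous_intros) auto
  have "mellin p field_differentiable at s" if s: "Re s > 0" for s
  proof -
    \<comment> \<open>The majorant contains u^(Re s - 2e - 1), and Re s - 2e = Re s / 2 is still
      positive.\<close>
    define e where "e = Re s / 4"
    have e: "e > 0" using s by (simp add: e_def)
    define w where "w u = C * (u powr (Re s + 2 * e - 1) * exp (- (1 * u)) + u powr (Re s - 2 * e - 1) *
        exp (- (1 * u)))" for u
    have w: "integrable half_line w" unfolding w_def[abs_def]
      using e s by (intro integrable_mult_right Bochner_Integration.integrable_add half_line_Gamma_real)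
          (auto simp: e_def)
    have bound: "norm (p u * of_real u powr (s - 1)) * (\<bar>ln u\<bar> ^ n * exp (e * \<bar>ln
        u\<bar>)) \<le> fact n / e ^ n * w u" if u: "u > 0" for u n
    proof -
      have "norm (p u * of_real u powr (s - 1)) * (\<bar>ln u\<bar> ^ n * exp (e * \<bar>ln u\<bar>))
         \<le> (C * exp (- u) * u powr (Re s - 1)) * (fact n / e ^ n * (u powr (2 * e) + u powr (- (2 * e))))"
      proof (rule mult_mono)
        show "norm (p u * of_real u powr (s - 1)) \<le> C * exp (- u) * u powr (Re s - 1)"
          using C(2)[OF u] u by (simp add: norm_mult norm_powr_half_line mult_right_mono)
      qed (use C u abs_ln_power_le[OF u e, of n] in auto)
      also have "\<dots> = fact n / e ^ n * w u"
      proof -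
        have "u powr (Re s + 2 * e - 1) = u powr (Re s - 1) * u powr (2 * e)"
             "u powr (Re s - 2 * e - 1) = u powr (Re s - 1) * u powr (- (2 * e))"
          by (simp_all add: algebra_simps flip: powr_add)
        then show ?thesis by (simp add: w_def algebra_simps)
      qed
      finally show ?thesis .
    qed
    have int: "integrable half_line (\<lambda>u. p u * of_real u powr (t - 1))" if t: "norm (t - s) \<le> e" for t
    proof (rule integrable_half_line_bound)
      show "integrable half_line (\<lambda>u. fact 0 / e ^ 0 * w u)" using w by simp
      show "(\<lambda>u. p u * of_real u powr (t - 1)) \<in> borel_measurable half_line"
        by (intro borel_measurable_times m measurable_powr_half_line)
      fix u :: real assume u: "u > 0"
      have "norm (complex_of_real u powr (t - 1)) = norm (complex_of_real u powr (s - 1)) * u powr (Re (t - s))"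
        using u by (simp add: norm_powr_half_line flip: powr_add)
      also have "\<dots> \<le> norm (complex_of_real u powr (s - 1)) * exp (e * \<bar>ln u\<bar>)"
      proof -
        have "Re (t - s) * ln u \<le> \<bar>Re (t - s)\<bar> * \<bar>ln u\<bar>" by (metis abs_ge_self abs_mult)
        also have "\<dots> \<le> e * \<bar>ln u\<bar>"
          using abs_Re_le_cmod[of "t - s"] t by (intro mult_right_mono) auto
        finally have "u powr (Re (t - s)) \<le> exp (e * \<bar>ln u\<bar>)" using u by (simp add: powr_def)
        then show ?thesis by (rule mult_left_mono) simp
      qed
      finally have "norm (complex_of_real u powr (t - 1)) \<le> norm (complex_of_real u powr (s - 1)) *
          exp (e * \<bar>ln u\<bar>)" .
      then have "norm (p u * of_real u powr (t - 1)) \<le> norm (p u) * (norm (complex_of_real u powr (s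
          - 1)) * exp (e * \<bar>ln u\<bar>))"
        unfolding norm_mult by (auto intro!: mult_left_mono)
      also have "\<dots> \<le> fact 0 / e ^ 0 * w u"
        using bound[OF u, of 0] by (simp add: norm_mult mult.assoc)
      finally show "norm (p u * of_real u powr (t - 1)) \<le> fact 0 / e ^ 0 * w u" .
    qed
    define D where "D = half_integral (\<lambda>u. p u * of_real u powr (s - 1) * of_real (ln u))"
    have intD: "integrable half_line (\<lambda>u. p u * of_real u powr (s - 1) * of_real (ln u))"
    proof (rule integrable_half_line_bound)
      show "integrable half_line (\<lambda>u. fact 1 / e ^ 1 * w u)" using w by simp
      show "(\<lambda>u. p u * of_real u powr (s - 1) * of_real (ln u)) \<in> borel_measurable half_line"
        by (intro borel_measurable_times m measurable_powr_half_line mln)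
      fix u :: real assume u: "u > 0"
      have "\<bar>ln u\<bar> \<le> \<bar>ln u\<bar> * exp (e * \<bar>ln u\<bar>)" using e by (simp add:
          mult_le_cancel_left1)
      then have "norm (p u * of_real u powr (s - 1) * of_real (ln u)) \<le> norm (p u * of_real u powr (s
          - 1)) * (\<bar>ln u\<bar> ^ 1 * exp (e * \<bar>ln u\<bar>))"
        unfolding norm_mult[of _ "of_real (ln u)"] by (intro mult_left_mono) auto
      also have "\<dots> \<le> fact 1 / e ^ 1 * w u" by (rule bound[OF u])
      finally show "norm (p u * of_real u powr (s - 1) * of_real (ln u)) \<le> fact 1 / e ^ 1 * w u" .
    qed
    define K where "K = half_integral (\<lambda>u. fact 2 / e ^ 2 * w u)"
    have est: "norm ((mellin p (s + h) - mellin p s) / h - D) \<le> norm h * K" if h: "h \<noteq> 0"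
        "norm h \<le> e" for h
    proof -
      let ?g = "\<lambda>u. (p u * of_real u powr (s + h - 1) - p u * of_real u powr (s - 1)) / h - p u *
          of_real u powr (s - 1) * of_real (ln u)"
      have ih: "integrable half_line (\<lambda>u. p u * of_real u powr (s + h - 1))" using int[of "s + h"] h by simp
      have i0: "integrable half_line (\<lambda>u. p u * of_real u powr (s - 1))" using int[of s] e by simp
      have ig: "integrable half_line ?g"
        by (intro Bochner_Integration.integrable_diff integrable_divide ih i0 intD)
      have diff: "(mellin p (s + h) - mellin p s) / h - D = half_integral ?g"
        unfolding mellin_def D_def
          Bochner_Integration.integral_diff[OF integrable_divide[OF
              Bochner_Integration.integrable_diff[OF ih i0]] intD]
          integral_divide_zero Bochner_Integration.integral_diff[OF ih i0] ..
      have "norm ((mellin p (s + h) - mellin p s) / h - D) \<le> half_integral (\<lambda>u. norm (?g u))"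
        unfolding diff by (rule integral_norm_bound)
      also have "\<dots> \<le> half_integral (\<lambda>u. norm h * (fact 2 / e ^ 2 * w u))"
      proof (rule integral_mono)
        show "integrable half_line (\<lambda>u. norm (?g u))" using ig by (rule integrable_norm)
        show "integrable half_line (\<lambda>u. norm h * (fact 2 / e ^ 2 * w u))" using w by (intro
            integrable_mult_right)
        fix u assume "u \<in> space half_line"
        then have u: "u > 0" by (simp add: space_restrict_space)
        define z where "z = h * of_real (ln u)"
        have pw: "complex_of_real u powr (s + h - 1) = of_real u powr (s - 1) * exp z"
          using u by (simp add: powr_def z_def Ln_of_real exp_add[symmetric] algebra_simps)
        have "?g u = p u * of_real u powr (s - 1) * (exp z - (1 + z)) / h"
        proof -
          have "(a * (c * x) - a * c) / h - a * c * l = a * c * (x - (1 + h * l)) / h" for a c x l :: complex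
            using h by (simp add: divide_simps) (simp add: algebra_simps)
          then show ?thesis unfolding pw unfolding z_def .
        qed
        moreover have "norm (exp z - (1 + z)) \<le> (norm h)\<^sup>2 * (\<bar>ln u\<bar>\<^sup>2 * exp (e
            * \<bar>ln u\<bar>))"
        proof -
          have "norm (exp z - (1 + z)) \<le> exp \<bar>Re z\<bar> * (norm z)\<^sup>2"
            using Taylor_exp[of z 1] by (simp add: numeral_2_eq_2)
          also have "\<dots> \<le> exp (e * \<bar>ln u\<bar>) * (norm z)\<^sup>2"
          proof (rule mult_right_mono)
            have "\<bar>Re z\<bar> \<le> norm h * \<bar>ln u\<bar>" unfolding z_def
              using abs_Re_le_cmod[of h] by (auto simp: abs_mult intro: mult_right_mono)
            also have "\<dots> \<le> e * \<bar>ln u\<bar>" using h by (intro mult_right_mono) auto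
            finally show "exp \<bar>Re z\<bar> \<le> exp (e * \<bar>ln u\<bar>)" by simp
          qed simp
          finally show ?thesis by (simp add: z_def norm_mult power_mult_distrib mult_ac)
        qed
        ultimately have "norm (?g u) \<le> norm (p u * of_real u powr (s - 1)) * ((norm h)\<^sup>2 *
            (\<bar>ln u\<bar>\<^sup>2 * exp (e * \<bar>ln u\<bar>))) / norm h"
          by (auto simp: norm_mult norm_divide intro!: divide_right_mono mult_left_mono)
        also have "\<dots> = norm h * (norm (p u * of_real u powr (s - 1)) * (\<bar>ln u\<bar>\<^sup>2 *
            exp (e * \<bar>ln u\<bar>)))"
          using h by (simp add: power2_eq_square)
        also have "\<dots> \<le> norm h * (fact 2 / e ^ 2 * w u)"
          by (intro mult_left_mono bound[OF u]) simp
        finally show "norm (?g u) \<le> norm h * (fact 2 / e ^ 2 * w u)" .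
      qed
      also have "\<dots> = norm h * K" unfolding K_def by (rule integral_mult_right_zero)
      finally show ?thesis .
    qed
    have "((\<lambda>h. (mellin p (s + h) - mellin p s) / h - D) \<longlongrightarrow> 0) (at 0)"
    proof (rule Lim_null_comparison)
      have "\<forall>\<^sub>F h in at (0::complex). h \<in> cball 0 e - {0}"
        unfolding eventually_at using e by (intro exI[of _ e]) (auto simp: dist_norm)
      then show "\<forall>\<^sub>F h in at 0. norm ((mellin p (s + h) - mellin p s) / h - D) \<le> norm h * K"
        by eventually_elim (intro est, auto)
      show "((\<lambda>h::complex. norm h * K) \<longlongrightarrow> 0) (at 0)" by (auto intro!: tendsto_eq_intros)
    qed
    then have "(mellin p has_field_derivative D) (at s)"
      unfolding DERIV_def by (simp add: Lim_null[symmetric])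
    then show ?thesis by (auto simp: field_differentiable_def)
  qed
  then show ?thesis
    by (auto simp: holomorphic_on_def field_differentiable_at_within)
qed

lemma eq_on_half_plane:
  assumes "f holomorphic_on {s. Re s > a}" "g holomorphic_on {s. Re s > a}"
    and "\<And>s. Re s > 1 \<Longrightarrow> f s = g s" "a \<le> 1" "Re s > a"
  shows "f s = g s"
proof (rule analytic_continuation_open[of "{s. Re s > 1}" "{s. Re s > a}" f g])
  show "{s. Re s > 1} \<noteq> {}" by (auto intro!: exI[of _ 2])
  show "connected {s. Re s > a}" by (intro convex_connected convex_halfspace_Re_gt)
qed (use assms open_halfspace_Re_gt in auto)

lemma half_line_unit_powr:
  fixes s :: real
  assumes "s > 0"
  shows "integrable half_line (\<lambda>u. if u < 1 then u powr (s - 1) else 0)"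
    and "half_integral (\<lambda>u. if u < 1 then u powr (s - 1) else 0) = 1 / s"
proof -
  have d: "((\<lambda>u. u powr s / s) has_real_derivative u powr (s - 1)) (at u)" if "ereal 0 < ereal u" for u
    using that assms by (auto intro!: derivative_eq_intros)
  have c: "isCont (\<lambda>u. u powr (s - 1)) u" if "ereal 0 < ereal u" for u
    using that by (intro continuous_intros) auto
  have A: "(((\<lambda>u. u powr s / s) \<circ> real_of_ereal) \<longlongrightarrow> 0) (at_right (ereal 0))"
    unfolding ereal_tendsto_simps using assms by real_asymp
  have "((\<lambda>u. u powr s / s) \<longlongrightarrow> 1 powr s / s) (at_left (1::real))"
    using assms by (intro tendsto_intros) auto
  then have B: "(((\<lambda>u. u powr s / s) \<circ> real_of_ereal) \<longlongrightarrow> 1 / s) (at_left (ereal 1))"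
    unfolding ereal_tendsto_simps by simp
  have I: "set_integrable lborel (einterval (ereal 0) (ereal 1)) (\<lambda>u. u powr (s - 1))"
    "(LBINT u=ereal 0..ereal 1. u powr (s - 1)) = 1 / s - 0"
    using interval_integral_FTC_nonneg[OF _ d c _ A B] by auto
  have s1: "set_integrable lborel {0<..<1} (\<lambda>u. u powr (s - 1))" using I(1) by simp
  have s2: "set_integrable lborel {1<..} (\<lambda>u::real. 0 :: real)" by (simp add: set_integrable_def)
  have m: "(\<lambda>u. if u < 1 then u powr (s - 1) else 0) \<in> borel_measurable half_line"
    by measurable
  note sp = half_line_split[OF s1 s2 _ _ m]
  show "integrable half_line (\<lambda>u. if u < 1 then u powr (s - 1) else 0)" by (rule sp(1)) auto
  have "half_integral (\<lambda>u. if u < 1 then u powr (s - 1) else 0)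
     = (LBINT u:{0<..<1}. u powr (s - 1)) + (LBINT u:{1::real<..}. (0::real))"
    by (rule sp(2)) auto
  then show "half_integral (\<lambda>u. if u < 1 then u powr (s - 1) else 0) = 1 / s"
    using I(2) by (simp add: interval_lebesgue_integral_def)
qed

section \<open>Analytic continuation of the L-function through Mellin transforms of the
  moments\<close>

context even_primitive_character
begin

lemma continuous_on_char_moment: "continuous_on {0<..} (\<lambda>u. char_moment k (of_real u))"
proof (rule continuous_at_imp_continuous_on, rule ballI)
  fix u :: real assume "u \<in> {0<..}"
  then have "isCont (char_moment k) (of_real u)"
    using has_field_derivative_char_moment[of "of_real u" k] DERIV_isCont by auto
  then show "isCont (\<lambda>u. char_moment k (of_real u)) u"
    using isCont_o2[of u complex_of_real "char_moment k"] by (simp add: continuous_of_real)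
qed

definition dirichlet_sum :: "complex \<Rightarrow> complex" where
  "dirichlet_sum s = (\<Sum>n. chi (Suc n) / of_nat (Suc n) powr s)"

abbreviation moment_mellin :: "nat \<Rightarrow> complex \<Rightarrow> complex" where
  "moment_mellin k \<equiv> mellin (\<lambda>u. char_moment k (of_real u))"

text \<open>Exchanging series and integral relies on the convergence of the sum of d^(k - Re s),
  which dictates the half-plane.\<close>

lemma moment_mellin_eq_dirichlet_sum:
  assumes "Re s > real k + 1"
  shows "moment_mellin k s = Gamma s * dirichlet_sum (s - of_nat k)"
proof -
  let ?f = "\<lambda>d u. of_nat d ^ k * chi d * (complex_of_real u powr (s - 1) * of_real (exp (- (real d * u))))"
  have s: "Re s > 0" using assms by simp
  have int: "integrable half_line (?f d)" for d
    using half_line_Gamma(1)[OF s, of "real d"] chi_0[OF nonprincipal] by (cases "d = 0") auto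
  have val: "half_integral (?f d) = of_nat d ^ k * chi d * (Gamma s / of_nat d powr s)" for d
    using half_line_Gamma(2)[OF s, of "real d"] chi_0[OF nonprincipal]
    by (cases "d = 0") (auto simp: integral_mult_right_zero)
  have norm_le: "norm (?f d u) \<le> real d ^ k * norm (chi d) * (u powr (Re s - 1) * exp (- (real d *
      u)))" if "u > 0" for d u
    using that by (simp add: norm_mult norm_power norm_powr_half_line flip: exp_of_real)
  have sums: "summable (\<lambda>d. half_integral (\<lambda>u. norm (?f d u)))"
  proof (rule summable_comparison_test)
    have "half_integral (\<lambda>u. norm (?f d u)) \<le> Gamma (Re s) * real d powr (real k - Re s)" for d
    proof (cases "d = 0")
      case True
      then show ?thesis using chi_0[OF nonprincipal] by simp
    next
      case False
      have "half_integral (\<lambda>u. norm (?f d u)) \<le>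
          half_integral (\<lambda>u. real d ^ k * norm (chi d) * (u powr (Re s - 1) * exp (- (real d * u))))"
      proof (rule integral_mono[OF integrable_norm[OF int] integrable_mult_right])
        show "integrable half_line (\<lambda>u. u powr (Re s - 1) * exp (- (real d * u)))"
          using False s by (intro half_line_Gamma_real) auto
      qed (use norm_le in \<open>auto simp: space_restrict_space\<close>)
      also have "\<dots> = real d ^ k * norm (chi d) * (Gamma (Re s) / real d powr Re s)"
        using half_line_Gamma_real(2)[OF s, of "real d"] False by (simp only: integral_mult_right_zero)
      also have "\<dots> \<le> real d ^ k * 1 * (Gamma (Re s) / real d powr Re s)"
        using norm_chi_le[of d] Gamma_real_pos[OF s] by (intro mult_right_mono mult_left_mono) auto
      also have "\<dots> = Gamma (Re s) * real d powr (real k - Re s)"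
        using False by (simp add: powr_diff powr_realpow)
      finally show ?thesis .
    qed
    then show "\<exists>N. \<forall>d\<ge>N. norm (half_integral (\<lambda>u. norm (?f d u))) \<le> Gamma
        (Re s) * real d powr (real k - Re s)"
      by (simp add: Bochner_Integration.integral_nonneg)
    show "summable (\<lambda>d. Gamma (Re s) * real d powr (real k - Re s))"
      using assms by (intro summable_mult) (simp add: summable_real_powr_iff)
  qed
  have eq: "?f d u = of_nat d ^ k * chi d * exp (- of_nat d * of_real u) * of_real u powr (s - 1)" for d u
    by (simp add: mult_ac flip: exp_of_real)
  have sn: "summable (\<lambda>d. norm (?f d u))" if "u > 0" for u
    unfolding eq norm_mult[of _ "of_real u powr (s - 1)"]
    by (intro summable_mult2 summable_norm_char_moment) (use that in simp)
  have sf: "(\<Sum>d. ?f d u) = char_moment k (of_real u) * of_real u powr (s - 1)" if "u > 0" for u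
    unfolding eq char_moment_def
    by (rule suminf_mult2[symmetric], rule summable_norm_cancel, rule summable_norm_char_moment) (use that in simp)
  have "(\<lambda>d. half_integral (?f d)) sums half_integral (\<lambda>u. \<Sum>d. ?f d u)"
    using sn by (intro sums_integral int sums AE_I2) (auto simp: space_restrict_space)
  also have "half_integral (\<lambda>u. \<Sum>d. ?f d u) = moment_mellin k s"
    unfolding mellin_def by (rule integral_half_line_cong[OF sf])
  finally have "(\<lambda>d. of_nat d ^ k * chi d * (Gamma s / of_nat d powr s)) sums moment_mellin k s"
    unfolding val .
  moreover have "of_nat 0 ^ k * chi 0 * (Gamma s / of_nat 0 powr s) = 0" using chi_0[OF nonprincipal] by simp
  ultimately have "(\<lambda>n. of_nat (Suc n) ^ k * chi (Suc n) * (Gamma s / of_nat (Suc n) powr s))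
      sums moment_mellin k s"
    by (subst sums_Suc_iff) simp
  moreover have "of_nat (Suc n) ^ k * chi (Suc n) * (Gamma s / of_nat (Suc n) powr s)
      = Gamma s * (chi (Suc n) / of_nat (Suc n) powr (s - of_nat k))" for n
    by (simp add: powr_diff powr_nat' del: of_nat_Suc)
  ultimately have "(\<lambda>n. Gamma s * (chi (Suc n) / of_nat (Suc n) powr (s - of_nat k))) sums moment_mellin k s"
    by (simp only:)
  then have S: "(\<lambda>n. Gamma s * (chi (Suc n) / of_nat (Suc n) powr (s - of_nat k)) / Gamma s) sums
      (moment_mellin k s / Gamma s)"
    by (rule sums_divide)
  have G: "Gamma s \<noteq> 0" using s by (auto simp: Gamma_eq_zero_iff elim!: nonpos_Ints_cases)
  then have "moment_mellin k s / Gamma s = dirichlet_sum (s - of_nat k)"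
    using S unfolding dirichlet_sum_def by (simp add: sums_iff del: of_nat_Suc)
  then show ?thesis using G by (simp add: field_simps)
qed

text \<open>Continues the Dirichlet series to Re s > -k. Larger \<open>k\<close> reach further left,
  and together the extensions cover the plane.\<close>

definition partial_L :: "nat \<Rightarrow> complex \<Rightarrow> complex" where
  "partial_L k s = rGamma (s + of_nat k) * moment_mellin k (s + of_nat k)"

lemma moment_mellin_holomorphic:
  assumes "k \<ge> 1"
  shows "moment_mellin k holomorphic_on {s. Re s > 0}"
proof -
  obtain C where "C \<ge> 0" "\<forall>u>0. norm (char_moment k (of_real u)) \<le> C * exp (- u)"
    using char_moment_exp_bound[OF assms] by blast
  then show ?thesis by (intro mellin_holomorphic[OF continuous_on_char_moment]) auto
qed

lemma partial_L_holomorphic: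
  assumes "k \<ge> 1"
  shows "partial_L k holomorphic_on {s. Re s > - real k}"
proof -
  have "(\<lambda>s. moment_mellin k (s + of_nat k)) holomorphic_on {s. Re s > - real k}"
    by (rule holomorphic_on_compose_gen[OF _ moment_mellin_holomorphic[OF assms], unfolded o_def])
       (auto intro!: holomorphic_intros)
  then show ?thesis unfolding partial_L_def[abs_def]
    by (intro holomorphic_intros) auto
qed

lemma partial_L_eq_dirichlet_sum:
  assumes "Re s > 1"
  shows "partial_L k s = dirichlet_sum s"
proof -
  have "s + of_nat k \<notin> \<int>\<^sub>\<le>\<^sub>0" using assms by (auto elim!: nonpos_Ints_cases
      simp: complex_eq_iff)
  then have "rGamma (s + of_nat k) * Gamma (s + of_nat k) = 1"
    by (simp add: rGamma_inverse_Gamma Gamma_eq_zero_iff)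
  then show ?thesis
    using moment_mellin_eq_dirichlet_sum[of k "s + of_nat k"] assms
    by (simp add: partial_L_def mult.assoc[symmetric])
qed

lemma partial_L_eq:
  assumes "k \<ge> 1" "k \<le> l" "Re s > - real k"
  shows "partial_L l s = partial_L k s"
proof (rule eq_on_half_plane[of "partial_L l" "- real k" "partial_L k"])
  show "partial_L l holomorphic_on {s. Re s > - real k}"
    by (rule holomorphic_on_subset[OF partial_L_holomorphic]) (use assms in auto)
qed (use assms partial_L_holomorphic partial_L_eq_dirichlet_sum in auto)

text \<open>Existence and uniqueness behind the \<open>THE\<close> in \<open>dirichlet_L\<close>:
  the extensions are glued to an entire function, and the identity theorem makes it the only
  one.\<close>

lemma dirichlet_L_characterization:
  "dirichlet_L chi holomorphic_on UNIV" "Re s > 1 \<Longrightarrow> dirichlet_L chi s = dirichlet_sum s"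
proof -
  \<comment> \<open>The order grows with the real part in absolute value, so that every point lies
    in the half-plane of the extension used there.\<close>
  define L where "L s = partial_L (nat \<lceil>\<bar>Re s\<bar>\<rceil> + 1) s" for s
  have L_eq: "L s = partial_L l s" if "l \<ge> nat \<lceil>\<bar>Re s\<bar>\<rceil> + 1" for s l
    unfolding L_def
  proof (rule partial_L_eq[symmetric])
    have "\<bar>Re s\<bar> \<le> real (nat \<lceil>\<bar>Re s\<bar>\<rceil>)" by (rule real_nat_ceiling_ge)
    then show "Re s > - real (nat \<lceil>\<bar>Re s\<bar>\<rceil> + 1)" unfolding of_nat_add by linarith
  qed (use that in auto)
  have hol: "L holomorphic_on UNIV"
  proof -
    have "L field_differentiable at s" for s
    proof -
      \<comment> \<open>One unit more than needed at \<open>s\<close>, so that a single extension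
        serves the whole unit ball around \<open>s\<close>.\<close>
      define l where "l = nat \<lceil>\<bar>Re s\<bar> + 1\<rceil> + 1"
      have l: "\<bar>Re s\<bar> + 1 < real l" unfolding l_def of_nat_add using real_nat_ceiling_ge[of
          "\<bar>Re s\<bar> + 1"] by linarith
      then have "partial_L l field_differentiable at s"
        using holomorphic_on_imp_differentiable_at[OF partial_L_holomorphic[of l] open_halfspace_Re_gt, of s]
        by (simp add: l_def)
      moreover have "L t = partial_L l t" if "t \<in> ball s 1" for t
      proof (rule L_eq)
        have "\<bar>Re (t - s)\<bar> < 1" using that abs_Re_le_cmod[of "t - s"] by (simp add: dist_norm
            norm_minus_commute)
        then have "\<bar>Re t\<bar> \<le> \<bar>Re s\<bar> + 1" by simp
        then show "nat \<lceil>\<bar>Re t\<bar>\<rceil> + 1 \<le> l" unfolding l_def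
          by (intro add_right_mono nat_mono ceiling_mono)
      qed
      moreover have "s \<in> ball s 1" by simp
      ultimately show ?thesis
        unfolding field_differentiable_def
        using has_field_derivative_transform_within_open[of "partial_L l" _ s "ball s 1" L] by auto
    qed
    then show ?thesis by (simp add: holomorphic_on_def field_differentiable_at_within)
  qed
  have ser: "L s = dirichlet_sum s" if "Re s > 1" for s
    unfolding L_def by (rule partial_L_eq_dirichlet_sum[OF that])
  have "dirichlet_L chi = L"
    unfolding dirichlet_L_def
  proof (rule the_equality)
    show "L holomorphic_on UNIV \<and> (\<forall>s. 1 < Re s \<longrightarrow> L s = (\<Sum>n. chi (Suc
        n) / of_nat (Suc n) powr s))"
      using hol ser by (simp add: dirichlet_sum_def)
    fix f assume f: "f holomorphic_on UNIV \<and> (\<forall>s. 1 < Re s \<longrightarrow> f s = (\<Sum>n.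
        chi (Suc n) / of_nat (Suc n) powr s))"
    show "f = L"
    proof
      fix s
      show "f s = L s"
        by (rule eq_on_half_plane[of f "min 1 (Re s - 1)" L])
           (use f hol ser in \<open>auto simp: dirichlet_sum_def intro: holomorphic_on_subset\<close>)
    qed
  qed
  then show "dirichlet_L chi holomorphic_on UNIV" "Re s > 1 \<Longrightarrow> dirichlet_L chi s = dirichlet_sum s"
    using hol ser by auto
qed

lemma moment_mellin_eq_L:
  assumes "k \<ge> 1" "Re s > 0"
  shows "moment_mellin k s = Gamma s * dirichlet_L chi (s - of_nat k)"
proof -
  have "partial_L k (s - of_nat k) = dirichlet_L chi (s - of_nat k)"
  proof (rule eq_on_half_plane[of "partial_L k" "- real k" "dirichlet_L chi"])
    show "dirichlet_L chi holomorphic_on {s. - real k < Re s}"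
      using dirichlet_L_characterization(1) by (rule holomorphic_on_subset) simp
  qed (use assms partial_L_holomorphic partial_L_eq_dirichlet_sum dirichlet_L_characterization(2) in auto)
  moreover have "s \<notin> \<int>\<^sub>\<le>\<^sub>0" using assms by (auto elim!: nonpos_Ints_cases
      simp: complex_eq_iff)
  then have "Gamma s * rGamma s = 1"
    by (simp add: rGamma_inverse_Gamma Gamma_eq_zero_iff)
  ultimately show ?thesis by (simp add: partial_L_def mult.assoc[symmetric] flip: \<open>partial_L k (s -
      of_nat k) = dirichlet_L chi (s - of_nat k)\<close>)
qed

section \<open>The values of L and its derivative at -k\<close>

definition regularized_moment :: "nat \<Rightarrow> complex" where
  "regularized_moment k = half_integral
     (\<lambda>u. (char_moment k (of_real u) - (if u < 1 then pole_sum k 0 else 0)) / of_real u)"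

text \<open>For 0 < s <= 1, Gamma(s + 1) L(s - k) equals P(0) + s E(s), where E is the Mellin
  integral after removing P(0) on u < 1. The limit of this identity at 0 and its difference quotient
  there give the two values; Gamma'(1) = -gamma produces the correction to L'.\<close>

lemma L_values:
  assumes "k \<ge> 1"
  shows "pole_sum k 0 = dirichlet_L chi (- of_nat k)"
    and "regularized_moment k = deriv (dirichlet_L chi) (- of_nat k) - euler_mascheroni * dirichlet_L chi
        (- of_nat k)"
proof -
  let ?L = "dirichlet_L chi" and ?Z = "pole_sum k 0"
  let ?P = "\<lambda>u. char_moment k (complex_of_real u)"
  let ?R = "\<lambda>u. ?P u - (if u < 1 then ?Z else 0)"
  obtain C where C: "C \<ge> 0" "\<And>u. u > 0 \<Longrightarrow> norm (?P u) \<le> C * exp (- u)"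
    using char_moment_exp_bound[OF assms] by blast
  obtain C' where C': "C' \<ge> 0" "\<And>u. u > 0 \<Longrightarrow> norm (?P u - ?Z) \<le> C' * u"
    using char_moment_lipschitz_0[OF assms] by blast
  define A where "A = C' * exp 1 + C"
  have A0: "A \<ge> 0" using C C' by (simp add: A_def)
  have mP: "?P \<in> borel_measurable half_line"
    by (rule borel_measurable_half_line[OF continuous_on_char_moment])
  have mR: "?R \<in> borel_measurable half_line"
    by (intro borel_measurable_diff mP) measurable
  have R: "norm (?R u) \<le> A * (u * exp (- u))" if u: "u > 0" for u
  proof (cases "u < 1")
    case True
    then have "norm (?R u) \<le> C' * u * 1" using C'(2)[OF u] by simp
    also have "\<dots> \<le> C' * u * (exp 1 * exp (- u))"
      using True C' u by (intro mult_left_mono) (auto simp flip: exp_add)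
    also have "\<dots> = C' * exp 1 * (u * exp (- u))" by simp
    also have "\<dots> \<le> A * (u * exp (- u))" unfolding A_def using C u by (intro mult_right_mono) auto
    finally show ?thesis .
  next
    case False
    then have "norm (?R u) \<le> C * (1 * exp (- u))" using C(2)[OF u] by simp
    also have "\<dots> \<le> C * (u * exp (- u))" using False C by (intro mult_left_mono mult_right_mono) auto
    also have "\<dots> \<le> A * (u * exp (- u))" unfolding A_def using C' u by (intro mult_right_mono) auto
    finally show ?thesis .
  qed
  \<comment> \<open>A majorant valid for all exponents \<open>s\<close> in [0, 1] at once: A (u + 1)
    exp(-u), written in terms of Gamma integrands.\<close>
  define w where "w u = A * (u powr (2 - 1) * exp (- (1 * u)) + u powr (1 - 1) * exp (- (1 * u)))" for u :: real
  have w: "integrable half_line w" unfolding w_def[abs_def]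
    by (intro integrable_mult_right Bochner_Integration.integrable_add half_line_Gamma_real) auto
  have Rw: "norm (?R u * of_real (u powr (s - 1))) \<le> w u" if u: "u > 0" and s: "0 \<le> s" "s \<le>
      1" for u s :: real
  proof -
    have "norm (?R u * of_real (u powr (s - 1))) \<le> A * (u * exp (- u)) * u powr (s - 1)"
      unfolding norm_mult using R[OF u] A0 u by (intro mult_mono) auto
    also have "\<dots> = A * (u powr s * exp (- u))"
      using u by (simp add: powr_diff)
    also have "\<dots> \<le> A * ((u + 1) * exp (- u))"
    proof (intro mult_left_mono mult_right_mono A0)
      show "u powr s \<le> u + 1"
      proof (cases "u \<le> 1")
        case True
        then have "u powr s \<le> 1" using u s by (intro powr_le1) auto
        then show ?thesis using u by simp
      next
        case False
        then have "u powr s \<le> u powr 1" using s by (intro powr_mono) auto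
        then show ?thesis using u by simp
      qed
    qed simp
    also have "\<dots> = w u" using u by (simp add: w_def algebra_simps)
    finally show ?thesis .
  qed
  have mpow: "(\<lambda>u. complex_of_real (u powr s)) \<in> borel_measurable half_line" for s
    by (intro borel_measurable_half_line continuous_intros) auto
  have intR: "integrable half_line (\<lambda>u. ?R u * of_real (u powr (s - 1)))" if "0 \<le> s" "s \<le> 1" for s
    by (rule integrable_half_line_bound[OF w]) (use Rw that in \<open>auto intro!: borel_measurable_times
        mR mpow\<close>)
  define E where "E s = half_integral (\<lambda>u. ?R u * of_real (u powr (s - 1)))" for s
  define t where "t n = 1 / real (Suc n)" for n
  have t: "t n > 0" "t n \<le> 1" for n by (auto simp: t_def)
  have t0: "t \<longlonglongrightarrow> 0" unfolding t_def[abs_def] by real_asymp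
  have reg: "regularized_moment k = E 0"
    unfolding regularized_moment_def E_def
    by (rule integral_half_line_cong) (simp add: powr_minus divide_inverse)
  have Elim: "(\<lambda>n. E (t n)) \<longlonglongrightarrow> E 0"
    unfolding E_def
  proof (rule integral_dominated_convergence[OF _ _ w])
    show "AE u in half_line. (\<lambda>n. ?R u * of_real (u powr (t n - 1))) \<longlonglongrightarrow> ?R
        u * of_real (u powr (0 - 1))"
      by (rule AE_I2, intro tendsto_intros t0) (auto simp: space_restrict_space)
    show "AE u in half_line. norm (?R u * of_real (u powr (t n - 1))) \<le> w u" for n
      using Rw t[of n] by (intro AE_I2) (auto simp: space_restrict_space)
  qed (intro borel_measurable_times mR mpow)+
  \<comment> \<open>Multiplying the Mellin transform by \<open>s\<close> removes the pole of Gamma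
    at 0 and makes the function differentiable there.\<close>
  define H where "H s = Gamma (s + 1) * ?L (s - of_nat k)" for s
  have HE: "H (of_real s) = of_real s * E s + ?Z" if s: "0 < s" "s \<le> 1" for s
  proof -
    have "moment_mellin k (of_real s) = half_integral
       (\<lambda>u. ?R u * of_real (u powr (s - 1)) + ?Z * of_real (if u < 1 then u powr (s - 1) else 0))"
      unfolding mellin_def
    proof (rule integral_half_line_cong)
      fix u :: real assume "u > 0"
      then have "complex_of_real u powr (of_real s - 1) = of_real (u powr (s - 1))"
        using powr_of_real[of u "s - 1"] by simp
      then show "?P u * complex_of_real u powr (of_real s - 1) = ?R u * of_real (u powr (s - 1)) + ?Z *
          of_real (if u < 1 then u powr (s - 1) else 0)"
        by (simp add: algebra_simps)
    qed
    also have "\<dots> = E s + half_integral (\<lambda>u. ?Z * complex_of_real (if u < 1 then u powr (s - 1) else 0))"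
      unfolding E_def using s
      by (intro Bochner_Integration.integral_add intR integrable_mult_right integrable_of_real
          half_line_unit_powr) auto
    also have "\<dots> = E s + ?Z * of_real (1 / s)"
      unfolding half_line_unit_powr(2)[OF s(1), symmetric] integral_complex_of_real[symmetric]
          integral_mult_right_zero ..
    finally have "Gamma (of_real s) * ?L (of_real s - of_nat k) = E s + ?Z * of_real (1 / s)"
      using moment_mellin_eq_L[OF assms, of "of_real s"] s by simp
    moreover have "H (of_real s) = of_real s * (Gamma (of_real s) * ?L (of_real s - of_nat k))"
    proof -
      have "complex_of_real s \<notin> \<int>\<^sub>\<le>\<^sub>0" using s by (auto elim!:
          nonpos_Ints_cases simp: complex_eq_iff)
      then show ?thesis unfolding H_def by (subst Gamma_plus1) auto
    qed
    ultimately show ?thesis using s by (simp add: algebra_simps)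
  qed
  have L': "(?L has_field_derivative deriv ?L (- of_nat k)) (at (- of_nat k))"
    using dirichlet_L_characterization(1) holomorphic_derivI[of ?L UNIV] by auto
  have H': "(H has_field_derivative (deriv ?L (- of_nat k) - euler_mascheroni * ?L (- of_nat k))) (at 0)"
  proof -
    have g: "((\<lambda>s. Gamma (s + 1)) has_field_derivative - euler_mascheroni) (at (0::complex))"
    proof -
      have "(Gamma has_field_derivative Gamma 1 * Digamma 1) (at (1::complex))"
        by (rule has_field_derivative_Gamma) auto
      then have "(Gamma has_field_derivative - euler_mascheroni) (at (0 + 1::complex))" by simp
      then show ?thesis by (subst (asm) DERIV_shift)
    qed
    have l: "((\<lambda>s. ?L (s - of_nat k)) has_field_derivative deriv ?L (- of_nat k)) (at 0)"
      using L' DERIV_shift[of ?L "deriv ?L (- of_nat k)" 0 "- of_nat k"] by simp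
    show ?thesis unfolding H_def[abs_def]
      using DERIV_mult[OF g l] by (simp add: algebra_simps)
  qed
  have tc: "(\<lambda>n. complex_of_real (t n)) \<longlonglongrightarrow> 0" using tendsto_of_real[OF t0] by simp
  have Hlim: "(\<lambda>n. H (of_real (t n))) \<longlonglongrightarrow> H 0"
    using isCont_tendsto_compose[OF DERIV_isCont[OF H'] tc] .
  have "(\<lambda>n. of_real (t n) * E (t n) + ?Z) \<longlonglongrightarrow> 0 * E 0 + ?Z"
    by (intro tendsto_intros tc Elim)
  then have "(\<lambda>n. H (of_real (t n))) \<longlonglongrightarrow> ?Z" using HE t by simp
  with Hlim have H0: "H 0 = ?Z" by (rule LIMSEQ_unique)
  then show P0: "?Z = ?L (- of_nat k)" by (simp add: H_def)
  have "((\<lambda>h. (H h - H 0) / h) \<longlongrightarrow> deriv ?L (- of_nat k) - euler_mascheroni *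
      ?L (- of_nat k)) (at 0)"
    using H' by (simp add: has_field_derivative_iff)
  moreover have "filterlim (\<lambda>n. complex_of_real (t n)) (at 0) sequentially"
    using tc t by (intro filterlim_atI) (auto simp: less_imp_neq[symmetric])
  ultimately have "(\<lambda>n. (H (of_real (t n)) - H 0) / of_real (t n)) \<longlonglongrightarrow>
      deriv ?L (- of_nat k) - euler_mascheroni * ?L (- of_nat k)"
    by (rule filterlim_compose)
  moreover have "(H (of_real (t n)) - H 0) / of_real (t n) = E (t n)" for n
    using HE[OF t] t(1)[of n] H0 by simp
  ultimately have "E 0 = deriv ?L (- of_nat k) - euler_mascheroni * ?L (- of_nat k)"
    using Elim LIMSEQ_unique by simp
  then show "regularized_moment k = deriv ?L (- of_nat k) - euler_mascheroni * ?L (- of_nat k)"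
    using reg by simp
qed

end

section \<open>Bessel series\<close>

text \<open>Trading exp(-beta/u) for a power of u/beta leaves a Gamma integrand and gives decay of
  any prescribed order in alpha beta.\<close>

lemma bessel_integrand_bound:
  fixes \<alpha> \<beta> u :: real
  assumes "\<beta> > 0" "u > 0"
  shows "exp (- (\<alpha> * u) - \<beta> / u) / u \<le> fact n / \<beta> ^ n * (u powr (real n - 1) * exp
      (- (\<alpha> * u)))"
proof -
  have "exp (- (\<beta> / u)) \<le> fact n / (\<beta> / u) ^ n"
    using assms by (intro exp_minus_le_power) simp
  then have "exp (- (\<alpha> * u)) * exp (- (\<beta> / u)) / u \<le> exp (- (\<alpha> * u)) * (fact n /
      (\<beta> / u) ^ n) / u"
    using assms by (intro divide_right_mono mult_left_mono) auto
  also have "\<dots> = fact n / \<beta> ^ n * (u powr (real n - 1) * exp (- (\<alpha> * u)))"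
    using assms by (simp add: powr_diff powr_realpow power_divide)
  finally show ?thesis by (simp add: exp_diff exp_minus divide_inverse)
qed

lemma continuous_on_bessel_integrand:
  "continuous_on {0<..} (\<lambda>u::real. exp (- (\<alpha> * u) - \<beta> / u) / u)"
  by (intro continuous_intros) auto

lemma integrable_bessel:
  fixes \<alpha> \<beta> :: real
  assumes "\<alpha> > 0" "\<beta> > 0"
  shows "integrable half_line (\<lambda>u. exp (- (\<alpha> * u) - \<beta> / u) / u)"
proof (rule integrable_half_line_bound)
  show "integrable half_line (\<lambda>u. fact 1 / \<beta> ^ 1 * (u powr (real 1 - 1) * exp (- (\<alpha> * u))))"
    using assms by (intro integrable_mult_right half_line_Gamma_real) auto
  show "(\<lambda>u. exp (- (\<alpha> * u) - \<beta> / u) / u) \<in> borel_measurable half_line"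
    by (rule borel_measurable_half_line[OF continuous_on_bessel_integrand])
  show "norm (exp (- (\<alpha> * u) - \<beta> / u) / u) \<le> fact 1 / \<beta> ^ 1 * (u powr (real 1 - 1)
      * exp (- (\<alpha> * u)))" if "u > 0" for u
    using bessel_integrand_bound[OF assms(2) that, of \<alpha> 1] that by simp
qed

lemma integral_bessel_le:
  fixes \<alpha> \<beta> :: real
  assumes "\<alpha> > 0" "\<beta> > 0" "n \<ge> 1"
  shows "half_integral (\<lambda>u. exp (- (\<alpha> * u) - \<beta> / u) / u) \<le> fact n * Gamma (real
      n) / (\<alpha> * \<beta>) ^ n"
proof -
  have "half_integral (\<lambda>u. exp (- (\<alpha> * u) - \<beta> / u) / u)
      \<le> half_integral (\<lambda>u. fact n / \<beta> ^ n * (u powr (real n - 1) * exp (- (\<alpha> * u))))"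
    using assms bessel_integrand_bound[OF assms(2)]
    by (intro integral_mono integrable_bessel integrable_mult_right half_line_Gamma_real)
       (auto simp: space_restrict_space)
  also have "\<dots> = fact n / \<beta> ^ n * (Gamma (real n) / \<alpha> powr real n)"
    using half_line_Gamma_real(2)[of "real n" \<alpha>] assms by (simp only: integral_mult_right_zero)
  also have "\<dots> = fact n * Gamma (real n) / (\<alpha> * \<beta>) ^ n"
    using assms by (simp add: powr_realpow power_mult_distrib mult.commute)
  finally show ?thesis .
qed

text \<open>The substitution u = c exp t with c = sqrt(beta/alpha) balances the two exponents into x
  cosh t. The integral over the whole line is twice the one over t >= 0 because cosh is
  even.\<close>

lemma integral_bessel:
  fixes \<alpha> \<beta> :: real
  assumes "\<alpha> > 0" "\<beta> > 0"
  shows "half_integral (\<lambda>u. exp (- (\<alpha> * u) - \<beta> / u) / u) = 2 * bessel_K0 (2 * sqrt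
      (\<alpha> * \<beta>))"
proof -
  let ?f = "\<lambda>u. exp (- (\<alpha> * u) - \<beta> / u) / u"
  define c where "c = sqrt (\<beta> / \<alpha>)"
  define x where "x = 2 * sqrt (\<alpha> * \<beta>)"
  let ?h = "\<lambda>t. exp (- x * cosh t)"
  have c: "c > 0" using assms by (simp add: c_def)
  have ac: "\<alpha> * c = sqrt (\<alpha> * \<beta>)" "\<beta> / c = sqrt (\<alpha> * \<beta>)"
  proof -
    have "c\<^sup>2 = \<beta> / \<alpha>" using assms by (simp add: c_def)
    then have "(\<alpha> * c)\<^sup>2 = \<alpha> * \<beta>" "(\<beta> / c)\<^sup>2 = \<alpha> * \<beta>"
      unfolding power_mult_distrib power_divide using assms by (simp_all add: power2_eq_square)
    then show "\<alpha> * c = sqrt (\<alpha> * \<beta>)" "\<beta> / c = sqrt (\<alpha> * \<beta>)"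
      using assms c by (metis less_imp_le mult_pos_pos real_sqrt_unique divide_pos_pos)+
  qed
  define I where "I = half_integral ?f"
  have "set_integrable lborel {0<..} ?f"
    using integrable_bessel[OF assms] by (simp add: integrable_half_line_iff)
  then have "set_integrable lebesgue {0<..} ?f"
    unfolding set_integrable_def by (subst integrable_completion) (auto intro: borel_measurable_integrable)
  moreover have "integral {0<..} ?f = I"
    using set_borel_integral_eq_integral(2)[OF \<open>set_integrable lborel {0<..} ?f\<close>]
    by (simp add: I_def integral_half_line)
  moreover have "range (\<lambda>t. c * exp t) = {0<..}"
  proof safe
    fix u :: real assume "u > 0"
    then have "u = c * exp (ln (u / c))" using c by simp
    then show "u \<in> range (\<lambda>t. c * exp t)" by blast
  qed (use c in auto)
  ultimately have "?f absolutely_integrable_on (range (\<lambda>t. c * exp t)) \<and> integral (range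
      (\<lambda>t. c * exp t)) ?f = I" by simp
  then have "(\<lambda>t. \<bar>c * exp t\<bar> * ?f (c * exp t)) absolutely_integrable_on UNIV \<and>
      integral UNIV (\<lambda>t. \<bar>c * exp t\<bar> * ?f (c * exp t)) = I"
    using c by (subst has_absolute_integral_change_of_variables_1'[where g = "\<lambda>t. c * exp t" and
        g' = "\<lambda>t. c * exp t"])
               (auto intro!: derivative_eq_intros inj_onI)
  moreover have "\<bar>c * exp t\<bar> * ?f (c * exp t) = ?h t" for t
  proof -
    have "\<alpha> * (c * exp t) + \<beta> / (c * exp t) = \<alpha> * c * exp t + (\<beta> / c) * exp (- t)"
      by (simp add: exp_minus divide_inverse mult_ac)
    also have "\<dots> = x * cosh t" unfolding ac by (simp add: x_def cosh_def algebra_simps)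
    finally have "- (\<alpha> * (c * exp t)) - \<beta> / (c * exp t) = - x * cosh t" by simp
    then have "?f (c * exp t) = exp (- x * cosh t) / (c * exp t)" by simp
    then show ?thesis using c by simp
  qed
  ultimately have h: "?h absolutely_integrable_on UNIV" "integral UNIV ?h = I" by simp_all
  have hp: "?h absolutely_integrable_on {0..}"
    using h(1) by (rule set_integrable_subset) auto
  have "(\<lambda>t. \<bar>-1\<bar> * ?h (- t)) absolutely_integrable_on {0..} \<and> integral {0..}
      (\<lambda>t. \<bar>-1\<bar> * ?h (- t)) = bessel_K0 x"
    using hp by (simp add: bessel_K0_def)
  then have "?h absolutely_integrable_on (uminus ` {0..}) \<and> integral (uminus ` {0..}) ?h = bessel_K0 x"
    by (subst (asm) has_absolute_integral_change_of_variables_1'[where g = uminus and g' = "\<lambda>_. -1"])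
       (auto intro!: derivative_eq_intros)
  then have hm: "?h absolutely_integrable_on {..0}" "integral {..0} ?h = bessel_K0 x" by simp_all
  have "integral ({..0} \<union> {0..}) ?h = integral {..0} ?h + integral {0..} ?h"
  proof (rule Henstock_Kurzweil_Integration.integral_Un)
    have "{..0} \<inter> {0..} = {0::real}" by auto
    then show "negligible ({..0} \<inter> {0..} :: real set)" by simp
  qed (use hp hm(1) in \<open>auto intro: set_lebesgue_integral_eq_integral(1)\<close>)
  moreover have "{..0} \<union> {0..} = (UNIV :: real set)" by auto
  ultimately show ?thesis using h(2) hm(2) by (simp add: I_def x_def bessel_K0_def)
qed

text \<open>The product majorant makes the double series over (d, m) absolutely summable, so it may
  be summed by rows, by columns, or along n = d m. The Bessel series and the dual series both use
  it.\<close>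

lemma divisor_sums:
  fixes c :: "nat \<Rightarrow> nat \<Rightarrow> complex"
  assumes bound: "\<And>d m. norm (c (Suc d) (Suc m)) \<le> a d * b m"
    and a: "summable a" "\<And>d. a d \<ge> 0" and b: "summable b" "\<And>m. b m \<ge> (0::real)"
  obtains S where "(\<lambda>n. \<Sum>d | d dvd Suc n. c d (Suc n div d)) sums S"
    and "(\<lambda>m. \<Sum>d. c (Suc d) (Suc m)) sums S" and "(\<lambda>d. \<Sum>m. c (Suc d) (Suc m)) sums S"
proof -
  let ?f = "\<lambda>(d, m). c (Suc d) (Suc m)"
  have hs: "((\<lambda>d. a d) has_sum suminf a) UNIV" "((\<lambda>m. b m) has_sum suminf b) UNIV"
    using a b by (auto intro!: norm_summable_imp_has_sum summable_sums)
  have "(\<lambda>(d, m). a d * b m) summable_on UNIV \<times> UNIV"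
  proof (rule summable_on_SigmaI[where g = "\<lambda>d. a d * suminf b"])
    show "(\<lambda>d. a d * suminf b) summable_on UNIV"
      using hs(1) by (intro summable_on_cmult_left) (rule has_sum_imp_summable)
  qed (use a b hs in \<open>auto intro!: has_sum_cmult_right\<close>)
  then have "(\<lambda>x. norm (?f x)) summable_on UNIV \<times> UNIV"
    by (rule summable_on_comparison_test) (auto simp: bound)
  then have "?f summable_on UNIV \<times> UNIV" by (rule abs_summable_summable)
  then obtain S where S: "(?f has_sum S) (UNIV \<times> UNIV)" by (auto simp: summable_on_def)
  have row: "((\<lambda>m. c (Suc d) (Suc m)) has_sum (\<Sum>m. c (Suc d) (Suc m))) UNIV" for d
  proof (rule norm_summable_imp_has_sum)
    show "summable (\<lambda>m. norm (c (Suc d) (Suc m)))"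
      by (rule summable_comparison_test[OF _ summable_mult[OF b(1), of "a d"]]) (simp add: bound)
    then show "(\<lambda>m. c (Suc d) (Suc m)) sums (\<Sum>m. c (Suc d) (Suc m))"
      by (rule summable_sums[OF summable_norm_cancel])
  qed
  have col: "((\<lambda>d. c (Suc d) (Suc m)) has_sum (\<Sum>d. c (Suc d) (Suc m))) UNIV" for m
  proof (rule norm_summable_imp_has_sum)
    show "summable (\<lambda>d. norm (c (Suc d) (Suc m)))"
      by (rule summable_comparison_test[OF _ summable_mult2[OF a(1), of "b m"]]) (simp add: bound)
    then show "(\<lambda>d. c (Suc d) (Suc m)) sums (\<Sum>d. c (Suc d) (Suc m))"
      by (rule summable_sums[OF summable_norm_cancel])
  qed
  have 1: "(\<lambda>d. \<Sum>m. c (Suc d) (Suc m)) sums S"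
    by (rule has_sum_imp_sums, rule has_sum_SigmaD[OF S]) (use row in auto)
  have S': "((\<lambda>(m, d). ?f (d, m)) has_sum S) (UNIV \<times> UNIV)"
    using S by (subst (asm) has_sum_swap)
  have 2: "(\<lambda>m. \<Sum>d. c (Suc d) (Suc m)) sums S"
    by (rule has_sum_imp_sums, rule has_sum_SigmaD[OF S']) (use col in auto)
  have "((\<lambda>(n, d). c d (Suc n div d)) has_sum S) (SIGMA n:UNIV. {d. d dvd Suc n})
      \<longleftrightarrow> (?f has_sum S) (UNIV \<times> UNIV)"
  \<comment> \<open>Series are indexed from 0 while divisors and cofactors start at 1. The truncated
    subtractions are safe, since \<open>d\<close>, its cofactor and \<open>Suc n\<close> are
    positive.\<close>
  proof (rule has_sum_reindex_bij_witness[where j = "\<lambda>(n, d). (d - 1, Suc n div d - 1)" and i =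
      "\<lambda>(d, m). (Suc d * Suc m - 1, Suc d)"])
    fix x assume x: "x \<in> (SIGMA n:UNIV. {d. d dvd Suc n})"
    obtain n d where nd: "x = (n, d)" by (cases x)
    from x nd obtain m where m: "Suc n = d * m" by auto
    then have pos: "d > 0" "m > 0" by (auto intro: ccontr)
    have dm: "Suc n div d = m" "Suc (d - 1) = d" "Suc (m - 1) = m" "d * m - 1 = n"
      using m pos by (simp_all flip: m) (simp add: m)
    show "(case case x of (n, d) \<Rightarrow> (d - 1, Suc n div d - 1) of (d, m) \<Rightarrow> (Suc d *
        Suc m - 1, Suc d)) = x"
      unfolding nd prod.case dm ..
    show "(case case x of (n, d) \<Rightarrow> (d - 1, Suc n div d - 1) of (d, m) \<Rightarrow> c (Suc d)
        (Suc m)) = (case x of (n, d) \<Rightarrow> c d (Suc n div d))"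
      using m pos nd by simp
  next
    fix x :: "nat \<times> nat"
    obtain d m where x: "x = (d, m)" by (cases x)
    have dm: "Suc (Suc d * Suc m - 1) = Suc d * Suc m" by simp
    show "(case case x of (d, m) \<Rightarrow> (Suc d * Suc m - 1, Suc d) of (n, d) \<Rightarrow> (d - 1,
        Suc n div d - 1)) = x"
      unfolding x prod.case dm nonzero_mult_div_cancel_left[OF nat.distinct(2)] by simp
    show "(case x of (d, m) \<Rightarrow> (Suc d * Suc m - 1, Suc d)) \<in> (SIGMA n:UNIV. {d. d dvd Suc n})"
      unfolding x prod.case mem_Sigma_iff mem_Collect_eq dm by (simp del: mult_Suc mult_Suc_right)
  qed auto
  then have D: "((\<lambda>(n, d). c d (Suc n div d)) has_sum S) (SIGMA n:UNIV. {d. d dvd Suc n})" using S by blast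
  have 3: "(\<lambda>n. \<Sum>d | d dvd Suc n. c d (Suc n div d)) sums S"
    by (rule has_sum_imp_sums, rule has_sum_SigmaD[OF D]) (auto intro!: has_sum_finite)
  show ?thesis using that 1 2 3 by blast
qed

section \<open>The Bessel series as an integral\<close>

context even_primitive_character
begin

definition theta_integral :: "nat \<Rightarrow> real \<Rightarrow> complex" where
  "theta_integral k X = half_integral
     (\<lambda>u. char_moment k (of_real u) * of_real (1 / (exp (X / u) - 1) / u))"

text \<open>With n = d m, summation over \<open>d\<close> first rebuilds the moment in the integral
  representation of K0; summation over \<open>m\<close> is then a geometric series in exp(-X/u),
  whose value is the Bose factor.\<close>

lemma bessel_series:
  assumes "k \<ge> 1" "X > 0"
  shows "(\<lambda>n. sigma_chi k chi (Suc n) * of_real (2 * bessel_K0 (2 * sqrt (X * real (Suc n)))))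
      sums theta_integral k X"
proof -
  \<comment> \<open>The Bessel integral decays like (d m)^(-N), so against d^k there remains a
    summable d^(-2).\<close>
  define N where "N = k + 2"
  define E where "E \<alpha> \<beta> = half_integral (\<lambda>u. exp (- (\<alpha> * u) - \<beta> / u) /
      u)" for \<alpha> \<beta> :: real
  define B where "B = fact N * Gamma (real N)"
  have B: "B \<ge> 0" unfolding B_def using Gamma_real_pos[of "real N"] by (simp add: N_def)
  have E: "E \<alpha> \<beta> \<le> B / (\<alpha> * \<beta>) ^ N" if "\<alpha> > 0" "\<beta> > 0" for \<alpha> \<beta>
    unfolding E_def B_def using integral_bessel_le[OF that, of N] by (simp add: N_def)
  have E0: "E \<alpha> \<beta> \<ge> 0" for \<alpha> \<beta> unfolding E_def
    by (rule Bochner_Integration.integral_nonneg) (auto simp: space_restrict_space)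
  define c where "c d m = of_nat d ^ k * chi d * of_real (E (real d) (X * real m))" for d m
  obtain C where C: "C \<ge> 0" "\<And>u. u > 0 \<Longrightarrow> norm (char_moment k (of_real u)) \<le>
      C * exp (- u)"
    using char_moment_exp_bound[OF assms(1)] by blast
  have bound: "norm (of_nat (Suc d) ^ k * chi (Suc d)) * E (real (Suc d)) (X * real (Suc m))
      \<le> (B / X ^ N * inverse (real (Suc d) ^ 2)) * inverse (real (Suc m) ^ N)" for d m
  proof -
    let ?d = "real (Suc d)" and ?m = "real (Suc m)"
    have "norm (of_nat (Suc d) ^ k * chi (Suc d)) * E ?d (X * ?m) \<le> (?d ^ k * 1) * (B / (?d * (X * ?m)) ^ N)"
      using norm_chi_le[of "Suc d"] E[of ?d "X * ?m"] E0 assms(2)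
      by (intro mult_mono) (auto simp: norm_mult norm_power simp del: of_nat_Suc)
    also have "\<dots> = (B / X ^ N * inverse (?d ^ 2)) * inverse (?m ^ N)"
      using assms(2) by (simp add: N_def power_mult_distrib power_add power2_eq_square divide_simps del: of_nat_Suc)
    finally show ?thesis .
  qed
  have sa: "summable (\<lambda>d. B / X ^ N * inverse (real (Suc d) ^ 2))"
    by (intro summable_mult summable_Suc_iff[THEN iffD2] inverse_power_summable) simp
  have sb: "summable (\<lambda>m. inverse (real (Suc m) ^ N))"
    by (intro summable_Suc_iff[THEN iffD2] inverse_power_summable) (simp add: N_def)
  have cbound: "norm (c (Suc d) (Suc m)) \<le> (B / X ^ N * inverse (real (Suc d) ^ 2)) * inverse (real
      (Suc m) ^ N)" for d m
    using bound[of d m] E0 by (simp add: c_def norm_mult)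
  have B0: "B / X ^ N * inverse (real (Suc d) ^ 2) \<ge> 0" for d using B assms(2) by simp
  obtain S where S: "(\<lambda>n. \<Sum>d | d dvd Suc n. c d (Suc n div d)) sums S"
    "(\<lambda>m. \<Sum>d. c (Suc d) (Suc m)) sums S"
  proof (rule divisor_sums[OF cbound sa B0 sb])
    show "inverse (real (Suc m) ^ N) \<ge> 0" for m by simp
  qed (rule that)
  define J where "J m = half_integral (\<lambda>u. char_moment k (of_real u) * of_real (exp (- (X * real
      (Suc m) / u)) / u))" for m
  have inner: "(\<Sum>d. c (Suc d) (Suc m)) = J m" for m
  proof -
    let ?X = "X * real (Suc m)"
    let ?f = "\<lambda>d u. of_nat (Suc d) ^ k * chi (Suc d) * complex_of_real (exp (- (real (Suc d) * u)
        - ?X / u) / u)"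
    have X: "?X > 0" using assms(2) by simp
    have int: "integrable half_line (?f d)" for d
      using X by (intro integrable_mult_right integrable_of_real integrable_bessel) auto
    have val: "half_integral (?f d) = c (Suc d) (Suc m)" for d
      unfolding c_def E_def integral_complex_of_real[symmetric] integral_mult_right_zero ..
    have nrm: "half_integral (\<lambda>u. norm (?f d u)) = norm (of_nat (Suc d) ^ k * chi (Suc d)) * E
        (real (Suc d)) ?X" for d
      unfolding E_def integral_mult_right_zero[symmetric]
      by (rule integral_half_line_cong) (simp only: norm_mult norm_of_real, simp)
    have "summable (\<lambda>d. half_integral (\<lambda>u. norm (?f d u)))"
      unfolding nrm
      by (rule summable_comparison_test[OF _ summable_mult2[OF sa, of "inverse (real (Suc m) ^ N)"]])
         (use bound E0 in \<open>auto simp: abs_mult simp del: of_nat_Suc\<close>)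
    moreover have eq: "?f d u = of_nat (Suc d) ^ k * chi (Suc d) * exp (- of_nat (Suc d) * of_real u) *
        of_real (exp (- (?X / u)) / u)" for d u
    proof -
      have "exp (- (real (Suc d) * u) - ?X / u) / u = exp (- (real (Suc d) * u)) * (exp (- (?X / u)) / u)"
        by (simp add: exp_diff exp_minus divide_inverse)
      moreover have "complex_of_real (exp (- (real (Suc d) * u))) = exp (- of_nat (Suc d) * of_real u)"
        by (simp add: algebra_simps flip: exp_of_real)
      ultimately show ?thesis by (simp only: of_real_mult mult.assoc)
    qed
    have sn: "summable (\<lambda>d. norm (of_nat (Suc d) ^ k * chi (Suc d) * exp (- of_nat (Suc d) *
        complex_of_real u)))" if "u > 0" for u
      using summable_norm_char_moment[of "of_real u" k] that by (subst summable_Suc_iff) simp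
    have "summable (\<lambda>d. norm (?f d u))" if "u > 0" for u
      unfolding eq norm_mult[of _ "of_real (exp (- (?X / u)) / u)"]
      by (intro summable_mult2 sn that)
    moreover have sf: "(\<Sum>d. ?f d u) = char_moment k (of_real u) * of_real (exp (- (?X / u)) / u)" if
        "u > 0" for u
    proof -
      have "(\<lambda>d. of_nat (Suc d) ^ k * chi (Suc d) * exp (- of_nat (Suc d) * of_real u)) sums
          char_moment k (of_real u)"
        using sums_char_moment[of "of_real u" k] chi_0[OF nonprincipal] that by (subst sums_Suc_iff) simp
      from sums_mult2[OF this] show ?thesis unfolding eq by (rule sums_unique[symmetric])
    qed
    ultimately have "(\<lambda>d. half_integral (?f d)) sums half_integral (\<lambda>u. \<Sum>d. ?f d u)"
      using int by (intro sums_integral AE_I2) (auto simp: space_restrict_space)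
    also have "half_integral (\<lambda>u. \<Sum>d. ?f d u) = J m"
      unfolding J_def by (rule integral_half_line_cong[OF sf])
    finally show ?thesis unfolding val by (rule sums_unique[symmetric])
  qed
  have outer: "J sums theta_integral k X"
  proof -
    let ?g = "\<lambda>m u. char_moment k (of_real u) * complex_of_real (exp (- (X * real (Suc m) / u)) / u)"
    let ?w = "\<lambda>m u. C * (exp (- (1 * u) - X * real (Suc m) / u) / u)"
    have X: "X * real (Suc m) > 0" for m using assms(2) by simp
    have gw: "norm (?g m u) \<le> ?w m u" if "u > 0" for m u
    proof -
      have "norm (?g m u) = norm (char_moment k (of_real u)) * (exp (- (X * real (Suc m) / u)) / u)"
        using that by (simp only: norm_mult norm_of_real) simp
      also have "\<dots> \<le> C * exp (- u) * (exp (- (X * real (Suc m) / u)) / u)"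
        using C(2)[OF that] that by (intro mult_right_mono) auto
      also have "\<dots> = ?w m u" by (simp add: exp_diff exp_minus divide_inverse)
      finally show ?thesis .
    qed
    have w: "integrable half_line (?w m)" for m
      using X by (intro integrable_mult_right integrable_bessel) auto
    have mg: "?g m \<in> borel_measurable half_line" for m
      by (intro borel_measurable_times borel_measurable_half_line continuous_on_char_moment continuous_intros) auto
    have int: "integrable half_line (?g m)" for m
      by (rule integrable_half_line_bound[OF w mg gw])
    have "summable (\<lambda>m. half_integral (\<lambda>u. norm (?g m u)))"
    proof (rule summable_comparison_test)
      have "half_integral (\<lambda>u. norm (?g m u)) \<le> C * B / X ^ N * inverse (real (Suc m) ^ N)" for m
      proof -
        have "half_integral (\<lambda>u. norm (?g m u)) \<le> half_integral (?w m)"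
          by (rule integral_mono[OF integrable_norm[OF int] w]) (use gw in \<open>auto simp:
              space_restrict_space\<close>)
        also have "\<dots> = C * E 1 (X * real (Suc m))" unfolding E_def by (rule integral_mult_right_zero)
        also have "\<dots> \<le> C * (B / (1 * (X * real (Suc m))) ^ N)"
          using E[OF _ X, of 1] C by (intro mult_left_mono) auto
        also have "\<dots> = C * B / X ^ N * inverse (real (Suc m) ^ N)"
          by (simp add: power_mult_distrib divide_inverse del: of_nat_Suc)
        finally show ?thesis .
      qed
      then show "\<exists>M. \<forall>m\<ge>M. norm (half_integral (\<lambda>u. norm (?g m u))) \<le> C *
          B / X ^ N * inverse (real (Suc m) ^ N)"
        by (simp add: Bochner_Integration.integral_nonneg del: of_nat_Suc)
      show "summable (\<lambda>m. C * B / X ^ N * inverse (real (Suc m) ^ N))" by (intro summable_mult sb)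
    qed
    moreover have geo: "(\<lambda>m. exp (- (X * real (Suc m) / u)) / u) sums (1 / (exp (X / u) - 1) /
        u)" if "u > 0" for u
    proof -
      let ?r = "exp (- (X / u))"
      have r: "norm ?r < 1" using that assms(2) by simp
      have "(\<lambda>m. ?r * ?r ^ m) sums (?r * (1 / (1 - ?r)))"
        using r by (intro sums_mult geometric_sums)
      also have "?r * (1 / (1 - ?r)) = 1 / (exp (X / u) - 1)"
      proof -
        have "exp (X / u) \<noteq> 1" using that assms(2) by simp
        then show ?thesis by (simp add: exp_minus field_simps)
      qed
      also have "(\<lambda>m. ?r * ?r ^ m) = (\<lambda>m. exp (- (X * real (Suc m) / u)))"
        by (simp add: exp_of_nat_mult[symmetric] exp_add[symmetric] algebra_simps add_divide_distrib)
      finally show ?thesis by (rule sums_divide)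
    qed
    have "summable (\<lambda>m. norm (?g m u))" if "u > 0" for u
    proof -
      have "norm (?g m u) = norm (char_moment k (of_real u)) * (exp (- (X * real (Suc m) / u)) / u)" for m
        using that by (simp only: norm_mult norm_of_real) simp
      then show ?thesis using summable_mult[OF sums_summable[OF geo[OF that]]] by (simp only:)
    qed
    moreover have sf: "(\<Sum>m. ?g m u) = char_moment k (of_real u) * of_real (1 / (exp (X / u) - 1) /
        u)" if "u > 0" for u
      using sums_mult[OF sums_of_real[OF geo[OF that], where 'a = complex], of "char_moment k (of_real u)"]
      by (rule sums_unique[symmetric])
    ultimately have "(\<lambda>m. half_integral (?g m)) sums half_integral (\<lambda>u. \<Sum>m. ?g m u)"
      using int by (intro sums_integral AE_I2) (auto simp: space_restrict_space)
    also have "half_integral (\<lambda>u. \<Sum>m. ?g m u) = theta_integral k X"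
      unfolding theta_integral_def by (rule integral_half_line_cong[OF sf])
    finally show ?thesis by (simp add: J_def[abs_def])
  qed
  have "S = theta_integral k X"
    using S(2) outer unfolding inner by (rule sums_unique2)
  moreover have "(\<Sum>d | d dvd Suc n. c d (Suc n div d)) = sigma_chi k chi (Suc n) * of_real (2 *
      bessel_K0 (2 * sqrt (X * real (Suc n))))" for n
    unfolding sigma_chi_def sum_distrib_right
  proof (intro sum.cong refl)
    fix d assume "d \<in> {d. d dvd Suc n}"
    then obtain m where m: "Suc n = d * m" by auto
    then have pos: "d > 0" "m > 0" by (auto intro: ccontr)
    have "E (real d) (X * real m) = 2 * bessel_K0 (2 * sqrt (real d * (X * real m)))"
      unfolding E_def using pos assms(2) by (intro integral_bessel) auto
    moreover have "real d * (X * real m) = X * real (Suc n)" unfolding m by simp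
    moreover have "Suc n div d = m" using m pos by simp
    ultimately show "c d (Suc n div d) = of_nat d ^ k * chi d * of_real (2 * bessel_K0 (2 * sqrt (X * real (Suc n))))"
      by (simp add: c_def)
  qed
  ultimately show ?thesis using S(1) by simp
qed

end

section \<open>The transformation formula\<close>

text \<open>The exponent k + 1 is even, so the sign of the base is irrelevant and the power of i is
  real.\<close>

lemma i_power_odd:
  assumes "odd k"
  shows "1 / (\<i> * of_real x) ^ Suc k = (-1) ^ ((k + 1) div 2) / complex_of_real x ^ Suc k"
    and "1 / (- (\<i> * of_real x)) ^ Suc k = (-1) ^ ((k + 1) div 2) / complex_of_real x ^ Suc k"
proof -
  obtain j where j: "Suc k = 2 * j" using assms by (metis even_Suc dvdE)
  have "\<i> ^ Suc k = (-1) ^ j" unfolding j power_mult by simp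
  moreover have "(k + 1) div 2 = j" using j by simp
  moreover have "(- (\<i> * complex_of_real x)) ^ Suc k = (\<i> * of_real x) ^ Suc k"
    using assms by (simp del: power_Suc)
  moreover have "inverse ((-1) ^ j) = ((-1) ^ j :: complex)" by (simp flip: power_inverse)
  ultimately show "1 / (\<i> * of_real x) ^ Suc k = (-1) ^ ((k + 1) div 2) / complex_of_real x ^ Suc k"
    "1 / (- (\<i> * of_real x)) ^ Suc k = (-1) ^ ((k + 1) div 2) / complex_of_real x ^ Suc k"
    by (simp_all only: power_mult_distrib divide_inverse inverse_mult_distrib mult_1_left)
qed

section \<open>Odd order: kernel integrals, nonvanishing, and the dual series\<close>

context even_primitive_character
begin

text \<open>Otherwise the Fourier expansion would give \<open>chi 1 = 0\<close>.\<close>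

lemma gauss_sum_nonzero: "gauss_sum q chi \<noteq> 0"
  using chi_fourier[OF primitive, of 1] chi_1 by auto

text \<open>The moment of order k - 1, negated, is an antiderivative; it decays at infinity and, k -
  1 being even, vanishes at 0.\<close>

lemma integral_char_moment:
  assumes "odd k"
  shows "half_integral (\<lambda>u. char_moment k (of_real u)) = 0"
proof -
  have k: "k \<ge> 1" using assms by (cases k) auto
  obtain C where C: "C \<ge> 0" "\<And>u. u > 0 \<Longrightarrow> norm (char_moment k (of_real u)) \<le>
      C * exp (- u)"
    using char_moment_exp_bound[OF k] by blast
  obtain A where A: "\<And>u. u \<ge> 1 \<Longrightarrow> norm (char_moment (k - 1) (of_real u)) \<le> A * exp (- u)"
    using char_moment_exp_bound_ge_1 by blast
  have "half_integral (\<lambda>u. char_moment k (of_real u)) = - 0 - (- 0)"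
  proof (rule integral_half_line_FTC[where F = "\<lambda>u. - char_moment (k - 1) (of_real u)"])
    fix u :: real assume "u > 0"
    then have "(char_moment (k - 1) has_field_derivative - char_moment k (of_real u)) (at (of_real u))"
      using has_field_derivative_char_moment[of "of_real u" "k - 1"] k by simp
    then show "((\<lambda>u. - char_moment (k - 1) (of_real u)) has_vector_derivative char_moment k
        (of_real u)) (at u)"
      using has_vector_derivative_minus[OF has_vector_derivative_real_field] by fastforce
  next
    show "integrable half_line (\<lambda>u. char_moment k (of_real u))"
    proof (rule integrable_half_line_bound)
      show "integrable half_line (\<lambda>u. C * (u powr (1 - 1) * exp (- (1 * u))))"
        by (intro integrable_mult_right half_line_Gamma_real) auto
    qed (use C borel_measurable_half_line[OF continuous_on_char_moment] in auto)
    have "((\<lambda>u. char_moment (k - 1) (of_real u)) \<longlongrightarrow> 0) at_top"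
    proof (rule Lim_null_comparison)
      show "\<forall>\<^sub>F u in at_top. norm (char_moment (k - 1) (of_real u)) \<le> A * exp (- u)"
        using eventually_ge_at_top[of 1] by eventually_elim (rule A)
      show "((\<lambda>u. A * exp (- u)) \<longlongrightarrow> 0) at_top" by real_asymp
    qed
    then show "((\<lambda>u. - char_moment (k - 1) (of_real u)) \<longlongrightarrow> - 0) at_top" by
        (rule tendsto_minus)
    show "((\<lambda>u. - char_moment (k - 1) (of_real u)) \<longlongrightarrow> - 0) (at_right 0)"
      using assms by (intro tendsto_minus char_moment_even_tendsto) simp
  qed (rule continuous_on_char_moment)
  then show ?thesis by simp
qed

text \<open>The sign is i^(-k-1) for odd \<open>k\<close>, the factor that every pole
  contributes.\<close>

definition pole_const :: "nat \<Rightarrow> complex" where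
  "pole_const k = gauss_sum q chi / of_nat q * fact k * (-1) ^ ((k + 1) div 2)"

text \<open>Up to a power of 2 pi/q, a Hurwitz-type shift of the Dirichlet series of the conjugate
  character at k + 1.\<close>

definition shifted_sum :: "nat \<Rightarrow> real \<Rightarrow> complex" where
  "shifted_sum k b = (\<Sum>n. cnj (chi n) / of_real (pole n + b) ^ Suc k)"

lemma norm_shifted_term_le:
  assumes "b \<ge> 0"
  shows "norm (cnj (chi n) / of_real (pole n + b) ^ Suc k) \<le> 1 / pole n ^ Suc k"
proof (cases "n = 0")
  case True
  then show ?thesis using chi_0[OF nonprincipal] by (simp add: pole_def)
next
  case False
  have "norm (chi n) / (pole n + b) ^ Suc k \<le> 1 / pole n ^ Suc k"
    using norm_chi_le[of n] pole_pos[of n] False assms by (intro frac_le power_mono) auto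
  then show ?thesis using pole_pos[of n] False assms
    by (simp add: norm_divide norm_power del: power_Suc of_real_add)
qed

lemma summable_shifted:
  assumes "k \<ge> 1" "b \<ge> 0"
  shows "summable (\<lambda>n. cnj (chi n) / of_real (pole n + b) ^ Suc k)"
  by (rule summable_comparison_test[OF _ summable_pole_power[OF assms(1), of 1]])
     (use norm_shifted_term_le[OF assms(2)] in blast)

text \<open>Conjugate poles contribute equally at 0, because k + 1 is even. Combined with
  \<open>L_values\<close> this is the functional equation relating -k to k + 1.\<close>

lemma pole_sum_0:
  assumes "odd k"
  shows "pole_sum k 0 = 2 * pole_const k * shifted_sum k 0"
proof -
  have k: "k \<ge> 1" using assms by (cases k) auto
  have "cnj (chi n) * pole_term k 0 n = (2 * (-1) ^ ((k + 1) div 2)) * (cnj (chi n) / of_real (pole n +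
      0) ^ Suc k)" for n
    unfolding pole_term_def using i_power_odd[OF assms, of "pole n"] by (simp del: power_Suc)
  then have "(\<Sum>n. cnj (chi n) * pole_term k 0 n) = (2 * (-1) ^ ((k + 1) div 2)) * shifted_sum k 0"
    unfolding shifted_sum_def by (simp only: suminf_mult[OF summable_shifted[OF k order_refl]])
  then show ?thesis by (simp add: pole_sum_def pole_const_def)
qed

text \<open>Each conjugate pair of poles is one Poisson integral over the whole line, evaluated at i
  b; this moves the pole from i c to i (b + c).\<close>

lemma integral_char_moment_kernel:
  assumes "odd k" "b > 0"
  shows "half_integral (\<lambda>u. char_moment k (of_real u) * of_real (b / (b\<^sup>2 + u\<^sup>2)))
    = of_real pi * pole_const k * shifted_sum k b"
proof -
  have k: "k \<ge> 1" using assms by (cases k) auto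
  let ?K = "\<lambda>u. b / (b\<^sup>2 + u\<^sup>2)"
  let ?f = "\<lambda>n u. cnj (chi n) * pole_term k (of_real u) n * complex_of_real (?K u)"
  have pos: "b\<^sup>2 + u\<^sup>2 > 0" for u using assms(2) by (intro add_pos_nonneg) auto
  have Kint: "integrable half_line ?K" "half_integral ?K = pi / 2"
    using half_line_cauchy_kernel[OF assms(2)] assms(2)
      integrable_mult_right[of b half_line "\<lambda>u. 1 / (b\<^sup>2 + u\<^sup>2)"]
      integral_mult_right_zero[of half_line b "\<lambda>u. 1 / (b\<^sup>2 + u\<^sup>2)"] by simp_all
  have trm: "integrable half_line (?f n) \<and>
    half_integral (?f n) = of_real pi * (-1) ^ ((k + 1) div 2) * (cnj (chi n) / of_real (pole n + b) ^ Suc k)" for n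
  proof (cases "n = 0")
    case True
    then show ?thesis using chi_0[OF nonprincipal] by simp
  next
    case False
    then have c: "pole n > 0" using pole_pos by simp
    let ?g = "symmetrize (\<lambda>u. of_real (2 * b) / ((complex_of_real u + \<i> * of_real (pole n)) ^
        Suc k * of_real (b\<^sup>2 + u\<^sup>2)))"
    \<comment> \<open>Replacing u by -u leads to the conjugate pole, without a sign because k + 1 is
      even. The factor 1/2 compares \<open>2 * b\<close> with \<open>b\<close>.\<close>
    have eq: "?f n u = cnj (chi n) / 2 * ?g u" for u
    proof -
      have "(- complex_of_real u + \<i> * of_real (pole n)) ^ Suc k = (- (complex_of_real u - \<i> *
          of_real (pole n))) ^ Suc k"
        by simp
      also have "\<dots> = (complex_of_real u - \<i> * of_real (pole n)) ^ Suc k"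
        by (rule power_minus_even) (use assms(1) in simp)
      finally have "?g u = of_real (2 * b) / ((complex_of_real u + \<i> * of_real (pole n)) ^ Suc k *
          of_real (b\<^sup>2 + u\<^sup>2))
          + of_real (2 * b) / ((complex_of_real u - \<i> * of_real (pole n)) ^ Suc k * of_real (b\<^sup>2
              + u\<^sup>2))"
        unfolding symmetrize_def by (simp del: power_Suc)
      moreover have "x * (1 / p + 1 / m) * complex_of_real (b / D) = x / 2 * (of_real (2 * b) / (p *
          of_real D) + of_real (2 * b) / (m * of_real D))" for x p m D
        by (simp add: distrib_left distrib_right mult_ac)
      ultimately show ?thesis unfolding pole_term_def by (simp only:)
    qed
    note P = half_line_poisson[OF assms(2) c, of "Suc k"]
    have int: "integrable half_line (?f n)" unfolding eq using P(1) by (rule integrable_mult_right)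
    have "half_integral (?f n) = cnj (chi n) / 2 * (2 * of_real pi / (\<i> * of_real (b + pole n)) ^ Suc k)"
      unfolding eq integral_mult_right_zero P(2) ..
    also have "\<dots> = of_real pi * cnj (chi n) * (1 / (\<i> * of_real (pole n + b)) ^ Suc k)"
      by (simp add: add.commute del: power_Suc of_real_add)
    finally have "half_integral (?f n) = of_real pi * (-1) ^ ((k + 1) div 2) * (cnj (chi n) / of_real
        (pole n + b) ^ Suc k)"
      unfolding i_power_odd(1)[OF assms(1)] by (simp add: mult_ac del: power_Suc of_real_add)
    with int show ?thesis ..
  qed
  note trm1 = trm[THEN conjunct1] and trm2 = trm[THEN conjunct2]
  have le: "norm (?f n u) \<le> 2 / pole n ^ Suc k * ?K u" if "u > 0" for n u
  proof -
    have "norm (complex_of_real (?K u)) = ?K u"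
      using pos[of u] assms(2) by (simp only: norm_of_real) simp
    then show ?thesis unfolding norm_mult[of _ "complex_of_real (?K u)"]
      using norm_pole_term_le[of u n k] that pos[of u] assms(2)
      by (metis (no_types, lifting) mult_right_mono norm_ge_zero less_imp_le)
  qed
  have "summable (\<lambda>n. half_integral (\<lambda>u. norm (?f n u)))"
  proof (rule summable_comparison_test)
    have "half_integral (\<lambda>u. norm (?f n u)) \<le> pi / pole n ^ Suc k" for n
    proof -
      have "half_integral (\<lambda>u. norm (?f n u)) \<le> half_integral (\<lambda>u. 2 / pole n ^ Suc k * ?K u)"
        by (rule integral_mono[OF integrable_norm[OF trm1] integrable_mult_right[OF Kint(1)]])
           (use le in \<open>auto simp: space_restrict_space simp del: power_Suc times_divide_eq_right\<close>)
      also have "\<dots> = 2 / pole n ^ Suc k * (pi / 2)" unfolding integral_mult_right_zero Kint(2) ..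
      finally show ?thesis by simp
    qed
    then show "\<exists>N. \<forall>n\<ge>N. norm (half_integral (\<lambda>u. norm (?f n u))) \<le> pi /
        pole n ^ Suc k"
      by (simp add: Bochner_Integration.integral_nonneg del: power_Suc)
    show "summable (\<lambda>n. pi / pole n ^ Suc k)" by (rule summable_pole_power[OF k])
  qed
  moreover have "summable (\<lambda>n. norm (?f n u))" if "u > 0" for u
    unfolding norm_mult[of _ "complex_of_real (?K u)"]
    by (intro summable_mult2 summable_pole_term k) (use that in simp)
  ultimately have "(\<lambda>n. half_integral (?f n)) sums half_integral (\<lambda>u. \<Sum>n. ?f n u)"
    using trm1 by (intro sums_integral AE_I2) (auto simp: space_restrict_space)
  then have "(\<Sum>n. half_integral (?f n)) = half_integral (\<lambda>u. \<Sum>n. ?f n u)"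
    by (rule sums_unique[symmetric])
  moreover have "(\<Sum>n. half_integral (?f n)) = of_real pi * (-1) ^ ((k + 1) div 2) * shifted_sum k b"
    unfolding trm2 shifted_sum_def using assms(2)
    by (intro suminf_mult summable_shifted[OF k]) simp
  moreover have "half_integral (\<lambda>u. char_moment k (of_real u) * of_real (?K u)) =
      gauss_sum q chi / of_nat q * fact k * half_integral (\<lambda>u. \<Sum>n. ?f n u)"
    unfolding integral_mult_right_zero[symmetric]
  proof (rule integral_half_line_cong)
    fix u :: real assume u: "u > 0"
    have "(\<Sum>n. ?f n u) = (\<Sum>n. cnj (chi n) * pole_term k (of_real u) n) * complex_of_real (?K u)"
      by (rule suminf_mult2[symmetric], rule summable_norm_cancel, rule summable_pole_term[OF k]) (use u in simp)
    then show "char_moment k (of_real u) * of_real (?K u) = gauss_sum q chi / of_nat q * fact k * (\<Sum>n. ?f n u)"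
      unfolding char_moment_eq_pole_sum[OF k u] pole_sum_def by (simp only: mult.assoc)
  qed
  ultimately show ?thesis by (simp add: pole_const_def)
qed

text \<open>After rescaling, the first term of the Dirichlet series is 1, while the others add up to
  at most 3/4 in absolute value, by comparison with the sum of 1/n^2 over n >= 2.\<close>

lemma shifted_sum_0_nonzero:
  assumes "k \<ge> 1"
  shows "shifted_sum k 0 \<noteq> 0"
proof
  assume 0: "shifted_sum k 0 = 0"
  let ?c = "2 * pi / real q"
  have c: "?c > 0" using q_pos by simp
  have "(\<lambda>n. cnj (chi n) / of_real (pole n + 0) ^ Suc k) sums 0"
    using summable_sums[OF summable_shifted[OF assms order_refl]] 0 by (simp add: shifted_sum_def)
  then have "(\<lambda>n. of_real ?c ^ Suc k * (cnj (chi n) / of_real (pole n + 0) ^ Suc k)) sums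
      (of_real ?c ^ Suc k * 0)"
    by (rule sums_mult)
  moreover have "of_real ?c ^ Suc k * (cnj (chi n) / of_real (pole n + 0) ^ Suc k) = cnj (chi n) / of_nat
      n ^ Suc k" for n
  proof -
    have "complex_of_real (pole n + 0) = of_real ?c * of_nat n" by (simp add: pole_def)
    moreover have "of_real ?c ^ Suc k \<noteq> (0::complex)" using c by (metis of_real_eq_0_iff
        less_irrefl power_not_zero)
    ultimately show ?thesis
      by (simp only: power_mult_distrib times_divide_eq_right mult_divide_mult_cancel_left not_False_eq_True)
  qed
  ultimately have "(\<lambda>n. cnj (chi n) / of_nat n ^ Suc k) sums 0" by (simp only: mult_zero_right)
  then have "(\<lambda>n. cnj (chi (n + 2)) / of_nat (n + 2) ^ Suc k) sums (0 - (\<Sum>n<2. cnj (chi n) /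
      of_nat n ^ Suc k))"
    by (rule sums_split_initial_segment)
  then have s: "(\<lambda>n. cnj (chi (n + 2)) / of_nat (n + 2) ^ Suc k) sums - 1"
    using chi_0[OF nonprincipal] chi_1 by (simp add: numeral_2_eq_2)
  have "(\<lambda>n. 1 / real (Suc n) - 1 / real (Suc (Suc n))) sums (1 / real (Suc 0) - 0)"
    by (rule telescope_sums'[of "\<lambda>n. 1 / real (Suc n)"]) real_asymp
  then have t: "(\<lambda>n. 1 / real (Suc n) - 1 / real (Suc (Suc n))) sums 1" by simp
  \<comment> \<open>The plain telescoping majorant has sum exactly 1, which is not enough. Its first
    term 1/2 is lowered to 1/4 = 1/2^2, which brings the total to 3/4.\<close>
  have "(\<lambda>n. (1 / real (Suc n) - 1 / real (Suc (Suc n))) - (if n = 0 then 1 / 4 else 0)) sums (1 - 1 / 4)"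
    using sums_diff[OF t sums_single[of 0 "\<lambda>_. 1 / 4 :: real"]] by (simp cong: if_cong)
  then have t': "(\<lambda>n. (1 / real (Suc n) - 1 / real (Suc (Suc n))) - (if n = 0 then 1 / 4 else 0))
      sums (3 / 4)" by simp
  have "norm (cnj (chi (n + 2)) / of_nat (n + 2) ^ Suc k) \<le> (1 / real (Suc n) - 1 / real (Suc (Suc
      n))) - (if n = 0 then 1 / 4 else 0)" for n
  proof -
    have "norm (cnj (chi (n + 2)) / of_nat (n + 2) ^ Suc k) = norm (chi (n + 2)) / real (n + 2) ^ Suc k"
      by (simp only: norm_divide norm_power complex_mod_cnj norm_of_nat)
    also have "\<dots> \<le> 1 / real (n + 2) ^ 2"
      using norm_chi_le[of "n + 2"] assms by (intro frac_le power_increasing) auto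
    also have "\<dots> \<le> (1 / real (Suc n) - 1 / real (Suc (Suc n))) - (if n = 0 then 1 / 4 else 0)"
    proof (cases "n = 0")
      case False
      have "1 / (x + 2) ^ 2 \<le> 1 / (x + 1) - 1 / (x + 2)" if "x \<ge> 0" for x :: real
        using that by (simp add: divide_simps) (simp add: power2_eq_square algebra_simps)
      from this[of "real n"] show ?thesis using False by (simp add: add.commute)
    qed simp
    finally show ?thesis .
  qed
  then have "norm (- 1 :: complex) \<le> 3 / 4" by (rule norm_sums_le[OF s t'])
  then show False by simp
qed

text \<open>Since division by 0 yields 0, the quotient L'/L in the final formula carries the value
  L'(-k) only because L(-k) is not 0.\<close>

lemma L_nonzero:
  assumes "odd k"
  shows "dirichlet_L chi (- of_nat k) \<noteq> 0"
proof -
  have k: "k \<ge> 1" using assms by (cases k) auto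
  show ?thesis
    unfolding L_values(1)[OF k, symmetric] pole_sum_0[OF assms]
    using shifted_sum_0_nonzero[OF k] gauss_sum_nonzero q_pos by (simp add: pole_const_def)
qed

text \<open>Writing r for \<open>Suc r\<close>, the shift b = 2 pi y/(q r) gives pole m + b = (2
  pi/(q r)) (r m + y). The bracket depends only on the product n = r m, so r becomes the divisor; of
  its power r^(k+1), the division by r leaves r^k.\<close>

lemma dual_series:
  assumes "odd k" "y > 0"
  defines "T \<equiv> \<lambda>n. 1 / of_nat n ^ (k + 1) - 1 / (of_nat n + of_real y) ^ (k + 1) :: complex"
  obtains S where "(\<lambda>n. sigma_bar_chi k (\<lambda>m. cnj (chi m)) (Suc n) * T (Suc n)) sums S"
    and "(\<lambda>r. (shifted_sum k 0 - shifted_sum k (2 * pi * y / (real q * real (Suc r)))) / of_nat (Suc r))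
      sums (of_real (real q / (2 * pi)) ^ (k + 1) * S)"
proof -
  have k: "k \<ge> 1" using assms by (cases k) auto
  define c where "c d m = of_nat d ^ k * cnj (chi m) * T (d * m)" for d m
  \<comment> \<open>The difference in \<open>T\<close> gains one power of the product d m, and
    d^k/(d m)^(k+2) is summable in both variables.\<close>
  have bound: "norm (c (Suc d) (Suc m)) \<le> (real (k + 1) * y * inverse (real (Suc d) ^ 2)) * inverse
      (real (Suc m) ^ (k + 2))" for d m
  proof -
    let ?d = "real (Suc d)" and ?m = "real (Suc m)"
    have "norm (T (Suc d * Suc m)) \<le> real (k + 1) * norm (complex_of_nat (Suc d * Suc m) - (of_nat
        (Suc d * Suc m) + of_real y))
        / (?d * ?m) ^ Suc (k + 1)"
      unfolding T_def
    proof (rule norm_inverse_power_diff_le)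
      have "norm (complex_of_nat (Suc d * Suc m) + of_real y) = norm (complex_of_real (?d * ?m + y))"
        by (simp only: of_real_add of_real_mult of_real_of_nat_eq of_nat_mult)
      also have "\<dots> = ?d * ?m + y" using assms(2) by (simp only: norm_of_real) (simp add:
          add_nonneg_nonneg del: of_nat_Suc)
      finally show "?d * ?m \<le> norm (complex_of_nat (Suc d * Suc m) + of_real y)" using assms(2) by simp
      show "?d * ?m \<le> norm (complex_of_nat (Suc d * Suc m))" by (simp only: norm_of_nat) (simp only:
          of_nat_mult order_refl)
    qed simp
    also have "\<dots> = real (k + 1) * y / (?d * ?m) ^ (k + 2)" using assms(2) by simp
    finally have T: "norm (T (Suc d * Suc m)) \<le> real (k + 1) * y / (?d * ?m) ^ (k + 2)" .
    have "norm (c (Suc d) (Suc m)) \<le> (?d ^ k * 1) * (real (k + 1) * y / (?d * ?m) ^ (k + 2))"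
      unfolding c_def norm_mult[of _ "T _"] using norm_chi_le[of "Suc m"] T
      by (intro mult_mono) (auto simp: norm_mult norm_power simp del: of_nat_Suc)
    also have "\<dots> = (real (k + 1) * y * inverse (?d ^ 2)) * inverse (?m ^ (k + 2))"
      by (simp add: power_mult_distrib power_add power2_eq_square divide_simps del: of_nat_Suc)
    finally show ?thesis .
  qed
  have sa: "summable (\<lambda>d. real (k + 1) * y * inverse (real (Suc d) ^ 2))"
    by (intro summable_mult summable_Suc_iff[THEN iffD2] inverse_power_summable) simp
  have sb: "summable (\<lambda>m. inverse (real (Suc m) ^ (k + 2)))"
    by (intro summable_Suc_iff[THEN iffD2] inverse_power_summable) simp
  have a0: "real (k + 1) * y * inverse (real (Suc d) ^ 2) \<ge> 0" for d using assms(2) by simp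
  have b0: "inverse (real (Suc m) ^ (k + 2)) \<ge> 0" for m by simp
  obtain S where S: "(\<lambda>n. \<Sum>d | d dvd Suc n. c d (Suc n div d)) sums S"
    "(\<lambda>d. \<Sum>m. c (Suc d) (Suc m)) sums S"
    by (rule divisor_sums[OF bound sa a0 sb b0]) (rule that)
  have 1: "(\<Sum>d | d dvd Suc n. c d (Suc n div d)) = sigma_bar_chi k (\<lambda>m. cnj (chi m)) (Suc n)
      * T (Suc n)" for n
    unfolding sigma_bar_chi_def sum_distrib_right
    by (intro sum.cong refl) (auto simp: c_def)
  have 2: "of_real (real q / (2 * pi)) ^ (k + 1) * (\<Sum>m. c (Suc r) (Suc m))
      = (shifted_sum k 0 - shifted_sum k (2 * pi * y / (real q * real (Suc r)))) / of_nat (Suc r)" for r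
  proof -
    let ?r = "real (Suc r)"
    let ?b = "2 * pi * y / (real q * ?r)"
    have b: "?b \<ge> 0" using assms(2) by simp
    let ?h = "\<lambda>n. (cnj (chi n) / of_real (pole n + 0) ^ Suc k - cnj (chi n) / of_real (pole n +
        ?b) ^ Suc k) / of_nat (Suc r)"
    have "?h sums ((shifted_sum k 0 - shifted_sum k ?b) / of_nat (Suc r))"
      unfolding shifted_sum_def by (intro sums_divide sums_diff summable_sums summable_shifted k b order_refl)
    moreover have "?h 0 = 0" using chi_0[OF nonprincipal] by simp
    ultimately have H: "(\<lambda>m. ?h (Suc m)) sums ((shifted_sum k 0 - shifted_sum k ?b) / of_nat (Suc r))"
      by (subst sums_Suc_iff) (simp only: add_0_right)
    have "?h (Suc m) = of_real (real q / (2 * pi)) ^ (k + 1) * c (Suc r) (Suc m)" for m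
    proof -
      let ?m = "real (Suc m)" and ?g = "2 * pi / (real q * ?r)"
      have g: "?g > 0" using q_pos by simp
      have p0: "pole (Suc m) + 0 = ?g * (?r * ?m)" and p1: "pole (Suc m) + ?b = ?g * (?r * ?m + y)"
        using q_pos by (simp_all add: pole_def field_simps del: of_nat_Suc)
      have "?h (Suc m) = cnj (chi (Suc m)) * (1 / of_real (?g * (?r * ?m)) ^ (k + 1) - 1 / of_real (?g *
          (?r * ?m + y)) ^ (k + 1)) / of_nat (Suc r)"
        unfolding p0 p1 by (simp only: Suc_eq_plus1[symmetric, of k] right_diff_distrib
            times_divide_eq_right mult_1_right)
      also have "\<dots> = cnj (chi (Suc m)) * (T (Suc r * Suc m) / of_real ?g ^ (k + 1)) / of_nat (Suc r)"
      proof -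
        have "1 / complex_of_real (?g * a) ^ (k + 1) = (1 / of_real a ^ (k + 1)) / of_real ?g ^ (k + 1)" for a
          by (simp only: of_real_mult power_mult_distrib divide_divide_eq_left mult.commute)
        moreover have "complex_of_real (?r * ?m) = of_nat (Suc r * Suc m)" "complex_of_real (?r * ?m + y)
            = of_nat (Suc r * Suc m) + of_real y"
          by (simp_all only: of_real_mult of_real_add of_real_of_nat_eq of_nat_mult)
        ultimately show ?thesis unfolding T_def by (simp only: diff_divide_distrib)
      qed
      also have "\<dots> = of_real (real q / (2 * pi)) ^ (k + 1) * c (Suc r) (Suc m)"
      proof -
        have "1 / complex_of_real ?g ^ (k + 1) = of_real (real q / (2 * pi)) ^ (k + 1) * of_nat (Suc r) ^ (k + 1)"
          using q_pos by (simp add: power_mult_distrib power_divide del: of_nat_Suc power_Suc)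
        then have "T (Suc r * Suc m) / of_real ?g ^ (k + 1) = T (Suc r * Suc m) * (of_real (real q / (2 *
            pi)) ^ (k + 1) * of_nat (Suc r) ^ (k + 1))"
          by (metis divide_inverse inverse_eq_divide)
        then show ?thesis unfolding c_def by (simp del: of_nat_Suc)
      qed
      finally show ?thesis .
    qed
    then have H': "(\<lambda>m. of_real (real q / (2 * pi)) ^ (k + 1) * c (Suc r) (Suc m)) sums
        ((shifted_sum k 0 - shifted_sum k ?b) / of_nat (Suc r))"
      using H by (simp only:)
    have "summable (\<lambda>m. c (Suc r) (Suc m))"
      by (rule summable_comparison_test[OF _ summable_mult[OF sb, of "real (k + 1) * y * inverse (real
          (Suc r) ^ 2)"]])
         (use bound in blast)
    then have "(\<lambda>m. of_real (real q / (2 * pi)) ^ (k + 1) * c (Suc r) (Suc m)) sums (of_real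
        (real q / (2 * pi)) ^ (k + 1) * (\<Sum>m. c (Suc r) (Suc m)))"
      by (intro sums_mult summable_sums)
    from sums_unique2[OF this H'] show ?thesis .
  qed
  show ?thesis
  proof (rule that)
    show "(\<lambda>n. sigma_bar_chi k (\<lambda>m. cnj (chi m)) (Suc n) * T (Suc n)) sums S"
      using S(1) unfolding 1 .
    show "(\<lambda>r. (shifted_sum k 0 - shifted_sum k (2 * pi * y / (real q * real (Suc r)))) / of_nat (Suc r))
      sums (of_real (real q / (2 * pi)) ^ (k + 1) * S)"
      using sums_mult[OF S(2), of "of_real (real q / (2 * pi)) ^ (k + 1)"] unfolding 2 .
  qed
qed

text \<open>Euler's constant from the harmonic numbers and the one inside
  \<open>regularized_moment\<close> have the same sign and add up to the factor 2.\<close>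

lemma theta_integral_eq:
  assumes "odd k" "X > 0"
    and "(\<lambda>r. (shifted_sum k 0 - shifted_sum k (X / (2 * pi * real (Suc r)))) / of_nat (Suc r)) sums W"
  shows "theta_integral k X = dirichlet_L chi (- of_nat k) / 2 * (2 * euler_mascheroni + of_real (ln (X / (2 * pi))))
    - deriv (dirichlet_L chi) (- of_nat k) / 2 - pole_const k * W"
proof -
  have k: "k \<ge> 1" using assms by (cases k) auto
  obtain C where C: "C \<ge> 0" "\<And>u. u > 0 \<Longrightarrow> norm (char_moment k (of_real u)) \<le>
      C * exp (- u)"
    using char_moment_exp_bound[OF k] by blast
  obtain C' where C': "C' \<ge> 0" "\<And>u. u > 0 \<Longrightarrow> norm (char_moment k (of_real u) -
      pole_sum k 0) \<le> C' * u"
    using char_moment_lipschitz_0[OF k] by blast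
  interpret poisson_data "\<lambda>u. char_moment k (of_real u)" "pole_sum k 0" C C' X
    by unfold_locales (use assms C C' continuous_on_char_moment integral_char_moment in auto)
  have node: "X / (2 * pi * real (Suc r)) = node r" for r by (simp add: node_def)
  have "(\<lambda>r. of_real pi * pole_const k * ((shifted_sum k 0 - shifted_sum k (X / (2 * pi * real
      (Suc r)))) / of_nat (Suc r)))
      sums (of_real pi * pole_const k * W)"
    by (intro sums_mult assms)
  also have "(\<lambda>r. of_real pi * pole_const k * ((shifted_sum k 0 - shifted_sum k (X / (2 * pi *
      real (Suc r)))) / of_nat (Suc r)))
     = (\<lambda>r. (pole_sum k 0 * of_real (pi / 2) - half_integral (\<lambda>u. char_moment k (of_real
         u) * of_real (kernel r u))) / of_nat (Suc r))"
    unfolding kernel_def integral_char_moment_kernel[OF assms(1) node_pos] pole_sum_0[OF assms(1)] node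
    by (simp add: right_diff_distrib mult_ac del: of_nat_Suc)
  finally have "of_real pi * pole_const k * W = pole_sum k 0 * of_real (pi / 2 * (euler_mascheroni + ln
      (X / (2 * pi))))
      - of_real pi * bose_integral - of_real (pi / 2) * regularized"
    by (rule poisson_summation)
  moreover have "bose_integral = theta_integral k X"
    by (simp add: bose_integral_def theta_integral_def bose_def)
  moreover have "regularized = regularized_moment k"
    by (simp add: regularized_def regularized_moment_def)
  moreover have "complex_of_real euler_mascheroni = euler_mascheroni" by simp
  ultimately have "of_real pi * (pole_const k * W) = of_real pi *
    (dirichlet_L chi (- of_nat k) / 2 * (2 * euler_mascheroni + of_real (ln (X / (2 * pi))))
      - deriv (dirichlet_L chi) (- of_nat k) / 2 - theta_integral k X)"
    unfolding L_values[OF k] by (simp add: algebra_simps)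
  then have "pole_const k * W = dirichlet_L chi (- of_nat k) / 2 * (2 * euler_mascheroni + of_real (ln (X
      / (2 * pi))))
      - deriv (dirichlet_L chi) (- of_nat k) / 2 - theta_integral k X"
    by simp
  then show ?thesis by simp
qed

end

theorem theorem2p6:
  fixes k q :: nat and chi :: "nat \<Rightarrow> complex" and a x :: real
  assumes "odd k"
    and "dirichlet_char q chi" and "\<not> principal_char q chi"
    and "even_char q chi" and "primitive_char q chi"
    and "a > 0" and "x > 0"
  shows "summable (\<lambda>n. sigma_bar_chi k (\<lambda>m. cnj (chi m)) (Suc n) *
             (1 / of_nat (Suc n) ^ (k + 1)
              - 1 / (of_nat (Suc n) + of_real (a\<^sup>2 * of_nat q * x / (16 * pi\<^sup>2))) ^ (k + 1)))
    \<and> (\<lambda>n. sigma_chi k chi (Suc n) * of_real (bessel_K0 (a * sqrt (of_nat (Suc n) * x))))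
      sums
      (- dirichlet_L chi (- of_nat k) / 4 *
          (of_real (ln (8 * pi / a\<^sup>2))
           + deriv (dirichlet_L chi) (- of_nat k) / dirichlet_L chi (- of_nat k)
           - 2 * euler_mascheroni)
       + dirichlet_L chi (- of_nat k) / 4 * of_real (ln x)
       + (-1) ^ ((k - 1) div 2) * of_nat (fact k) * of_nat q ^ k
           / (2 * (2 * of_real pi) ^ (k + 1)) * gauss_sum q chi
         * (\<Sum>n. sigma_bar_chi k (\<lambda>m. cnj (chi m)) (Suc n) *
             (1 / of_nat (Suc n) ^ (k + 1)
              - 1 / (of_nat (Suc n) + of_real (a\<^sup>2 * of_nat q * x / (16 * pi\<^sup>2))) ^ (k + 1))))"
proof -
  interpret even_primitive_character q chi
    by unfold_locales (use assms in auto)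
  have k: "k \<ge> 1" using assms(1) by (cases k) auto
  \<comment> \<open>\<open>X\<close> makes the argument 2 sqrt(X n) equal to a sqrt(n x). The shift
    \<open>y\<close> is then X q/(4 pi^2), so that the shifts in the dual series are the points X/(2
    pi r).\<close>
  define X where "X = a\<^sup>2 * x / 4"
  define y where "y = a\<^sup>2 * of_nat q * x / (16 * pi\<^sup>2)"
  have X: "X > 0" and y: "y > 0" using assms q_pos by (auto simp: X_def y_def)
  have yX: "2 * pi * y / (real q * real (Suc r)) = X / (2 * pi * real (Suc r))" for r
    using q_pos by (simp add: X_def y_def power2_eq_square divide_simps del: of_nat_Suc)
  let ?L = "dirichlet_L chi (- of_nat k)" and ?L' = "deriv (dirichlet_L chi) (- of_nat k)"
  let ?s = "\<lambda>n. sigma_bar_chi k (\<lambda>m. cnj (chi m)) (Suc n) *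
     (1 / of_nat (Suc n) ^ (k + 1) - 1 / (of_nat (Suc n) + of_real y) ^ (k + 1))"
  obtain S where S: "?s sums S"
    "(\<lambda>r. (shifted_sum k 0 - shifted_sum k (X / (2 * pi * real (Suc r)))) / of_nat (Suc r))
      sums (of_real (real q / (2 * pi)) ^ (k + 1) * S)"
    using dual_series[OF assms(1) y] unfolding yX by blast
  have "(\<lambda>n. sigma_chi k chi (Suc n) * of_real (2 * bessel_K0 (2 * sqrt (X * real (Suc n)))) / 2)
      sums (theta_integral k X / 2)"
    by (intro sums_divide bessel_series k X)
  moreover have "2 * sqrt (X * real (Suc n)) = a * sqrt (real (Suc n) * x)" for n
  proof -
    have "X * real (Suc n) = (a / 2)\<^sup>2 * (real (Suc n) * x)" by (simp add: X_def power_divide)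
    then show ?thesis using assms(6) by (simp only: real_sqrt_mult real_sqrt_abs)
  qed
  ultimately have main: "(\<lambda>n. sigma_chi k chi (Suc n) * of_real (bessel_K0 (a * sqrt (of_nat (Suc
      n) * x)))) sums (theta_integral k X / 2)"
    by simp
  \<comment> \<open>This sign turns the minus before \<open>pole_const\<close> in
    \<open>theta_integral_eq\<close> into the plus of the formula.\<close>
  have sgn: "(-1) ^ ((k + 1) div 2) = - ((-1) ^ ((k - 1) div 2) :: complex)"
    using assms(1) by (auto elim!: oddE)
  have const: "pole_const k * of_real (real q / (2 * pi)) ^ (k + 1) / 2 =
      - ((-1) ^ ((k - 1) div 2) * of_nat (fact k) * of_nat q ^ k / (2 * (2 * of_real pi) ^ (k + 1)) *
          gauss_sum q chi)"
    unfolding pole_const_def sgn using q_pos by (simp add: power_divide field_simps)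
  have ln: "ln (X / (2 * pi)) = ln x - ln (8 * pi / a\<^sup>2)"
  proof -
    have "X / (2 * pi) = x / (8 * pi / a\<^sup>2)" by (simp add: X_def)
    then show ?thesis using assms(6,7) ln_div[of x "8 * pi / a\<^sup>2"] by (simp only:) simp
  qed
  have "theta_integral k X / 2 = ?L / 4 * (2 * euler_mascheroni + of_real (ln (X / (2 * pi)))) - ?L' / 4
      - pole_const k * of_real (real q / (2 * pi)) ^ (k + 1) / 2 * S"
    using theta_integral_eq[OF assms(1) X S(2)] by (simp add: diff_divide_distrib mult.assoc)
  also have "\<dots> = - ?L / 4 * (of_real (ln (8 * pi / a\<^sup>2)) + ?L' / ?L - 2 * euler_mascheroni) +
      ?L / 4 * of_real (ln x)
       + (-1) ^ ((k - 1) div 2) * of_nat (fact k) * of_nat q ^ k / (2 * (2 * of_real pi) ^ (k + 1)) *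
           gauss_sum q chi * S"
    \<comment> \<open>Nonvanishing of L(-k) turns the product of L with L'/L back into L'.\<close>
    unfolding const ln using L_nonzero[OF assms(1)]
    by (simp add: algebra_simps add_divide_distrib diff_divide_distrib)
  also have "S = (\<Sum>n. ?s n)" using S(1) by (rule sums_unique)
  finally have eq: "theta_integral k X / 2 = - ?L / 4 * (of_real (ln (8 * pi / a\<^sup>2)) + ?L' / ?L - 2
      * euler_mascheroni) + ?L / 4 * of_real (ln x)
       + (-1) ^ ((k - 1) div 2) * of_nat (fact k) * of_nat q ^ k / (2 * (2 * of_real pi) ^ (k + 1)) *
           gauss_sum q chi * (\<Sum>n. ?s n)" .
  show ?thesis
    using sums_summable[OF S(1)] main unfolding eq unfolding y_def by (rule conjI)
qed

end
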